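(* Let $(H,*,\mathcal G,\gamma)$ be a quasi-$*$ Hopf algebra over $\mathbb C$ and let ${}_H\mathcal M$ be the monoidal category of left $H$-modules (tensor product of modules via the coproduct, trivial associator, unit $\mathbb C$ with action by the counit). Then ${}_H\mathcal M$ can be made into a bar category as follows: for a left $H$-module $V$, $\overline V$ is the conjugate vector space (equal to $V$ as a set) with action $$h\triangleright\overline v=\overline{(Sh)^*\triangleright v},$$ $\overline\theta(\overline v)=\overline{\theta(v)}$ on morphisms, $\star:\mathbb C\to\overline{\mathbb C}$ is given by complex conjugation, and $$\Upsilon_{V,W}:\overline{V\otimes W}\to\overline W\otimes\overline V,\quad \Upsilon_{V,W}(\overline{v\otimes w})=\overline{\mathcal G^{(2)}\triangleright w}\otimes\overline{\mathcal G^{(1)}\triangleright v},\qquad \mathrm{bb}_V:V\to\overline{\overline V},\quad \mathrm{bb}_V(v)=\overline{\overline{\gamma\triangleright v}}.$$ The associated coboundary map $\Xi$ is $$\Xi(v\otimes w)=\gamma^{-1}(S\tilde{\mathcal G}^{(2)})^*\mathcal G^{(1)}\gamma_{(1)}\triangleright v\;\otimes\;\gamma^{-1}(S\tilde{\mathcal G}^{(1)})^*\mathcal G^{(2)}\gamma_{(2)}\triangleright w,$$ where $\tilde{\mathcal G}$ is a second independent copy of $\mathcal G$. The bar category ${}_H\mathcal M$ is strong precisely when the quasi-$*$ Hopf algebra $H$ is strong.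
   Context: Monoidal conventions: $\Phi_{X,Y,Z}:(X\otimes Y)\otimes Z\to X\otimes(Y\otimes Z)$, $l_X:X\to X\otimes 1$, $r_X:X\to 1\otimes X$ are the associator and unit isomorphisms. A bar category is a monoidal category with: a functor bar, written $X\mapsto\overline X$, $\theta\mapsto\overline\theta$; a natural isomorphism $\mathrm{bb}_X:X\to\overline{\overline X}$; an invertible morphism $\star:1\to\overline 1$; and a natural isomorphism $\Upsilon_{X,Y}:\overline{X\otimes Y}\to\overline Y\otimes\overline X$; such that (a) $(\star^{-1}\otimes\mathrm{id})\Upsilon_{X,1}\overline{l_X}=r_{\overline X}$ and $(\mathrm{id}\otimes\star^{-1})\Upsilon_{1,X}\overline{r_X}=l_{\overline X}$; (b) $\Phi_{\overline Z,\overline Y,\overline X}(\Upsilon_{Y,Z}\otimes\mathrm{id})\Upsilon_{X,Y\otimes Z}\overline{\Phi_{X,Y,Z}}=(\mathrm{id}\otimes\Upsilon_{X,Y})\Upsilon_{X\otimes Y,Z}$; (c) $\overline\star\,\star=\mathrm{bb}_1$; (d) $\overline{\mathrm{bb}_X}=\mathrm{bb}_{\overline X}$. The coboundary map $\Xi_{X,Y}:X\otimes Y\to X\otimes Y$ is defined by $(\mathrm{bb}_X\otimes\mathrm{bb}_Y)\,\Xi_{X,Y}=\Upsilon_{\overline Y,\overline X}\,\overline{\Upsilon_{X,Y}}\,\mathrm{bb}_{X\otimes Y}$. The bar category is strong if $\Xi=\mathrm{id}$. For a complex vector space $V$, $\overline V$ is the same abelian group, with $v\in V$ written $\overline v$ in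 $\overline V$, and $\lambda\overline v=\overline{\overline\lambda v}$ for $\lambda\in\mathbb C$. A quasi-$*$ Hopf algebra $(H,*,\mathcal G,\gamma)$: $H$ is a Hopf algebra over $\mathbb C$ (coproduct $\Delta h=h_{(1)}\otimes h_{(2)}$, counit $\epsilon$, invertible antipode $S$), and a $*$-algebra (antilinear, order-reversing involution $*$); $\mathcal G=\mathcal G^{(1)}\otimes\mathcal G^{(2)}\in H\otimes H$ (summation understood) is a 2-cocycle, i.e. invertible with $\mathcal G_{12}(\Delta\otimes\mathrm{id})(\mathcal G)=\mathcal G_{23}(\mathrm{id}\otimes\Delta)(\mathcal G)$ and $(\epsilon\otimes\mathrm{id})\mathcal G=1$; $\gamma\in H$ is invertible with $(S\gamma)^*=\gamma$; and for all $h\in H$ $$\Delta(h^* )=\mathcal G^{-1}(\Delta h)^{*\otimes *}\mathcal G,\quad \overline{\epsilon(h)}=\epsilon(h^* ),\quad S^{-1}(h^* )=\gamma^{-1}(Sh)^*\gamma.$$ It is strong if in addition $(\gamma\otimes\gamma)\Delta\gamma^{-1}=\big(( *\otimes * )(S\otimes S)(\mathcal G_{21})\big)\,\mathcal G$, where $\mathcal G_{21}=\mathcal G^{(2)}\otimes\mathcal G^{(1)}$.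
   Formalization: The claim that the modules form a bar category is proved under the added hypothesis ε(γ)=1, which axiom (c) forces and the definition does not imply (H=ℂ, γ=2 fails); the formulas for Υ and Ξ and the strong equivalence need no such hypothesis. *)

theory Defs
  imports Complex_Main "HOL-Algebra.Module"
begin

section \<open>Monoidal categories and bar categories\<close>

record ('o, 'm) category =
  Obj :: "'o set"
  Hom :: "'o \<Rightarrow> 'o \<Rightarrow> 'm set"
  ident :: "'o \<Rightarrow> 'm"
  comp :: "'m \<Rightarrow> 'm \<Rightarrow> 'm"  (infixr \<open>\<cdot>\<index>\<close> 55)

locale category =
  fixes C :: "('o, 'm, 'b) category_scheme" (structure)
  assumes ident_Hom: "X \<in> Obj C \<Longrightarrow> ident C X \<in> Hom C X X"
    and comp_Hom: "\<lbrakk>X \<in> Obj C; Y \<in> Obj C; Z \<in> Obj C; f \<in> Hom C X Y; g \<in> Hom C Y Z\<rbrakk>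
      \<Longrightarrow> g \<cdot> f \<in> Hom C X Z"
    and comp_ident_right: "\<lbrakk>X \<in> Obj C; Y \<in> Obj C; f \<in> Hom C X Y\<rbrakk> \<Longrightarrow> f \<cdot> ident C X = f"
    and comp_ident_left: "\<lbrakk>X \<in> Obj C; Y \<in> Obj C; f \<in> Hom C X Y\<rbrakk> \<Longrightarrow> ident C Y \<cdot> f = f"
    and comp_assoc: "\<lbrakk>W \<in> Obj C; X \<in> Obj C; Y \<in> Obj C; Z \<in> Obj C;
        f \<in> Hom C W X; g \<in> Hom C X Y; h \<in> Hom C Y Z\<rbrakk>
      \<Longrightarrow> (h \<cdot> g) \<cdot> f = h \<cdot> (g \<cdot> f)"
    and Hom_disjoint: "\<lbrakk>X \<in> Obj C; Y \<in> Obj C; X' \<in> Obj C; Y' \<in> Obj C;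
        f \<in> Hom C X Y; f \<in> Hom C X' Y'\<rbrakk> \<Longrightarrow> X = X' \<and> Y = Y'"

definition Iso :: "('o, 'm, 'b) category_scheme \<Rightarrow> 'o \<Rightarrow> 'o \<Rightarrow> 'm set" where
  "Iso C X Y = {f \<in> Hom C X Y. \<exists>g \<in> Hom C Y X.
     g \<cdot>\<^bsub>C\<^esub> f = ident C X \<and> f \<cdot>\<^bsub>C\<^esub> g = ident C Y}"

definition inverse_arrow :: "('o, 'm, 'b) category_scheme \<Rightarrow> 'o \<Rightarrow> 'o \<Rightarrow> 'm \<Rightarrow> 'm" where
  "inverse_arrow C X Y f = (THE g. g \<in> Hom C Y X \<and>
     g \<cdot>\<^bsub>C\<^esub> f = ident C X \<and> f \<cdot>\<^bsub>C\<^esub> g = ident C Y)"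

record ('o, 'm) monoidal = "('o, 'm) category" +
  tensor_obj :: "'o \<Rightarrow> 'o \<Rightarrow> 'o"  (infixl \<open>\<boxtimes>\<index>\<close> 70)
  tensor_arr :: "'m \<Rightarrow> 'm \<Rightarrow> 'm"  (infixl \<open>\<boxdot>\<index>\<close> 70)
  unit_obj :: "'o"
  assoc :: "'o \<Rightarrow> 'o \<Rightarrow> 'o \<Rightarrow> 'm"
  lunit :: "'o \<Rightarrow> 'm"
  runit :: "'o \<Rightarrow> 'm"

text \<open>
  \<open>lunit\<close> and \<open>runit\<close> are the unit isomorphisms \<open>l\<^sub>X : X \<rightarrow> X \<otimes> 1\<close> and
  \<open>r\<^sub>X : X \<rightarrow> 1 \<otimes> X\<close>, in this orientation.
\<close>

locale monoidal_category = category C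
  for C :: "('o, 'm, 'b) monoidal_scheme" (structure) +
  assumes tensor_obj: "\<lbrakk>X \<in> Obj C; Y \<in> Obj C\<rbrakk> \<Longrightarrow> X \<boxtimes> Y \<in> Obj C"
    and unit_obj: "unit_obj C \<in> Obj C"
    and tensor_arr: "\<lbrakk>X \<in> Obj C; X' \<in> Obj C; Y \<in> Obj C; Y' \<in> Obj C;
        f \<in> Hom C X X'; g \<in> Hom C Y Y'\<rbrakk> \<Longrightarrow> f \<boxdot> g \<in> Hom C (X \<boxtimes> Y) (X' \<boxtimes> Y')"
    and tensor_ident: "\<lbrakk>X \<in> Obj C; Y \<in> Obj C\<rbrakk>
      \<Longrightarrow> ident C X \<boxdot> ident C Y = ident C (X \<boxtimes> Y)"
    and tensor_comp: "\<lbrakk>X \<in> Obj C; X' \<in> Obj C; X'' \<in> Obj C; Y \<in> Obj C; Y' \<in> Obj C; Y'' \<in> Obj C;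
        f \<in> Hom C X X'; f' \<in> Hom C X' X''; g \<in> Hom C Y Y'; g' \<in> Hom C Y' Y''\<rbrakk>
      \<Longrightarrow> (f' \<cdot> f) \<boxdot> (g' \<cdot> g) = (f' \<boxdot> g') \<cdot> (f \<boxdot> g)"
    and assoc_Iso: "\<lbrakk>X \<in> Obj C; Y \<in> Obj C; Z \<in> Obj C\<rbrakk>
      \<Longrightarrow> assoc C X Y Z \<in> Iso C ((X \<boxtimes> Y) \<boxtimes> Z) (X \<boxtimes> (Y \<boxtimes> Z))"
    and assoc_natural: "\<lbrakk>X \<in> Obj C; X' \<in> Obj C; Y \<in> Obj C; Y' \<in> Obj C; Z \<in> Obj C; Z' \<in> Obj C;
        f \<in> Hom C X X'; g \<in> Hom C Y Y'; h \<in> Hom C Z Z'\<rbrakk>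
      \<Longrightarrow> assoc C X' Y' Z' \<cdot> ((f \<boxdot> g) \<boxdot> h) = (f \<boxdot> (g \<boxdot> h)) \<cdot> assoc C X Y Z"
    and lunit_Iso: "X \<in> Obj C \<Longrightarrow> lunit C X \<in> Iso C X (X \<boxtimes> unit_obj C)"
    and lunit_natural: "\<lbrakk>X \<in> Obj C; X' \<in> Obj C; f \<in> Hom C X X'\<rbrakk>
      \<Longrightarrow> lunit C X' \<cdot> f = (f \<boxdot> ident C (unit_obj C)) \<cdot> lunit C X"
    and runit_Iso: "X \<in> Obj C \<Longrightarrow> runit C X \<in> Iso C X (unit_obj C \<boxtimes> X)"
    and runit_natural: "\<lbrakk>X \<in> Obj C; X' \<in> Obj C; f \<in> Hom C X X'\<rbrakk>
      \<Longrightarrow> runit C X' \<cdot> f = (ident C (unit_obj C) \<boxdot> f) \<cdot> runit C X"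
    and pentagon: "\<lbrakk>W \<in> Obj C; X \<in> Obj C; Y \<in> Obj C; Z \<in> Obj C\<rbrakk>
      \<Longrightarrow> assoc C W X (Y \<boxtimes> Z) \<cdot> assoc C (W \<boxtimes> X) Y Z
        = (ident C W \<boxdot> assoc C X Y Z) \<cdot> assoc C W (X \<boxtimes> Y) Z \<cdot> (assoc C W X Y \<boxdot> ident C Z)"
    and triangle: "\<lbrakk>X \<in> Obj C; Y \<in> Obj C\<rbrakk>
      \<Longrightarrow> assoc C X (unit_obj C) Y \<cdot> (lunit C X \<boxdot> ident C Y) = ident C X \<boxdot> runit C Y"

record ('o, 'm) bar_structure = "('o, 'm) monoidal" +
  bar_obj :: "'o \<Rightarrow> 'o"
  bar_arr :: "'m \<Rightarrow> 'm"
  bb :: "'o \<Rightarrow> 'm"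
  star_arr :: "'m"
  Upsilon :: "'o \<Rightarrow> 'o \<Rightarrow> 'm"

locale bar_category = monoidal_category C
  for C :: "('o, 'm, 'b) bar_structure_scheme" (structure) +
  assumes bar_obj: "X \<in> Obj C \<Longrightarrow> bar_obj C X \<in> Obj C"
    and bar_arr: "\<lbrakk>X \<in> Obj C; Y \<in> Obj C; f \<in> Hom C X Y\<rbrakk>
      \<Longrightarrow> bar_arr C f \<in> Hom C (bar_obj C X) (bar_obj C Y)"
    and bar_ident: "X \<in> Obj C \<Longrightarrow> bar_arr C (ident C X) = ident C (bar_obj C X)"
    and bar_comp: "\<lbrakk>X \<in> Obj C; Y \<in> Obj C; Z \<in> Obj C; f \<in> Hom C X Y; g \<in> Hom C Y Z\<rbrakk>
      \<Longrightarrow> bar_arr C (g \<cdot> f) = bar_arr C g \<cdot> bar_arr C f"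
    and bb_Iso: "X \<in> Obj C \<Longrightarrow> bb C X \<in> Iso C X (bar_obj C (bar_obj C X))"
    and bb_natural: "\<lbrakk>X \<in> Obj C; X' \<in> Obj C; f \<in> Hom C X X'\<rbrakk>
      \<Longrightarrow> bb C X' \<cdot> f = bar_arr C (bar_arr C f) \<cdot> bb C X"
    and star_Iso: "star_arr C \<in> Iso C (unit_obj C) (bar_obj C (unit_obj C))"
    and Upsilon_Iso: "\<lbrakk>X \<in> Obj C; Y \<in> Obj C\<rbrakk>
      \<Longrightarrow> Upsilon C X Y \<in> Iso C (bar_obj C (X \<boxtimes> Y)) (bar_obj C Y \<boxtimes> bar_obj C X)"
    and Upsilon_natural: "\<lbrakk>X \<in> Obj C; X' \<in> Obj C; Y \<in> Obj C; Y' \<in> Obj C;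
        f \<in> Hom C X X'; g \<in> Hom C Y Y'\<rbrakk>
      \<Longrightarrow> Upsilon C X' Y' \<cdot> bar_arr C (f \<boxdot> g) = (bar_arr C g \<boxdot> bar_arr C f) \<cdot> Upsilon C X Y"
    and bar_lunit: "X \<in> Obj C \<Longrightarrow>
      (inverse_arrow C (unit_obj C) (bar_obj C (unit_obj C)) (star_arr C) \<boxdot> ident C (bar_obj C X))
        \<cdot> Upsilon C X (unit_obj C) \<cdot> bar_arr C (lunit C X) = runit C (bar_obj C X)"
    and bar_runit: "X \<in> Obj C \<Longrightarrow>
      (ident C (bar_obj C X) \<boxdot> inverse_arrow C (unit_obj C) (bar_obj C (unit_obj C)) (star_arr C))
        \<cdot> Upsilon C (unit_obj C) X \<cdot> bar_arr C (runit C X) = lunit C (bar_obj C X)"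
    and bar_assoc: "\<lbrakk>X \<in> Obj C; Y \<in> Obj C; Z \<in> Obj C\<rbrakk> \<Longrightarrow>
      assoc C (bar_obj C Z) (bar_obj C Y) (bar_obj C X)
        \<cdot> (Upsilon C Y Z \<boxdot> ident C (bar_obj C X)) \<cdot> Upsilon C X (Y \<boxtimes> Z) \<cdot> bar_arr C (assoc C X Y Z)
      = (ident C (bar_obj C Z) \<boxdot> Upsilon C X Y) \<cdot> Upsilon C (X \<boxtimes> Y) Z"
    and bar_star: "bar_arr C (star_arr C) \<cdot> star_arr C = bb C (unit_obj C)"
    and bar_bb: "X \<in> Obj C \<Longrightarrow> bar_arr C (bb C X) = bb C (bar_obj C X)"

definition coboundary :: "('o, 'm, 'b) bar_structure_scheme \<Rightarrow> 'o \<Rightarrow> 'o \<Rightarrow> 'm" where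
  "coboundary C X Y = (THE f. f \<in> Hom C (X \<boxtimes>\<^bsub>C\<^esub> Y) (X \<boxtimes>\<^bsub>C\<^esub> Y) \<and>
     (bb C X \<boxdot>\<^bsub>C\<^esub> bb C Y) \<cdot>\<^bsub>C\<^esub> f
       = Upsilon C (bar_obj C Y) (bar_obj C X) \<cdot>\<^bsub>C\<^esub> bar_arr C (Upsilon C X Y)
           \<cdot>\<^bsub>C\<^esub> bb C (X \<boxtimes>\<^bsub>C\<^esub> Y))"

locale strong_bar_category = bar_category C
  for C :: "('o, 'm, 'b) bar_structure_scheme" (structure) +
  assumes strong: "\<lbrakk>X \<in> Obj C; Y \<in> Obj C\<rbrakk> \<Longrightarrow> coboundary C X Y = ident C (X \<boxtimes> Y)"


section \<open>Complex vector spaces and their tensor products\<close>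

text \<open>
  All vector spaces live on subsets of the following type.  It is a universe over an arbitrary
  type \<open>'a\<close>: it contains \<open>'a\<close> (so every complex vector space, algebra or module carried by a
  subset of \<open>'a\<close> has an isomorphic copy in it) and the complex numbers, and it is closed under
  tensor products, whose elements are \<open>Tensor ts\<close> with \<open>ts\<close> a finite formal sum of pure tensors.
\<close>

datatype 'a univ =
    Elem 'a
  | Scalar (scalar: complex)
  | Tensor (summands: "('a univ \<times> 'a univ) list")

definition complex_ring :: "complex ring" where
  "complex_ring = \<lparr>carrier = UNIV, monoid.mult = (*), one = 1, zero = 0, add = (+)\<rparr>"

abbreviation vec_space :: "(complex, 'v, 'b) module_scheme \<Rightarrow> bool" where
  "vec_space V \<equiv> module complex_ring V"

text \<open>
  The fields \<open>mult\<close> and \<open>one\<close> which a \<open>module\<close> record inherits from \<open>ring\<close> play no role for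
  vector spaces; for algebras they are the multiplication and the unit.
\<close>

definition additive_map ::
  "(complex, 'v, 'b) module_scheme \<Rightarrow> (complex, 'w, 'c) module_scheme \<Rightarrow> ('v \<Rightarrow> 'w) \<Rightarrow> bool" where
  "additive_map V W f \<longleftrightarrow> f \<in> carrier V \<rightarrow> carrier W \<and>
     (\<forall>x \<in> carrier V. \<forall>y \<in> carrier V. f (x \<oplus>\<^bsub>V\<^esub> y) = f x \<oplus>\<^bsub>W\<^esub> f y)"

definition linear_map ::
  "(complex, 'v, 'b) module_scheme \<Rightarrow> (complex, 'w, 'c) module_scheme \<Rightarrow> ('v \<Rightarrow> 'w) \<Rightarrow> bool" where
  "linear_map V W f \<longleftrightarrow> additive_map V W f \<and>
     (\<forall>c. \<forall>x \<in> carrier V. f (c \<odot>\<^bsub>V\<^esub> x) = c \<odot>\<^bsub>W\<^esub> f x)"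

definition antilinear_map ::
  "(complex, 'v, 'b) module_scheme \<Rightarrow> (complex, 'w, 'c) module_scheme \<Rightarrow> ('v \<Rightarrow> 'w) \<Rightarrow> bool" where
  "antilinear_map V W f \<longleftrightarrow> additive_map V W f \<and>
     (\<forall>c. \<forall>x \<in> carrier V. f (c \<odot>\<^bsub>V\<^esub> x) = cnj c \<odot>\<^bsub>W\<^esub> f x)"

text \<open>
  A list of pairs \<open>(v, w)\<close> stands for the formal sum of the \<open>v \<otimes> w\<close>.  The tensor product is the
  quotient of these formal sums by the congruence generated by commutativity and bilinearity;
  each class is represented by one chosen list, so that elements stay inside \<open>'a univ\<close>.
\<close>

inductive tensor_eq ::
  "(complex, 'v, 'b) module_scheme \<Rightarrow> (complex, 'w, 'c) module_scheme \<Rightarrow>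
    ('v \<times> 'w) list \<Rightarrow> ('v \<times> 'w) list \<Rightarrow> bool"
  for V W where
  refl: "set xs \<subseteq> carrier V \<times> carrier W \<Longrightarrow> tensor_eq V W xs xs"
| sym: "tensor_eq V W xs ys \<Longrightarrow> tensor_eq V W ys xs"
| trans: "tensor_eq V W xs ys \<Longrightarrow> tensor_eq V W ys zs \<Longrightarrow> tensor_eq V W xs zs"
| append: "tensor_eq V W xs xs' \<Longrightarrow> tensor_eq V W ys ys' \<Longrightarrow> tensor_eq V W (xs @ ys) (xs' @ ys')"
| commute: "set (xs @ ys) \<subseteq> carrier V \<times> carrier W \<Longrightarrow> tensor_eq V W (xs @ ys) (ys @ xs)"
| zero: "w \<in> carrier W \<Longrightarrow> tensor_eq V W [(\<zero>\<^bsub>V\<^esub>, w)] []"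
| add_left: "v \<in> carrier V \<Longrightarrow> v' \<in> carrier V \<Longrightarrow> w \<in> carrier W \<Longrightarrow>
    tensor_eq V W [(v \<oplus>\<^bsub>V\<^esub> v', w)] [(v, w), (v', w)]"
| add_right: "v \<in> carrier V \<Longrightarrow> w \<in> carrier W \<Longrightarrow> w' \<in> carrier W \<Longrightarrow>
    tensor_eq V W [(v, w \<oplus>\<^bsub>W\<^esub> w')] [(v, w), (v, w')]"
| scale: "v \<in> carrier V \<Longrightarrow> w \<in> carrier W \<Longrightarrow>
    tensor_eq V W [(c \<odot>\<^bsub>V\<^esub> v, w)] [(v, c \<odot>\<^bsub>W\<^esub> w)]"

definition tensor_of ::
  "(complex, 'a univ, 'b) module_scheme \<Rightarrow> (complex, 'a univ, 'c) module_scheme \<Rightarrow>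
    ('a univ \<times> 'a univ) list \<Rightarrow> 'a univ" where
  "tensor_of V W xs = Tensor (SOME ys. tensor_eq V W xs ys)"

definition pure ::
  "(complex, 'a univ, 'b) module_scheme \<Rightarrow> (complex, 'a univ, 'c) module_scheme \<Rightarrow>
    'a univ \<Rightarrow> 'a univ \<Rightarrow> 'a univ" where
  "pure V W v w = tensor_of V W [(v, w)]"

text \<open>
  The fields \<open>mult\<close> and \<open>one\<close> make the tensor product of two algebras an algebra, with
  \<open>(a \<otimes> b)(c \<otimes> d) = ac \<otimes> bd\<close>.
\<close>

definition tensor ::
  "(complex, 'a univ, 'b) module_scheme \<Rightarrow> (complex, 'a univ, 'c) module_scheme \<Rightarrow>
    (complex, 'a univ) module" where
  "tensor V W = \<lparr>
     carrier = tensor_of V W ` {xs. set xs \<subseteq> carrier V \<times> carrier W},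
     monoid.mult = (\<lambda>s t. tensor_of V W
       [(a \<otimes>\<^bsub>V\<^esub> c, b \<otimes>\<^bsub>W\<^esub> d). (a, b) \<leftarrow> summands s, (c, d) \<leftarrow> summands t]),
     one = pure V W \<one>\<^bsub>V\<^esub> \<one>\<^bsub>W\<^esub>,
     zero = tensor_of V W [],
     add = (\<lambda>s t. tensor_of V W (summands s @ summands t)),
     smult = (\<lambda>k t. tensor_of V W [(k \<odot>\<^bsub>V\<^esub> v, w). (v, w) \<leftarrow> summands t])\<rparr>"

text \<open>
  \<open>sweedler U t \<beta>\<close> is the sum in \<open>U\<close> of the \<open>\<beta> v w\<close> over the summands \<open>v \<otimes> w\<close> of \<open>t\<close>, i.e.\
  \<open>\<beta> t\<^sup>(\<^sup>1\<^sup>) t\<^sup>(\<^sup>2\<^sup>)\<close> with summation understood.  If \<open>\<beta>\<close> is biadditive and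
  \<open>\<beta> (c v) w = \<beta> v (c w)\<close>, this is the additive map induced on the tensor product by \<open>\<beta>\<close>, and
  it does not depend on the chosen representative.
\<close>

definition sweedler ::
  "(complex, 'u, 'b) module_scheme \<Rightarrow> 'a univ \<Rightarrow> ('a univ \<Rightarrow> 'a univ \<Rightarrow> 'u) \<Rightarrow> 'u" where
  "sweedler U t \<beta> = foldr (\<lambda>(v, w) s. \<beta> v w \<oplus>\<^bsub>U\<^esub> s) (summands t) \<zero>\<^bsub>U\<^esub>"

definition tensor_map ::
  "(complex, 'a univ, 'b) module_scheme \<Rightarrow> (complex, 'a univ, 'c) module_scheme \<Rightarrow>
    ('a univ \<Rightarrow> 'a univ) \<Rightarrow> ('a univ \<Rightarrow> 'a univ) \<Rightarrow> 'a univ \<Rightarrow> 'a univ" where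
  "tensor_map V' W' f g t = sweedler (tensor V' W') t (\<lambda>v w. pure V' W' (f v) (g w))"

definition flip ::
  "(complex, 'a univ, 'b) module_scheme \<Rightarrow> (complex, 'a univ, 'c) module_scheme \<Rightarrow>
    'a univ \<Rightarrow> 'a univ" where
  "flip V W t = sweedler (tensor W V) t (\<lambda>v w. pure W V w v)"

definition reassoc ::
  "(complex, 'a univ, 'b) module_scheme \<Rightarrow> (complex, 'a univ, 'c) module_scheme \<Rightarrow>
    (complex, 'a univ, 'd) module_scheme \<Rightarrow> 'a univ \<Rightarrow> 'a univ" where
  "reassoc U V W t = sweedler (tensor U (tensor V W)) t (\<lambda>s w.
     sweedler (tensor U (tensor V W)) s (\<lambda>u v. pure U (tensor V W) u (pure V W v w)))"


section \<open>Quasi-star Hopf algebras\<close>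

locale complex_algebra =
  fixes H :: "(complex, 'v, 'b) module_scheme" (structure)
  assumes ring: "ring H"
    and vec_space: "vec_space H"
    and smult_mult_left: "\<lbrakk>x \<in> carrier H; y \<in> carrier H\<rbrakk> \<Longrightarrow> (c \<odot> x) \<otimes> y = c \<odot> (x \<otimes> y)"
    and smult_mult_right: "\<lbrakk>x \<in> carrier H; y \<in> carrier H\<rbrakk> \<Longrightarrow> x \<otimes> (c \<odot> y) = c \<odot> (x \<otimes> y)"

record 'v hopf = "(complex, 'v) module" +
  coprod :: "'v \<Rightarrow> 'v"
  counit :: "'v \<Rightarrow> complex"
  antipode :: "'v \<Rightarrow> 'v"

locale hopf_algebra = complex_algebra H
  for H :: "('a univ, 'b) hopf_scheme" (structure) +
  assumes coprod_linear: "linear_map H (tensor H H) (coprod H)"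
    and coprod_mult: "\<lbrakk>h \<in> carrier H; k \<in> carrier H\<rbrakk>
      \<Longrightarrow> coprod H (h \<otimes> k) = coprod H h \<otimes>\<^bsub>tensor H H\<^esub> coprod H k"
    and coprod_one: "coprod H \<one> = \<one>\<^bsub>tensor H H\<^esub>"
    and counit_add: "\<lbrakk>h \<in> carrier H; k \<in> carrier H\<rbrakk> \<Longrightarrow> counit H (h \<oplus> k) = counit H h + counit H k"
    and counit_smult: "h \<in> carrier H \<Longrightarrow> counit H (c \<odot> h) = c * counit H h"
    and counit_mult: "\<lbrakk>h \<in> carrier H; k \<in> carrier H\<rbrakk> \<Longrightarrow> counit H (h \<otimes> k) = counit H h * counit H k"
    and counit_one: "counit H \<one> = 1"
    and coassoc: "h \<in> carrier H \<Longrightarrow>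
      reassoc H H H (tensor_map (tensor H H) H (coprod H) (\<lambda>x. x) (coprod H h))
        = tensor_map H (tensor H H) (\<lambda>x. x) (coprod H) (coprod H h)"
    and counit_left: "h \<in> carrier H \<Longrightarrow> sweedler H (coprod H h) (\<lambda>x y. counit H x \<odot> y) = h"
    and counit_right: "h \<in> carrier H \<Longrightarrow> sweedler H (coprod H h) (\<lambda>x y. counit H y \<odot> x) = h"
    and antipode_linear: "linear_map H H (antipode H)"
    and antipode_left: "h \<in> carrier H \<Longrightarrow>
      sweedler H (coprod H h) (\<lambda>x y. antipode H x \<otimes> y) = counit H h \<odot> \<one>"
    and antipode_right: "h \<in> carrier H \<Longrightarrow>
      sweedler H (coprod H h) (\<lambda>x y. x \<otimes> antipode H y) = counit H h \<odot> \<one>"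
    and antipode_bij: "bij_betw (antipode H) (carrier H) (carrier H)"

record 'v quasi_star_hopf = "'v hopf" +
  star :: "'v \<Rightarrow> 'v"
  twist :: "'v"  (\<open>\<G>\<index>\<close>)
  gam :: "'v"  (\<open>\<gamma>\<index>\<close>)

locale quasi_star_hopf_algebra = hopf_algebra H
  for H :: "('a univ, 'b) quasi_star_hopf_scheme" (structure) +
  assumes star_antilinear: "antilinear_map H H (star H)"
    and star_mult: "\<lbrakk>h \<in> carrier H; k \<in> carrier H\<rbrakk> \<Longrightarrow> star H (h \<otimes> k) = star H k \<otimes> star H h"
    and star_star: "h \<in> carrier H \<Longrightarrow> star H (star H h) = h"
    and twist_unit: "\<G> \<in> Units (tensor H H)"
    and twist_cocycle:
      \<comment> \<open>\<open>\<G>\<^sub>1\<^sub>2 (\<Delta> \<otimes> id)(\<G>) = \<G>\<^sub>2\<^sub>3 (id \<otimes> \<Delta>)(\<G>)\<close>, with the left-hand side, an element of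
        \<open>(H \<otimes> H) \<otimes> H\<close>, rebracketed\<close>
      "reassoc H H H
         (pure (tensor H H) H \<G> \<one> \<otimes>\<^bsub>tensor (tensor H H) H\<^esub>
            tensor_map (tensor H H) H (coprod H) (\<lambda>x. x) \<G>)
       = pure H (tensor H H) \<one> \<G> \<otimes>\<^bsub>tensor H (tensor H H)\<^esub>
            tensor_map H (tensor H H) (\<lambda>x. x) (coprod H) \<G>"
    and twist_counit: "sweedler H \<G> (\<lambda>x y. counit H x \<odot> y) = \<one>"
    and gam_unit: "\<gamma> \<in> Units H"
    and gam_star: "star H (antipode H \<gamma>) = \<gamma>"
    and coprod_star: "h \<in> carrier H \<Longrightarrow>
      coprod H (star H h) = inv\<^bsub>tensor H H\<^esub> \<G> \<otimes>\<^bsub>tensor H H\<^esub>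
        tensor_map H H (star H) (star H) (coprod H h) \<otimes>\<^bsub>tensor H H\<^esub> \<G>"
    and counit_star: "h \<in> carrier H \<Longrightarrow> cnj (counit H h) = counit H (star H h)"
    and antipode_star: "h \<in> carrier H \<Longrightarrow>
      inv_into (carrier H) (antipode H) (star H h) = inv \<gamma> \<otimes> star H (antipode H h) \<otimes> \<gamma>"

locale strong_quasi_star_hopf_algebra = quasi_star_hopf_algebra H
  for H :: "('a univ, 'b) quasi_star_hopf_scheme" (structure) +
  assumes strong: "pure H H \<gamma> \<gamma> \<otimes>\<^bsub>tensor H H\<^esub> coprod H (inv \<gamma>)
    = tensor_map H H (star H) (star H) (tensor_map H H (antipode H) (antipode H) (flip H H \<G>))
        \<otimes>\<^bsub>tensor H H\<^esub> \<G>"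

text \<open>
  The axioms above allow \<open>\<epsilon>(\<gamma>) \<noteq> 1\<close>, e.g.\ \<open>\<gamma> = 2\<close> in \<open>H = \<complex>\<close>.  The unit axiom
  \<open>bar_star\<close> of a bar category evaluates on \<open>H\<close>-modules to \<open>\<epsilon>(\<gamma>) = 1\<close>.  The strong
  condition implies \<open>\<epsilon>(\<gamma>) = 1\<close>: apply \<open>\<epsilon> \<otimes> \<epsilon>\<close> to it.
\<close>


section \<open>The category of left modules over a Hopf algebra\<close>

record ('h, 'v) lmod = "(complex, 'v) module" +
  act :: "'h \<Rightarrow> 'v \<Rightarrow> 'v"  (infixr \<open>\<triangleright>\<index>\<close> 75)

locale left_module =
  fixes H :: "(complex, 'h, 'b) module_scheme" and V :: "('h, 'v, 'c) lmod_scheme" (structure)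
  assumes vec_space: "vec_space V"
    and act_linear: "h \<in> carrier H \<Longrightarrow> linear_map V V (\<lambda>v. h \<triangleright> v)"
    and act_add: "\<lbrakk>h \<in> carrier H; k \<in> carrier H; v \<in> carrier V\<rbrakk>
      \<Longrightarrow> (h \<oplus>\<^bsub>H\<^esub> k) \<triangleright> v = (h \<triangleright> v) \<oplus> (k \<triangleright> v)"
    and act_smult: "\<lbrakk>h \<in> carrier H; v \<in> carrier V\<rbrakk> \<Longrightarrow> (c \<odot>\<^bsub>H\<^esub> h) \<triangleright> v = c \<odot> (h \<triangleright> v)"
    and act_mult: "\<lbrakk>h \<in> carrier H; k \<in> carrier H; v \<in> carrier V\<rbrakk>
      \<Longrightarrow> (h \<otimes>\<^bsub>H\<^esub> k) \<triangleright> v = h \<triangleright> k \<triangleright> v"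
    and act_one: "v \<in> carrier V \<Longrightarrow> \<one>\<^bsub>H\<^esub> \<triangleright> v = v"

datatype ('h, 'v) arrow =
  Arrow (src: "('h, 'v) lmod") (trg: "('h, 'v) lmod") (fn: "'v \<Rightarrow> 'v")

definition module_hom ::
  "(complex, 'h, 'b) module_scheme \<Rightarrow> ('h, 'v) lmod \<Rightarrow> ('h, 'v) lmod \<Rightarrow> ('h, 'v) arrow set" where
  "module_hom H V W = {Arrow V W f | f. f \<in> extensional (carrier V) \<and> linear_map V W f \<and>
     (\<forall>h \<in> carrier H. \<forall>v \<in> carrier V. f (h \<triangleright>\<^bsub>V\<^esub> v) = h \<triangleright>\<^bsub>W\<^esub> f v)}"

definition tensor_lmod ::
  "('a univ, 'b) hopf_scheme \<Rightarrow> ('a univ, 'a univ) lmod \<Rightarrow> ('a univ, 'a univ) lmod \<Rightarrow>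
    ('a univ, 'a univ) lmod" where
  "tensor_lmod H V W = module.extend (tensor V W) (lmod.fields
     (\<lambda>h t. sweedler (tensor V W) (coprod H h) (\<lambda>h\<^sub>1 h\<^sub>2.
        tensor_map V W (\<lambda>v. h\<^sub>1 \<triangleright>\<^bsub>V\<^esub> v) (\<lambda>w. h\<^sub>2 \<triangleright>\<^bsub>W\<^esub> w) t)))"

definition unit_lmod :: "('a univ, 'b) hopf_scheme \<Rightarrow> ('a univ, 'a univ) lmod" where
  "unit_lmod H = \<lparr>
     carrier = range Scalar,
     monoid.mult = (\<lambda>x y. Scalar (scalar x * scalar y)),
     one = Scalar 1,
     zero = Scalar 0,
     add = (\<lambda>x y. Scalar (scalar x + scalar y)),
     smult = (\<lambda>c x. Scalar (c * scalar x)),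
     act = (\<lambda>h x. Scalar (counit H h * scalar x))\<rparr>"

text \<open>The conjugate module has the same underlying abelian group, so \<open>v\<close> also denotes its conjugate.\<close>

definition bar_lmod ::
  "('a univ, 'b) quasi_star_hopf_scheme \<Rightarrow> ('a univ, 'a univ) lmod \<Rightarrow> ('a univ, 'a univ) lmod" where
  "bar_lmod H V = V\<lparr>
     smult := (\<lambda>c v. cnj c \<odot>\<^bsub>V\<^esub> v),
     act := (\<lambda>h v. star H (antipode H h) \<triangleright>\<^bsub>V\<^esub> v)\<rparr>"

definition monoidal_lmod ::
  "('a univ, 'b) hopf_scheme \<Rightarrow>
    (('a univ, 'a univ) lmod, ('a univ, 'a univ) arrow) monoidal" where
  "monoidal_lmod H = \<lparr>
     Obj = {V. left_module H V},
     Hom = module_hom H,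
     ident = (\<lambda>V. Arrow V V (\<lambda>v \<in> carrier V. v)),
     comp = (\<lambda>g f. Arrow (src f) (trg g) (compose (carrier (src f)) (fn g) (fn f))),
     tensor_obj = tensor_lmod H,
     tensor_arr = (\<lambda>f g.
       Arrow (tensor_lmod H (src f) (src g)) (tensor_lmod H (trg f) (trg g))
         (\<lambda>t \<in> carrier (tensor (src f) (src g)). tensor_map (trg f) (trg g) (fn f) (fn g) t)),
     unit_obj = unit_lmod H,
     assoc = (\<lambda>U V W.
       Arrow (tensor_lmod H (tensor_lmod H U V) W) (tensor_lmod H U (tensor_lmod H V W))
         (\<lambda>t \<in> carrier (tensor (tensor_lmod H U V) W).
            sweedler (tensor U (tensor_lmod H V W)) t (\<lambda>s w.
              sweedler (tensor U (tensor_lmod H V W)) s (\<lambda>u v.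
                pure U (tensor_lmod H V W) u (pure V W v w))))),
     lunit = (\<lambda>V. Arrow V (tensor_lmod H V (unit_lmod H))
       (\<lambda>v \<in> carrier V. pure V (unit_lmod H) v (Scalar 1))),
     runit = (\<lambda>V. Arrow V (tensor_lmod H (unit_lmod H) V)
       (\<lambda>v \<in> carrier V. pure (unit_lmod H) V (Scalar 1) v))\<rparr>"

definition bar_lmod_category ::
  "('a univ, 'b) quasi_star_hopf_scheme \<Rightarrow>
    (('a univ, 'a univ) lmod, ('a univ, 'a univ) arrow) bar_structure" where
  "bar_lmod_category H = monoidal.extend (monoidal_lmod H) (bar_structure.fields
     (bar_lmod H)
     (\<lambda>f. Arrow (bar_lmod H (src f)) (bar_lmod H (trg f)) (fn f))
     (\<lambda>V. Arrow V (bar_lmod H (bar_lmod H V)) (\<lambda>v \<in> carrier V. \<gamma>\<^bsub>H\<^esub> \<triangleright>\<^bsub>V\<^esub> v))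
     (Arrow (unit_lmod H) (bar_lmod H (unit_lmod H))
        (\<lambda>x \<in> range Scalar. Scalar (cnj (scalar x))))
     (\<lambda>V W. Arrow (bar_lmod H (tensor_lmod H V W)) (tensor_lmod H (bar_lmod H W) (bar_lmod H V))
        (\<lambda>t \<in> carrier (tensor V W).
           sweedler (tensor (bar_lmod H W) (bar_lmod H V)) t (\<lambda>v w.
             sweedler (tensor (bar_lmod H W) (bar_lmod H V)) \<G>\<^bsub>H\<^esub> (\<lambda>g\<^sub>1 g\<^sub>2.
               pure (bar_lmod H W) (bar_lmod H V) (g\<^sub>2 \<triangleright>\<^bsub>W\<^esub> w) (g\<^sub>1 \<triangleright>\<^bsub>V\<^esub> v))))))"

end

theory Submission
  imports Defs
begin

text \<open>
  If \<open>V\<close> is a module over \<open>A\<close> and \<open>W\<close> a module over \<open>B\<close>, then \<open>V \<otimes> W\<close> is a module over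
  \<open>A \<otimes> B\<close>.  In these terms \<open>h\<close> acts on \<open>V \<otimes> W\<close> as \<open>\<Delta>h\<close>, and \<open>\<Upsilon>\<close> is the action of \<open>\<G>\<close>
  followed by the flip.  Write \<open>h\<^sup>\<dagger> = (Sh)\<^sup>*\<close>, an antilinear ring endomorphism of \<open>H\<close>.  Since \<open>S\<close>
  reverses the coproduct, the axioms give \<open>\<G> \<Delta>(h\<^sup>\<dagger>) = (\<dagger> \<otimes> \<dagger>)(\<Delta>h)\<^sub>2\<^sub>1 \<G>\<close>, which makes \<open>\<Upsilon>\<close>
  equivariant, and \<open>\<gamma> h = h\<^sup>\<dagger>\<^sup>\<dagger> \<gamma>\<close>, which makes \<open>bb\<close> equivariant.  The associativity axiom is the
  cocycle identity acting on a triple tensor product, and the unit axioms hold because both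
  counit contractions of \<open>\<G>\<close> are \<open>1\<close>.  The coboundary map is the action of
  \<open>\<xi> = (\<gamma>\<inverse> \<otimes> \<gamma>\<inverse>) (\<dagger> \<otimes> \<dagger>)(\<G>\<^sub>2\<^sub>1) \<G> \<Delta>\<gamma>\<close>; evaluated at \<open>1 \<otimes> 1\<close> in the regular module it shows
  that the bar category is strong iff \<open>\<xi> = 1\<close>, which is the strong condition on \<open>H\<close> and which
  forces \<open>\<epsilon>(\<gamma>) = 1\<close> under \<open>\<epsilon> \<otimes> \<epsilon>\<close>.
\<close>

section \<open>Tensor products of vector spaces\<close>

text \<open>A tensor is a chosen list of pairs, so a Sweedler sum has meaning only for a balanced
  summand, and equations between structure maps are checked on pure tensors. Conjugation is
  antilinear, which rules out a purely bilinear theory; the common ground is additivity. It suffices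
  because every tensor is a sum of pure ones, and because scalars act on modules through H, so that
  additive equivariant maps are linear. For conjugate spaces the congruence on formal sums is the
  same predicate as before, hence the chosen representatives are the same too: bars disappear from
  all formulas except in scalars and actions, and no comparison isomorphism is carried along. That S
  reverses products and coproducts is derived from uniqueness of convolution inverses, and the
  second counit contraction of \<G> from the cocycle identity. The condition \<epsilon>(\<gamma>) =
  1 comes from the unit object: complex conjugation applied twice is the identity, while bb at the
  unit is multiplication by \<epsilon>(\<gamma>).\<close>

type_synonym ('a, 'b) univ_space = "(complex, 'a univ, 'b) module_scheme"

section \<open>Vector space laws with scalars of type \<open>complex\<close>\<close>

lemma cring_complex_ring: "cring complex_ring"
  by (rule cringI, rule abelian_groupI)
    (auto simp: complex_ring_def algebra_simps intro!: comm_monoidI exI[of _ "- _"])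

lemma vec_spaceI:
  assumes "abelian_group V"
    and "\<And>c x. x \<in> carrier V \<Longrightarrow> c \<odot>\<^bsub>V\<^esub> x \<in> carrier V"
    and "\<And>c d x. x \<in> carrier V \<Longrightarrow> (c + d) \<odot>\<^bsub>V\<^esub> x = c \<odot>\<^bsub>V\<^esub> x \<oplus>\<^bsub>V\<^esub> d \<odot>\<^bsub>V\<^esub> x"
    and "\<And>c x y. x \<in> carrier V \<Longrightarrow> y \<in> carrier V \<Longrightarrow> c \<odot>\<^bsub>V\<^esub> (x \<oplus>\<^bsub>V\<^esub> y) = c \<odot>\<^bsub>V\<^esub> x \<oplus>\<^bsub>V\<^esub> c \<odot>\<^bsub>V\<^esub> y"
    and "\<And>c d x. x \<in> carrier V \<Longrightarrow> (c * d) \<odot>\<^bsub>V\<^esub> x = c \<odot>\<^bsub>V\<^esub> (d \<odot>\<^bsub>V\<^esub> x)"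
    and "\<And>x. x \<in> carrier V \<Longrightarrow> 1 \<odot>\<^bsub>V\<^esub> x = x"
  shows "vec_space V"
  by (rule moduleI[OF cring_complex_ring assms(1)]) (simp_all add: complex_ring_def assms(2-))

context
  fixes V :: "(complex, 'v, 'b) module_scheme" (structure)
  assumes V: "vec_space V"
begin

interpretation module complex_ring V by (rule V)

lemma vec_abelian_group: "abelian_group V" ..
lemma vec_zero [simp]: "\<zero> \<in> carrier V" by simp
lemma vec_add [simp]: "\<lbrakk>x \<in> carrier V; y \<in> carrier V\<rbrakk> \<Longrightarrow> x \<oplus> y \<in> carrier V" by simp
lemma vec_smult [simp]: "x \<in> carrier V \<Longrightarrow> c \<odot> x \<in> carrier V"
  using smult_closed[of c x] by (simp add: complex_ring_def)
lemma vec_add_zero [simp]: "x \<in> carrier V \<Longrightarrow> x \<oplus> \<zero> = x" by simp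
lemma vec_zero_add [simp]: "x \<in> carrier V \<Longrightarrow> \<zero> \<oplus> x = x" by simp
lemma vec_add_assoc: "\<lbrakk>x \<in> carrier V; y \<in> carrier V; z \<in> carrier V\<rbrakk> \<Longrightarrow> (x \<oplus> y) \<oplus> z = x \<oplus> (y \<oplus> z)"
  by (rule a_assoc)
lemma vec_add_comm: "\<lbrakk>x \<in> carrier V; y \<in> carrier V\<rbrakk> \<Longrightarrow> x \<oplus> y = y \<oplus> x"
  by (rule a_comm)
lemma vec_add_left_comm: "\<lbrakk>x \<in> carrier V; y \<in> carrier V; z \<in> carrier V\<rbrakk> \<Longrightarrow> x \<oplus> (y \<oplus> z) = y \<oplus> (x \<oplus> z)"
  by (rule a_lcomm)
lemma vec_smult_add_left: "x \<in> carrier V \<Longrightarrow> (c + d) \<odot> x = c \<odot> x \<oplus> d \<odot> x"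
  using smult_l_distr[of c d x] by (simp add: complex_ring_def)
lemma vec_smult_add: "\<lbrakk>x \<in> carrier V; y \<in> carrier V\<rbrakk> \<Longrightarrow> c \<odot> (x \<oplus> y) = c \<odot> x \<oplus> c \<odot> y"
  using smult_r_distr[of c x y] by (simp add: complex_ring_def)
lemma vec_smult_smult: "x \<in> carrier V \<Longrightarrow> c \<odot> (d \<odot> x) = (c * d) \<odot> x"
  using smult_assoc1[of c d x] by (simp add: complex_ring_def)
lemma vec_smult_one [simp]: "x \<in> carrier V \<Longrightarrow> 1 \<odot> x = x"
  using smult_one[of x] by (simp add: complex_ring_def)
lemma vec_smult_zero_left [simp]: "x \<in> carrier V \<Longrightarrow> 0 \<odot> x = \<zero>"
  using smult_l_null[of x] by (simp add: complex_ring_def)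
lemma vec_smult_zero [simp]: "c \<odot> \<zero> = \<zero>"
  using smult_r_null[of c] by (simp add: complex_ring_def)
text \<open>Cancellation in the form that makes additive and balanced maps vanish at zero: there x =
  x + x comes from 0 + 0 = 0.\<close>

lemma vec_add_self: "\<lbrakk>x \<in> carrier V; x \<oplus> x = x\<rbrakk> \<Longrightarrow> x = \<zero>"
  using add.r_cancel_one' by auto

end

lemmas vec_ac = vec_add_assoc vec_add_comm vec_add_left_comm

section \<open>Additive and linear maps\<close>

lemma additive_mapI:
  "\<lbrakk>\<And>x. x \<in> carrier V \<Longrightarrow> f x \<in> carrier W;
    \<And>x y. x \<in> carrier V \<Longrightarrow> y \<in> carrier V \<Longrightarrow> f (x \<oplus>\<^bsub>V\<^esub> y) = f x \<oplus>\<^bsub>W\<^esub> f y\<rbrakk> \<Longrightarrow> additive_map V W f"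
  by (auto simp: additive_map_def)

lemma additive_map_closed: "\<lbrakk>additive_map V W f; x \<in> carrier V\<rbrakk> \<Longrightarrow> f x \<in> carrier W"
  by (auto simp: additive_map_def)

lemma additive_map_add:
  "\<lbrakk>additive_map V W f; x \<in> carrier V; y \<in> carrier V\<rbrakk> \<Longrightarrow> f (x \<oplus>\<^bsub>V\<^esub> y) = f x \<oplus>\<^bsub>W\<^esub> f y"
  by (auto simp: additive_map_def)

lemma additive_map_zero:
  assumes "vec_space V" "vec_space W" "additive_map V W f"
  shows "f \<zero>\<^bsub>V\<^esub> = \<zero>\<^bsub>W\<^esub>"
  using assms additive_map_add[OF assms(3), of "\<zero>\<^bsub>V\<^esub>" "\<zero>\<^bsub>V\<^esub>"]
  by (intro vec_add_self[of W]) (auto intro: additive_map_closed)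

lemma additive_map_compose:
  "\<lbrakk>additive_map U V f; additive_map V W g\<rbrakk> \<Longrightarrow> additive_map U W (\<lambda>x. g (f x))"
  by (auto simp: additive_map_def Pi_iff)

lemma linear_mapI:
  "\<lbrakk>\<And>x. x \<in> carrier V \<Longrightarrow> f x \<in> carrier W;
    \<And>x y. x \<in> carrier V \<Longrightarrow> y \<in> carrier V \<Longrightarrow> f (x \<oplus>\<^bsub>V\<^esub> y) = f x \<oplus>\<^bsub>W\<^esub> f y;
    \<And>c x. x \<in> carrier V \<Longrightarrow> f (c \<odot>\<^bsub>V\<^esub> x) = c \<odot>\<^bsub>W\<^esub> f x\<rbrakk> \<Longrightarrow> linear_map V W f"
  by (auto simp: linear_map_def additive_map_def)

lemma linear_map_additive: "linear_map V W f \<Longrightarrow> additive_map V W f"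
  by (simp add: linear_map_def)

lemma linear_map_closed: "\<lbrakk>linear_map V W f; x \<in> carrier V\<rbrakk> \<Longrightarrow> f x \<in> carrier W"
  by (auto simp: linear_map_def additive_map_def)

lemma linear_map_add:
  "\<lbrakk>linear_map V W f; x \<in> carrier V; y \<in> carrier V\<rbrakk> \<Longrightarrow> f (x \<oplus>\<^bsub>V\<^esub> y) = f x \<oplus>\<^bsub>W\<^esub> f y"
  by (auto simp: linear_map_def additive_map_def)

lemma linear_map_smult:
  "\<lbrakk>linear_map V W f; x \<in> carrier V\<rbrakk> \<Longrightarrow> f (c \<odot>\<^bsub>V\<^esub> x) = c \<odot>\<^bsub>W\<^esub> f x"
  by (auto simp: linear_map_def)

lemma linear_map_id: "linear_map V V (\<lambda>x. x)"
  by (rule linear_mapI) auto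

section \<open>Finite sums over lists\<close>

definition list_sum :: "(complex, 'u, 'b) module_scheme \<Rightarrow> ('i \<Rightarrow> 'u) \<Rightarrow> 'i list \<Rightarrow> 'u" where
  "list_sum U f xs = foldr (\<lambda>x s. f x \<oplus>\<^bsub>U\<^esub> s) xs \<zero>\<^bsub>U\<^esub>"

lemma list_sum_simps [simp]:
  "list_sum U f [] = \<zero>\<^bsub>U\<^esub>"
  "list_sum U f (x # xs) = f x \<oplus>\<^bsub>U\<^esub> list_sum U f xs"
  by (simp_all add: list_sum_def)

text \<open>Reads a Sweedler sum as a sum over a single index ranging over pairs, so that the
  inductions on lists apply to it.\<close>

lemma sweedler_eq_list_sum: "sweedler U t \<beta> = list_sum U (\<lambda>(v, w). \<beta> v w) (summands t)"
  unfolding sweedler_def list_sum_def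
  by (rule arg_cong[where f = "\<lambda>g. foldr g (summands t) \<zero>\<^bsub>U\<^esub>"]) (auto simp: fun_eq_iff)

lemma list_sum_closed:
  "\<lbrakk>vec_space U; \<And>x. x \<in> set xs \<Longrightarrow> f x \<in> carrier U\<rbrakk> \<Longrightarrow> list_sum U f xs \<in> carrier U"
  by (induct xs) auto

lemma list_sum_cong:
  "\<lbrakk>\<And>x. x \<in> set xs \<Longrightarrow> f x = g x\<rbrakk> \<Longrightarrow> list_sum U f xs = list_sum U g xs"
  by (induct xs) auto

lemma list_sum_append:
  "\<lbrakk>vec_space U; \<And>x. x \<in> set xs \<union> set ys \<Longrightarrow> f x \<in> carrier U\<rbrakk>
    \<Longrightarrow> list_sum U f (xs @ ys) = list_sum U f xs \<oplus>\<^bsub>U\<^esub> list_sum U f ys"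
  by (induct xs) (auto simp: list_sum_closed vec_add_assoc)

lemma list_sum_add:
  "\<lbrakk>vec_space U; \<And>x. x \<in> set xs \<Longrightarrow> f x \<in> carrier U; \<And>x. x \<in> set xs \<Longrightarrow> g x \<in> carrier U\<rbrakk>
    \<Longrightarrow> list_sum U (\<lambda>x. f x \<oplus>\<^bsub>U\<^esub> g x) xs = list_sum U f xs \<oplus>\<^bsub>U\<^esub> list_sum U g xs"
  by (induct xs) (auto simp: list_sum_closed vec_ac)

lemma list_sum_additive:
  "\<lbrakk>vec_space U; vec_space U'; additive_map U U' \<phi>; \<And>x. x \<in> set xs \<Longrightarrow> f x \<in> carrier U\<rbrakk>
    \<Longrightarrow> \<phi> (list_sum U f xs) = list_sum U' (\<lambda>x. \<phi> (f x)) xs"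
  by (induct xs) (auto simp: list_sum_closed additive_map_zero additive_map_add)

lemma list_sum_map: "list_sum U f (map g xs) = list_sum U (\<lambda>x. f (g x)) xs"
  by (induct xs) auto

text \<open>The formal sum representing a product of two tensors is a concatenation of lists; this
  rule evaluates sums over it.\<close>

lemma list_sum_concat:
  "\<lbrakk>vec_space U; \<And>x y. x \<in> set xs \<Longrightarrow> y \<in> set (g x) \<Longrightarrow> f y \<in> carrier U\<rbrakk>
    \<Longrightarrow> list_sum U f (concat (map g xs)) = list_sum U (\<lambda>x. list_sum U f (g x)) xs"
proof (induct xs)
  case (Cons x xs)
  have "list_sum U f (concat (map g xs)) = list_sum U (\<lambda>x. list_sum U f (g x)) xs"
    by (rule Cons.hyps) (auto intro: Cons.prems)
  with Cons.prems show ?case by (simp, subst list_sum_append) auto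
qed simp

section \<open>Balanced maps and the congruence on formal sums\<close>

lemma tensor_eq_subset:
  assumes "tensor_eq V W xs ys" "vec_space V" "vec_space W"
  shows "set xs \<subseteq> carrier V \<times> carrier W \<and> set ys \<subseteq> carrier V \<times> carrier W"
  using assms by (induct rule: tensor_eq.induct) auto

text \<open>
  Balanced maps are the additive analogue of bilinear maps; antilinear and bilinear maps
  are treated uniformly because the values carry no compatibility with scalars.
\<close>

definition balanced ::
  "(complex, 'v, 'b) module_scheme \<Rightarrow> (complex, 'w, 'c) module_scheme \<Rightarrow>
    (complex, 'u, 'd) module_scheme \<Rightarrow> ('v \<Rightarrow> 'w \<Rightarrow> 'u) \<Rightarrow> bool" where
  "balanced V W U \<beta> \<longleftrightarrow>
     (\<forall>v \<in> carrier V. \<forall>w \<in> carrier W. \<beta> v w \<in> carrier U) \<and>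
     (\<forall>v \<in> carrier V. \<forall>v' \<in> carrier V. \<forall>w \<in> carrier W. \<beta> (v \<oplus>\<^bsub>V\<^esub> v') w = \<beta> v w \<oplus>\<^bsub>U\<^esub> \<beta> v' w) \<and>
     (\<forall>v \<in> carrier V. \<forall>w \<in> carrier W. \<forall>w' \<in> carrier W. \<beta> v (w \<oplus>\<^bsub>W\<^esub> w') = \<beta> v w \<oplus>\<^bsub>U\<^esub> \<beta> v w') \<and>
     (\<forall>c. \<forall>v \<in> carrier V. \<forall>w \<in> carrier W. \<beta> (c \<odot>\<^bsub>V\<^esub> v) w = \<beta> v (c \<odot>\<^bsub>W\<^esub> w))"

lemma balancedI:
  assumes "\<And>v w. \<lbrakk>v \<in> carrier V; w \<in> carrier W\<rbrakk> \<Longrightarrow> \<beta> v w \<in> carrier U"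
    and "\<And>v v' w. \<lbrakk>v \<in> carrier V; v' \<in> carrier V; w \<in> carrier W\<rbrakk> \<Longrightarrow> \<beta> (v \<oplus>\<^bsub>V\<^esub> v') w = \<beta> v w \<oplus>\<^bsub>U\<^esub> \<beta> v' w"
    and "\<And>v w w'. \<lbrakk>v \<in> carrier V; w \<in> carrier W; w' \<in> carrier W\<rbrakk> \<Longrightarrow> \<beta> v (w \<oplus>\<^bsub>W\<^esub> w') = \<beta> v w \<oplus>\<^bsub>U\<^esub> \<beta> v w'"
    and "\<And>c v w. \<lbrakk>v \<in> carrier V; w \<in> carrier W\<rbrakk> \<Longrightarrow> \<beta> (c \<odot>\<^bsub>V\<^esub> v) w = \<beta> v (c \<odot>\<^bsub>W\<^esub> w)"
  shows "balanced V W U \<beta>"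
  using assms by (simp add: balanced_def)

lemma balancedD:
  assumes "balanced V W U \<beta>"
  shows "\<lbrakk>v \<in> carrier V; w \<in> carrier W\<rbrakk> \<Longrightarrow> \<beta> v w \<in> carrier U"
    and "\<lbrakk>v \<in> carrier V; v' \<in> carrier V; w \<in> carrier W\<rbrakk> \<Longrightarrow> \<beta> (v \<oplus>\<^bsub>V\<^esub> v') w = \<beta> v w \<oplus>\<^bsub>U\<^esub> \<beta> v' w"
    and "\<lbrakk>v \<in> carrier V; w \<in> carrier W; w' \<in> carrier W\<rbrakk> \<Longrightarrow> \<beta> v (w \<oplus>\<^bsub>W\<^esub> w') = \<beta> v w \<oplus>\<^bsub>U\<^esub> \<beta> v w'"
    and "\<lbrakk>v \<in> carrier V; w \<in> carrier W\<rbrakk> \<Longrightarrow> \<beta> (c \<odot>\<^bsub>V\<^esub> v) w = \<beta> v (c \<odot>\<^bsub>W\<^esub> w)"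
  using assms by (simp_all add: balanced_def)

text \<open>The universal property of the tensor product at the level of representatives: each rule
  generating the congruence is an identity that balanced maps satisfy.\<close>

lemma list_sum_tensor_eq:
  assumes "tensor_eq V W xs ys" and vs: "vec_space V" "vec_space W" "vec_space U"
    and \<beta>: "balanced V W U \<beta>"
  shows "list_sum U (\<lambda>(v, w). \<beta> v w) xs = list_sum U (\<lambda>(v, w). \<beta> v w) ys"
  using assms(1)
proof (induct rule: tensor_eq.induct)
  case (append xs xs' ys ys')
  have "set xs \<union> set ys \<subseteq> carrier V \<times> carrier W" "set xs' \<union> set ys' \<subseteq> carrier V \<times> carrier W"
    using tensor_eq_subset[OF append(1) vs(1,2)] tensor_eq_subset[OF append(3) vs(1,2)] by auto
  then show ?case using append(2,4) \<beta> vs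
    by (subst list_sum_append, simp, fastforce simp: balancedD, subst list_sum_append)
      (simp, fastforce simp: balancedD, simp)
next
  case (commute xs ys)
  then show ?case using \<beta> vs
    by (subst list_sum_append, simp, fastforce simp: balancedD, subst list_sum_append)
      (simp, fastforce simp: balancedD, rule vec_add_comm, auto intro!: list_sum_closed balancedD(1)[OF \<beta>])
next
  case (zero w)
  \<comment> \<open>Additivity in the first argument, applied to 0 + 0, gives x = x + x for this
    value.\<close>
  have "\<beta> \<zero>\<^bsub>V\<^esub> w = \<zero>\<^bsub>U\<^esub>"
    using zero vs \<beta> balancedD(2)[OF \<beta>, of "\<zero>\<^bsub>V\<^esub>" "\<zero>\<^bsub>V\<^esub>" w]
    by (intro vec_add_self[of U]) (auto simp: balancedD)
  then show ?case using vs by simp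
qed (use vs in \<open>auto simp: balancedD[OF \<beta>] vec_add_assoc\<close>)

section \<open>The tensor product as a vector space of chosen representatives\<close>

locale tensor_spaces =
  fixes V :: "('a, 'b) univ_space" and W :: "('a, 'c) univ_space"
  assumes vs: "vec_space V" "vec_space W"
begin

abbreviation "T \<equiv> tensor V W"
abbreviation "formal \<equiv> {xs. set xs \<subseteq> carrier V \<times> carrier W}"

text \<open>Congruent lists define the same predicate \<open>tensor_eq V W xs\<close>, and the
  choice operator applied to equal predicates picks the same list. The quotient is thereby realised
  by canonical representatives.\<close>

lemma tensor_of_eq_iff:
  assumes "xs \<in> formal" "ys \<in> formal"
  shows "tensor_of V W xs = tensor_of V W ys \<longleftrightarrow> tensor_eq V W xs ys"
proof
  have some: "tensor_eq V W zs (SOME ys. tensor_eq V W zs ys)" if "zs \<in> formal" for zs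
    using that by (intro someI[of "tensor_eq V W zs" zs]) (auto intro: tensor_eq.refl)
  show "tensor_eq V W xs ys" if "tensor_of V W xs = tensor_of V W ys"
    using some[OF assms(1)] some[OF assms(2)] that unfolding tensor_of_def
    by (metis tensor_eq.sym tensor_eq.trans univ.inject(3))
  show "tensor_of V W xs = tensor_of V W ys" if "tensor_eq V W xs ys"
  proof -
    have "tensor_eq V W xs = tensor_eq V W ys"
      using that by (auto simp: fun_eq_iff intro: tensor_eq.sym tensor_eq.trans)
    then show ?thesis by (simp add: tensor_of_def)
  qed
qed

lemma tensor_of_eqI: "tensor_eq V W xs ys \<Longrightarrow> tensor_of V W xs = tensor_of V W ys"
  using tensor_eq_subset[OF _ vs] by (subst tensor_of_eq_iff) auto

lemma tensor_eq_summands: "xs \<in> formal \<Longrightarrow> tensor_eq V W xs (summands (tensor_of V W xs))"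
  unfolding tensor_of_def univ.sel
  by (rule someI[of _ xs]) (auto intro: tensor_eq.refl)

lemma summands_formal: "xs \<in> formal \<Longrightarrow> summands (tensor_of V W xs) \<in> formal"
  using tensor_eq_summands tensor_eq_subset vs by blast

lemma tensor_of_summands: "xs \<in> formal \<Longrightarrow> tensor_of V W (summands (tensor_of V W xs)) = tensor_of V W xs"
  using tensor_eq_summands summands_formal by (subst tensor_of_eq_iff) (auto intro: tensor_eq.sym)

lemma tensor_sel:
  "carrier T = tensor_of V W ` formal"
  "\<zero>\<^bsub>T\<^esub> = tensor_of V W []"
  "\<one>\<^bsub>T\<^esub> = pure V W \<one>\<^bsub>V\<^esub> \<one>\<^bsub>W\<^esub>"
  by (simp_all add: tensor_def)

lemma carrier_cases:
  assumes "t \<in> carrier T"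
  obtains xs where "xs \<in> formal" "t = tensor_of V W xs"
  using assms by (auto simp: tensor_sel)

lemma carrier_summands: "t \<in> carrier T \<Longrightarrow> summands t \<in> formal \<and> t = tensor_of V W (summands t)"
  by (elim carrier_cases) (metis summands_formal tensor_of_summands)

lemma tensor_of_closed: "xs \<in> formal \<Longrightarrow> tensor_of V W xs \<in> carrier T"
  by (auto simp: tensor_sel)

lemma tensor_of_append:
  assumes "xs \<in> formal" "ys \<in> formal"
  shows "tensor_of V W xs \<oplus>\<^bsub>T\<^esub> tensor_of V W ys = tensor_of V W (xs @ ys)"
proof -
  have "tensor_eq V W (summands (tensor_of V W xs) @ summands (tensor_of V W ys)) (xs @ ys)"
    using assms by (intro tensor_eq.append tensor_eq.sym[OF tensor_eq_summands]) auto
  then show ?thesis by (simp add: tensor_def tensor_of_eqI)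
qed

lemma tensor_eq_smult:
  assumes "tensor_eq V W xs ys"
  shows "tensor_eq V W (map (\<lambda>(v, w). (c \<odot>\<^bsub>V\<^esub> v, w)) xs) (map (\<lambda>(v, w). (c \<odot>\<^bsub>V\<^esub> v, w)) ys)"
  using assms
proof (induct rule: tensor_eq.induct)
  case (refl xs)
  then show ?case using vs by (intro tensor_eq.refl) auto
next
  case (trans xs ys zs)
  then show ?case by (blast intro: tensor_eq.trans)
next
  case (commute xs ys)
  then show ?case using vs unfolding map_append by (intro tensor_eq.commute) auto
next
  case (scale v w d)
  \<comment> \<open>Scaling by c and moving d across the tensor sign commute because complex
    multiplication does.\<close>
  then show ?case using vs
    using tensor_eq.scale[of "c \<odot>\<^bsub>V\<^esub> v" V w W d] by (simp add: vec_smult_smult mult.commute)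
qed (use vs in \<open>auto simp: vec_smult_add intro: tensor_eq.intros\<close>)

lemma tensor_of_smult:
  assumes "xs \<in> formal"
  shows "c \<odot>\<^bsub>T\<^esub> tensor_of V W xs = tensor_of V W (map (\<lambda>(v, w). (c \<odot>\<^bsub>V\<^esub> v, w)) xs)"
proof -
  have "tensor_eq V W (map (\<lambda>(v, w). (c \<odot>\<^bsub>V\<^esub> v, w)) (summands (tensor_of V W xs)))
      (map (\<lambda>(v, w). (c \<odot>\<^bsub>V\<^esub> v, w)) xs)"
    using assms by (intro tensor_eq_smult tensor_eq.sym[OF tensor_eq_summands])
  then show ?thesis by (simp add: tensor_def tensor_of_eqI)
qed

lemma pure_closed: "\<lbrakk>v \<in> carrier V; w \<in> carrier W\<rbrakk> \<Longrightarrow> pure V W v w \<in> carrier T"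
  unfolding pure_def by (rule tensor_of_closed) auto

lemma pure_add_left: "\<lbrakk>v \<in> carrier V; v' \<in> carrier V; w \<in> carrier W\<rbrakk>
    \<Longrightarrow> pure V W (v \<oplus>\<^bsub>V\<^esub> v') w = pure V W v w \<oplus>\<^bsub>T\<^esub> pure V W v' w"
  unfolding pure_def by (subst tensor_of_append) (auto intro!: tensor_of_eqI tensor_eq.add_left)

lemma pure_add_right: "\<lbrakk>v \<in> carrier V; w \<in> carrier W; w' \<in> carrier W\<rbrakk>
    \<Longrightarrow> pure V W v (w \<oplus>\<^bsub>W\<^esub> w') = pure V W v w \<oplus>\<^bsub>T\<^esub> pure V W v w'"
  unfolding pure_def by (subst tensor_of_append) (auto intro!: tensor_of_eqI tensor_eq.add_right)

lemma smult_pure: "\<lbrakk>v \<in> carrier V; w \<in> carrier W\<rbrakk> \<Longrightarrow> c \<odot>\<^bsub>T\<^esub> pure V W v w = pure V W (c \<odot>\<^bsub>V\<^esub> v) w"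
  unfolding pure_def by (subst tensor_of_smult) auto

lemma pure_smult_right: "\<lbrakk>v \<in> carrier V; w \<in> carrier W\<rbrakk> \<Longrightarrow> pure V W v (c \<odot>\<^bsub>W\<^esub> w) = pure V W (c \<odot>\<^bsub>V\<^esub> v) w"
  unfolding pure_def by (auto intro!: tensor_of_eqI tensor_eq.scale tensor_eq.sym[OF tensor_eq.scale])

text \<open>Induction along a representing list. It rests only on \<open>tensor_of_append\<close>,
  so it is available while the vector space laws are still being established.\<close>

lemma tensor_induct_list [consumes 1, case_names zero add]:
  assumes "t \<in> carrier T" "P \<zero>\<^bsub>T\<^esub>"
    and "\<And>v w s. \<lbrakk>v \<in> carrier V; w \<in> carrier W; s \<in> carrier T; P s\<rbrakk> \<Longrightarrow> P (pure V W v w \<oplus>\<^bsub>T\<^esub> s)"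
  shows "P t"
proof -
  have "P (tensor_of V W xs)" if "xs \<in> formal" for xs
    using that
  proof (induct xs)
    case (Cons x xs)
    then have "P (pure V W (fst x) (snd x) \<oplus>\<^bsub>T\<^esub> tensor_of V W xs)"
      by (intro assms(3)) (auto intro: tensor_of_closed)
    with Cons show ?case unfolding pure_def by (subst (asm) tensor_of_append) auto
  qed (use assms(2) in \<open>simp add: tensor_sel\<close>)
  then show ?thesis using assms(1) by (auto elim: carrier_cases)
qed

lemma abelian_monoid_tensor: "abelian_monoid T"
proof (rule abelian_monoidI)
  fix x y z assume "x \<in> carrier T" "y \<in> carrier T" "z \<in> carrier T"
  then show "x \<oplus>\<^bsub>T\<^esub> y \<oplus>\<^bsub>T\<^esub> z = x \<oplus>\<^bsub>T\<^esub> (y \<oplus>\<^bsub>T\<^esub> z)"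
    by (elim carrier_cases) (simp add: tensor_of_append)
next
  fix x y assume "x \<in> carrier T" "y \<in> carrier T"
  then show "x \<oplus>\<^bsub>T\<^esub> y \<in> carrier T" by (elim carrier_cases) (simp add: tensor_of_append tensor_of_closed)
next
  fix x y assume "x \<in> carrier T" "y \<in> carrier T"
  then show "x \<oplus>\<^bsub>T\<^esub> y = y \<oplus>\<^bsub>T\<^esub> x"
    by (elim carrier_cases) (auto simp: tensor_of_append intro!: tensor_of_eqI tensor_eq.commute)
next
  fix x assume "x \<in> carrier T"
  then show "\<zero>\<^bsub>T\<^esub> \<oplus>\<^bsub>T\<^esub> x = x"
    by (elim carrier_cases) (simp add: tensor_sel tensor_of_append)
qed (simp add: tensor_sel(2) tensor_of_closed)

lemma vec_space_tensor: "vec_space T"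
proof -
  interpret abelian_monoid T by (rule abelian_monoid_tensor)
  have smult_closed: "c \<odot>\<^bsub>T\<^esub> x \<in> carrier T" if "x \<in> carrier T" for c x
    using that vs by (elim carrier_cases) (force simp: tensor_of_smult intro!: tensor_of_closed)
  have smult_zero: "c \<odot>\<^bsub>T\<^esub> \<zero>\<^bsub>T\<^esub> = \<zero>\<^bsub>T\<^esub>" for c
    by (simp add: tensor_sel(2) tensor_of_smult)
  have smult_add: "c \<odot>\<^bsub>T\<^esub> (x \<oplus>\<^bsub>T\<^esub> y) = c \<odot>\<^bsub>T\<^esub> x \<oplus>\<^bsub>T\<^esub> c \<odot>\<^bsub>T\<^esub> y"
    if "x \<in> carrier T" "y \<in> carrier T" for c x y
  proof -
    obtain xs where xs: "xs \<in> formal" "x = tensor_of V W xs" using \<open>x \<in> carrier T\<close> by (rule carrier_cases)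
    obtain ys where ys: "ys \<in> formal" "y = tensor_of V W ys" using \<open>y \<in> carrier T\<close> by (rule carrier_cases)
    from xs ys vs have "map (\<lambda>(v, w). (c \<odot>\<^bsub>V\<^esub> v, w)) xs \<in> formal"
      "map (\<lambda>(v, w). (c \<odot>\<^bsub>V\<^esub> v, w)) ys \<in> formal" by auto
    with xs ys show ?thesis by (simp add: tensor_of_append tensor_of_smult)
  qed
  have add_smult: "(c + d) \<odot>\<^bsub>T\<^esub> x = c \<odot>\<^bsub>T\<^esub> x \<oplus>\<^bsub>T\<^esub> d \<odot>\<^bsub>T\<^esub> x" if "x \<in> carrier T" for c d x
    using that vs
    by (induct rule: tensor_induct_list)
      (simp_all add: smult_zero smult_add smult_closed pure_closed smult_pure vec_smult_add_left
        pure_add_left a_ac)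
  have smult_smult: "(c * d) \<odot>\<^bsub>T\<^esub> x = c \<odot>\<^bsub>T\<^esub> (d \<odot>\<^bsub>T\<^esub> x)" if "x \<in> carrier T" for c d x
    using that vs
    by (induct rule: tensor_induct_list)
      (simp_all add: smult_zero smult_add smult_closed pure_closed smult_pure vec_smult_smult)
  have smult_one: "1 \<odot>\<^bsub>T\<^esub> x = x" if "x \<in> carrier T" for x
    using that vs
    by (induct rule: tensor_induct_list)
      (simp_all add: smult_zero smult_add smult_closed pure_closed smult_pure)
  have smult_0: "0 \<odot>\<^bsub>T\<^esub> x = \<zero>\<^bsub>T\<^esub>" if x: "x \<in> carrier T" for x
  proof -
    have "pure V W \<zero>\<^bsub>V\<^esub> w = \<zero>\<^bsub>T\<^esub>" if "w \<in> carrier W" for w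
      using that unfolding pure_def tensor_sel by (auto intro: tensor_of_eqI tensor_eq.zero)
    with x show ?thesis using vs
      by (induct rule: tensor_induct_list) (simp_all add: smult_zero smult_add smult_closed pure_closed
          smult_pure)
  qed
  \<comment> \<open>Formal sums carry no negatives; the inverse of x is -1 times x, by
    distributivity over -1 + 1 and \<open>smult_0\<close>.\<close>
  have "abelian_group T"
  proof (rule abelian_groupI)
    fix x assume x: "x \<in> carrier T"
    then have "(-1) \<odot>\<^bsub>T\<^esub> x \<oplus>\<^bsub>T\<^esub> x = \<zero>\<^bsub>T\<^esub>"
      using add_smult[OF x, of "-1" 1] by (simp add: smult_one smult_0)
    with x smult_closed show "\<exists>y\<in>carrier T. y \<oplus>\<^bsub>T\<^esub> x = \<zero>\<^bsub>T\<^esub>" by blast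
  qed (simp_all add: a_ac)
  then show ?thesis
    by (rule vec_spaceI) (simp_all add: smult_closed smult_add add_smult smult_smult smult_one)
qed

lemma pure_zero_left [simp]: "w \<in> carrier W \<Longrightarrow> pure V W \<zero>\<^bsub>V\<^esub> w = \<zero>\<^bsub>T\<^esub>"
  unfolding pure_def tensor_sel by (auto intro: tensor_of_eqI tensor_eq.zero)

text \<open>Zero is itself a pure tensor, which absorbs the base case of the list induction.\<close>

lemma tensor_induct [consumes 1, case_names pure add]:
  assumes "t \<in> carrier T"
    and pure: "\<And>v w. \<lbrakk>v \<in> carrier V; w \<in> carrier W\<rbrakk> \<Longrightarrow> P (pure V W v w)"
    and "\<And>s t. \<lbrakk>s \<in> carrier T; t \<in> carrier T; P s; P t\<rbrakk> \<Longrightarrow> P (s \<oplus>\<^bsub>T\<^esub> t)"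
  shows "P t"
  using assms(1)
proof (rule tensor_induct_list)
  show "P \<zero>\<^bsub>T\<^esub>" using pure[of "\<zero>\<^bsub>V\<^esub>" "\<zero>\<^bsub>W\<^esub>"] vs by simp
qed (simp_all add: assms pure_closed)

context
  fixes U :: "(complex, 'u, 'd) module_scheme" and \<beta>
  assumes U: "vec_space U" and \<beta>: "balanced V W U \<beta>"
begin

text \<open>Independence of the representative: any list for the tensor may replace the chosen one.
  Evaluation on pure tensors and additivity both follow from this.\<close>

lemma sweedler_tensor_of:
  "xs \<in> formal \<Longrightarrow> sweedler U (tensor_of V W xs) \<beta> = list_sum U (\<lambda>(v, w). \<beta> v w) xs"
  unfolding sweedler_eq_list_sum
  by (rule list_sum_tensor_eq[OF tensor_eq.sym[OF tensor_eq_summands] vs U \<beta>])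

lemma sweedler_pure: "\<lbrakk>v \<in> carrier V; w \<in> carrier W\<rbrakk> \<Longrightarrow> sweedler U (pure V W v w) \<beta> = \<beta> v w"
  unfolding pure_def using U by (simp add: sweedler_tensor_of balancedD[OF \<beta>])

lemma sweedler_add:
  "\<lbrakk>s \<in> carrier T; t \<in> carrier T\<rbrakk> \<Longrightarrow> sweedler U (s \<oplus>\<^bsub>T\<^esub> t) \<beta> = sweedler U s \<beta> \<oplus>\<^bsub>U\<^esub> sweedler U t \<beta>"
  using U
  by (elim carrier_cases)
    (simp add: tensor_of_append sweedler_tensor_of, rule list_sum_append, auto simp: balancedD[OF \<beta>])

end

lemma sweedler_closed:
  "\<lbrakk>vec_space U; \<And>v w. \<lbrakk>v \<in> carrier V; w \<in> carrier W\<rbrakk> \<Longrightarrow> \<beta> v w \<in> carrier U; t \<in> carrier T\<rbrakk>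
    \<Longrightarrow> sweedler U t \<beta> \<in> carrier U"
  unfolding sweedler_eq_list_sum using carrier_summands
  by (intro list_sum_closed) auto

lemma sweedler_cong:
  "\<lbrakk>\<And>v w. \<lbrakk>v \<in> carrier V; w \<in> carrier W\<rbrakk> \<Longrightarrow> \<beta> v w = \<beta>' v w; t \<in> carrier T\<rbrakk>
    \<Longrightarrow> sweedler U t \<beta> = sweedler U t \<beta>'"
  unfolding sweedler_eq_list_sum using carrier_summands[of t]
  by (intro list_sum_cong) auto

text \<open>Both sides run over the same chosen list, so the law for finite sums applies term by
  term. This is the rule by which maps are pulled into and out of Sweedler notation.\<close>

lemma additive_sweedler:
  "\<lbrakk>vec_space U; vec_space U'; additive_map U U' \<phi>;
    \<And>v w. \<lbrakk>v \<in> carrier V; w \<in> carrier W\<rbrakk> \<Longrightarrow> \<beta> v w \<in> carrier U; t \<in> carrier T\<rbrakk>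
    \<Longrightarrow> \<phi> (sweedler U t \<beta>) = sweedler U' t (\<lambda>v w. \<phi> (\<beta> v w))"
  unfolding sweedler_eq_list_sum using carrier_summands[of t]
  by (subst list_sum_additive[of U U' \<phi>]) (auto intro!: list_sum_cong)

lemma sweedler_sum:
  "\<lbrakk>vec_space U; \<And>v w. \<lbrakk>v \<in> carrier V; w \<in> carrier W\<rbrakk> \<Longrightarrow> \<beta> v w \<in> carrier U;
    \<And>v w. \<lbrakk>v \<in> carrier V; w \<in> carrier W\<rbrakk> \<Longrightarrow> \<beta>' v w \<in> carrier U; t \<in> carrier T\<rbrakk>
    \<Longrightarrow> sweedler U t (\<lambda>v w. \<beta> v w \<oplus>\<^bsub>U\<^esub> \<beta>' v w) = sweedler U t \<beta> \<oplus>\<^bsub>U\<^esub> sweedler U t \<beta>'"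
  unfolding sweedler_eq_list_sum using carrier_summands[of t]
  by (subst list_sum_add[symmetric]) (auto intro!: list_sum_cong)

text \<open>Writes an arbitrary tensor as a Sweedler sum; combined with
  \<open>additive_sweedler\<close> it expands any additive function of a tensor.\<close>

lemma sweedler_pures:
  assumes "t \<in> carrier T"
  shows "sweedler T t (pure V W) = t"
  using assms
proof (induct rule: tensor_induct)
qed (simp_all add: sweedler_pure sweedler_add vec_space_tensor balancedI pure_closed
    pure_add_left pure_add_right pure_smult_right)

end

lemmas vec_space_tensor = tensor_spaces.vec_space_tensor [OF tensor_spaces.intro]
lemmas pure_closed = tensor_spaces.pure_closed [OF tensor_spaces.intro]
lemmas pure_add_left = tensor_spaces.pure_add_left [OF tensor_spaces.intro]
lemmas pure_add_right = tensor_spaces.pure_add_right [OF tensor_spaces.intro]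
lemmas smult_pure = tensor_spaces.smult_pure [OF tensor_spaces.intro]
lemmas pure_smult_right = tensor_spaces.pure_smult_right [OF tensor_spaces.intro]
lemmas tensor_induct = tensor_spaces.tensor_induct [OF tensor_spaces.intro, consumes 3, case_names pure add]
lemmas sweedler_pure = tensor_spaces.sweedler_pure [OF tensor_spaces.intro]
lemmas sweedler_add = tensor_spaces.sweedler_add [OF tensor_spaces.intro]
lemmas sweedler_closed = tensor_spaces.sweedler_closed [OF tensor_spaces.intro]
lemmas sweedler_cong = tensor_spaces.sweedler_cong [OF tensor_spaces.intro]
lemmas sweedler_sum = tensor_spaces.sweedler_sum [OF tensor_spaces.intro]
lemmas additive_sweedler = tensor_spaces.additive_sweedler [OF tensor_spaces.intro]
lemmas sweedler_pures = tensor_spaces.sweedler_pures [OF tensor_spaces.intro]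

declare vec_space_tensor [simp] pure_closed [simp]

lemma additive_sweedler_map:
  "\<lbrakk>vec_space V; vec_space W; vec_space U; balanced V W U \<beta>\<rbrakk>
    \<Longrightarrow> additive_map (tensor V W) U (\<lambda>t. sweedler U t \<beta>)"
  by (intro additive_mapI) (auto simp: sweedler_add balancedD intro!: sweedler_closed[of V W])

text \<open>Pure tensors generate the tensor product additively, since scalars can be absorbed in a
  factor. Hence the criterion covers linear and antilinear maps alike.\<close>

lemma additive_map_tensor_eqI:
  assumes "t \<in> carrier (tensor V W)" "vec_space V" "vec_space W"
    and "additive_map (tensor V W) U f" "additive_map (tensor V W) U g"
    and "\<And>v w. \<lbrakk>v \<in> carrier V; w \<in> carrier W\<rbrakk> \<Longrightarrow> f (pure V W v w) = g (pure V W v w)"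
  shows "f t = g t"
  using assms(2,3,1) by (induct rule: tensor_induct) (use assms in \<open>simp_all add: additive_map_add\<close>)

section \<open>Semilinear maps on tensor products\<close>

definition semilinear_map ::
  "(complex \<Rightarrow> complex) \<Rightarrow> (complex, 'v, 'b) module_scheme \<Rightarrow> (complex, 'w, 'c) module_scheme \<Rightarrow> ('v \<Rightarrow> 'w) \<Rightarrow>
      bool" where
  "semilinear_map \<sigma> V W f \<longleftrightarrow> additive_map V W f \<and>
     (\<forall>c. \<forall>x \<in> carrier V. f (c \<odot>\<^bsub>V\<^esub> x) = \<sigma> c \<odot>\<^bsub>W\<^esub> f x)"

lemma linear_semilinear: "linear_map V W f \<longleftrightarrow> semilinear_map (\<lambda>c. c) V W f"
  and antilinear_semilinear: "antilinear_map V W f \<longleftrightarrow> semilinear_map cnj V W f"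
  by (simp_all add: linear_map_def antilinear_map_def semilinear_map_def)

context
  fixes V :: "('a, 'b) univ_space" and W :: "('a, 'c) univ_space"
    and V' :: "('a, 'd) univ_space" and W' :: "('a, 'e) univ_space"
    and f g \<sigma>
  assumes vs: "vec_space V" "vec_space W" "vec_space V'" "vec_space W'"
    and f: "semilinear_map \<sigma> V V' f" and g: "semilinear_map \<sigma> W W' g"
begin

text \<open>Having the same \<sigma> on both factors is what balances the map: a scalar c leaves
  either side as \<sigma>(c). With \<sigma> the identity or conjugation this covers S \<otimes> S as
  well as the tensor square of star or \<open>dagger\<close>.\<close>

lemma balanced_tensor_map: "balanced V W (tensor V' W') (\<lambda>v w. pure V' W' (f v) (g w))"
  using f g vs
  by (intro balancedI)
    (auto simp: semilinear_map_def additive_map_def Pi_iff pure_add_left pure_add_right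
       pure_smult_right)

lemma semilinear_tensor_map_pure:
  "\<lbrakk>v \<in> carrier V; w \<in> carrier W\<rbrakk> \<Longrightarrow> tensor_map V' W' f g (pure V W v w) = pure V' W' (f v) (g w)"
  unfolding tensor_map_def using vs balanced_tensor_map by (simp add: sweedler_pure)

lemma semilinear_tensor_map_additive: "additive_map (tensor V W) (tensor V' W') (tensor_map V' W' f g)"
  unfolding tensor_map_def using vs balanced_tensor_map by (simp add: additive_sweedler_map)

end

context
  fixes V :: "('a, 'b) univ_space" and W :: "('a, 'c) univ_space"
    and V' :: "('a, 'd) univ_space" and W' :: "('a, 'e) univ_space"
    and f g
  assumes vs: "vec_space V" "vec_space W" "vec_space V'" "vec_space W'"
    and f: "linear_map V V' f" and g: "linear_map W W' g"
begin

lemmas tensor_map_pure = semilinear_tensor_map_pure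
    [OF vs f[unfolded linear_semilinear] g[unfolded linear_semilinear]]
lemmas tensor_map_additive = semilinear_tensor_map_additive
    [OF vs f[unfolded linear_semilinear] g[unfolded linear_semilinear]]

lemma tensor_map_linear: "linear_map (tensor V W) (tensor V' W') (tensor_map V' W' f g)"
proof (intro linear_mapI)
  fix c t assume "t \<in> carrier (tensor V W)"
  with vs(1,2) show "tensor_map V' W' f g (c \<odot>\<^bsub>tensor V W\<^esub> t) = c \<odot>\<^bsub>tensor V' W'\<^esub> tensor_map V' W' f g t"
    by (induct rule: tensor_induct)
      (use vs f g in \<open>simp_all add: vec_smult_add additive_map_add[OF tensor_map_additive]
        additive_map_closed[OF tensor_map_additive] smult_pure tensor_map_pure linear_map_closed
            linear_map_smult\<close>)
qed (simp_all add: additive_map_add[OF tensor_map_additive] additive_map_closed[OF tensor_map_additive])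

end

context
  fixes V :: "('a, 'b) univ_space" and W :: "('a, 'c) univ_space"
  assumes vs: "vec_space V" "vec_space W"
begin

lemma balanced_flip: "balanced V W (tensor W V) (\<lambda>v w. pure W V w v)"
  using vs by (intro balancedI) (auto simp: pure_add_left pure_add_right pure_smult_right)

lemma flip_pure: "\<lbrakk>v \<in> carrier V; w \<in> carrier W\<rbrakk> \<Longrightarrow> flip V W (pure V W v w) = pure W V w v"
  unfolding flip_def using vs balanced_flip by (simp add: sweedler_pure)

lemma flip_additive: "additive_map (tensor V W) (tensor W V) (flip V W)"
  unfolding flip_def using vs balanced_flip by (simp add: additive_sweedler_map)

lemma flip_linear: "linear_map (tensor V W) (tensor W V) (flip V W)"
proof (intro linear_mapI)
  fix c t assume "t \<in> carrier (tensor V W)"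
  with vs show "flip V W (c \<odot>\<^bsub>tensor V W\<^esub> t) = c \<odot>\<^bsub>tensor W V\<^esub> flip V W t"
    by (induct rule: tensor_induct)
      (use vs in \<open>simp_all add: vec_smult_add additive_map_add[OF flip_additive]
        additive_map_closed[OF flip_additive] smult_pure flip_pure pure_smult_right\<close>)
qed (simp_all add: additive_map_add[OF flip_additive] additive_map_closed[OF flip_additive])

end

lemma flip_flip:
  assumes "vec_space V" "vec_space W" "t \<in> carrier (tensor V W)"
  shows "flip W V (flip V W t) = t"
  using assms
  by (induct rule: tensor_induct)
    (use assms(1,2) in \<open>simp_all add: flip_pure additive_map_add[OF flip_additive]
        additive_map_closed[OF flip_additive]\<close>)

section \<open>Triple tensor products\<close>

context
  fixes U :: "('a, 'd) univ_space" and V :: "('a, 'b) univ_space"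
    and W :: "('a, 'c) univ_space" and X :: "(complex, 'x, 'e) module_scheme"
    and \<tau> :: "'a univ \<Rightarrow> 'a univ \<Rightarrow> 'a univ \<Rightarrow> 'x"
  assumes vs: "vec_space U" "vec_space V" "vec_space W" "vec_space X"
    and left: "\<And>w. w \<in> carrier W \<Longrightarrow> balanced U V X (\<lambda>u v. \<tau> u v w)"
    and right: "\<And>u. u \<in> carrier U \<Longrightarrow> balanced V W X (\<tau> u)"
begin

text \<open>Well-definedness of nested Sweedler sums. A scalar travels from the pair (u, v) to w in
  two hops: from u to v by \<open>left\<close>, then from v to w by \<open>right\<close>.\<close>

lemma balanced_sweedler_left: "balanced (tensor U V) W X (\<lambda>s w. sweedler X s (\<lambda>u v. \<tau> u v w))"
proof (intro balancedI)
  fix s w assume "s \<in> carrier (tensor U V)" "w \<in> carrier W"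
  then show "sweedler X s (\<lambda>u v. \<tau> u v w) \<in> carrier X"
    using vs by (intro sweedler_closed[of U V]) (auto intro: balancedD[OF left])
next
  fix s s' w assume "s \<in> carrier (tensor U V)" "s' \<in> carrier (tensor U V)" "w \<in> carrier W"
  then show "sweedler X (s \<oplus>\<^bsub>tensor U V\<^esub> s') (\<lambda>u v. \<tau> u v w)
     = sweedler X s (\<lambda>u v. \<tau> u v w) \<oplus>\<^bsub>X\<^esub> sweedler X s' (\<lambda>u v. \<tau> u v w)"
    using vs by (simp add: sweedler_add left)
next
  fix s w w' assume s: "s \<in> carrier (tensor U V)" and w: "w \<in> carrier W" "w' \<in> carrier W"
  have "sweedler X s (\<lambda>u v. \<tau> u v (w \<oplus>\<^bsub>W\<^esub> w')) = sweedler X s (\<lambda>u v. \<tau> u v w \<oplus>\<^bsub>X\<^esub> \<tau> u v w')"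
    by (rule sweedler_cong[OF vs(1,2) _ s]) (simp add: balancedD[OF right] w)
  also have "\<dots> = sweedler X s (\<lambda>u v. \<tau> u v w) \<oplus>\<^bsub>X\<^esub> sweedler X s (\<lambda>u v. \<tau> u v w')"
    using vs s w by (intro sweedler_sum[of U V]) (auto intro: balancedD[OF right])
  finally show "sweedler X s (\<lambda>u v. \<tau> u v (w \<oplus>\<^bsub>W\<^esub> w'))
     = sweedler X s (\<lambda>u v. \<tau> u v w) \<oplus>\<^bsub>X\<^esub> sweedler X s (\<lambda>u v. \<tau> u v w')" .
next
  fix c s w assume s: "s \<in> carrier (tensor U V)" and w: "w \<in> carrier W"
  from vs(1,2) s show "sweedler X (c \<odot>\<^bsub>tensor U V\<^esub> s) (\<lambda>u v. \<tau> u v w) = sweedler X s (\<lambda>u v. \<tau> u v (c \<odot>\<^bsub>W\<^esub> w))"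
  proof (induct rule: tensor_induct)
    case (pure u v)
    then show ?case using vs w
      by (simp add: smult_pure sweedler_pure left balancedD(4)[OF left] balancedD(4)[OF right])
  qed (use vs w in \<open>simp add: sweedler_add left vec_smult_add\<close>)
qed

lemma balanced_sweedler_right: "balanced U (tensor V W) X (\<lambda>u s. sweedler X s (\<tau> u))"
proof (intro balancedI)
  fix u s assume "s \<in> carrier (tensor V W)" "u \<in> carrier U"
  then show "sweedler X s (\<tau> u) \<in> carrier X"
    using vs by (intro sweedler_closed[of V W]) (auto intro: balancedD[OF right])
next
  fix u s s' assume "s \<in> carrier (tensor V W)" "s' \<in> carrier (tensor V W)" "u \<in> carrier U"
  then show "sweedler X (s \<oplus>\<^bsub>tensor V W\<^esub> s') (\<tau> u) = sweedler X s (\<tau> u) \<oplus>\<^bsub>X\<^esub> sweedler X s' (\<tau> u)"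
    using vs by (simp add: sweedler_add right)
next
  fix u u' s assume s: "s \<in> carrier (tensor V W)" and u: "u \<in> carrier U" "u' \<in> carrier U"
  have "sweedler X s (\<tau> (u \<oplus>\<^bsub>U\<^esub> u')) = sweedler X s (\<lambda>v w. \<tau> u v w \<oplus>\<^bsub>X\<^esub> \<tau> u' v w)"
    by (rule sweedler_cong[OF vs(2,3) _ s]) (simp add: balancedD[OF left] u)
  also have "\<dots> = sweedler X s (\<tau> u) \<oplus>\<^bsub>X\<^esub> sweedler X s (\<tau> u')"
    using vs s u by (intro sweedler_sum[of V W]) (auto intro: balancedD[OF right])
  finally show "sweedler X s (\<tau> (u \<oplus>\<^bsub>U\<^esub> u')) = sweedler X s (\<tau> u) \<oplus>\<^bsub>X\<^esub> sweedler X s (\<tau> u')" .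
next
  fix c s u assume s: "s \<in> carrier (tensor V W)" and u: "u \<in> carrier U"
  from vs(2,3) s show "sweedler X s (\<tau> (c \<odot>\<^bsub>U\<^esub> u)) = sweedler X (c \<odot>\<^bsub>tensor V W\<^esub> s) (\<tau> u)"
  proof (induct rule: tensor_induct)
    case (pure v w)
    then show ?case using vs u
      by (simp add: smult_pure sweedler_pure right balancedD(4)[OF left] balancedD(4)[OF right])
  qed (use vs u in \<open>simp add: sweedler_add right vec_smult_add\<close>)
qed

text \<open>Rebracketing the tensor turns one order of nesting into the other; it is the bridge from
  equations involving \<open>reassoc\<close> to Sweedler calculus.\<close>

lemma sweedler_reassoc:
  assumes t: "t \<in> carrier (tensor (tensor U V) W)"
  shows "sweedler X (reassoc U V W t) (\<lambda>u s. sweedler X s (\<tau> u))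
    = sweedler X t (\<lambda>s w. sweedler X s (\<lambda>u v. \<tau> u v w))"
proof -
  let ?T = "tensor U (tensor V W)"
  let ?f = "\<lambda>r. sweedler X r (\<lambda>u s. sweedler X s (\<tau> u))"
  have add: "additive_map ?T X ?f"
    using vs by (intro additive_sweedler_map balanced_sweedler_right) auto
  have *: "?f (sweedler ?T s (\<lambda>u v. pure U (tensor V W) u (pure V W v w))) = sweedler X s (\<lambda>u v. \<tau> u v w)"
    if s: "s \<in> carrier (tensor U V)" and w: "w \<in> carrier W" for s w
    using vs s w
    by (subst additive_sweedler[of U V ?T X ?f])
      (auto simp: add sweedler_pure balanced_sweedler_right right intro!: sweedler_cong[of U V])
  show ?thesis unfolding reassoc_def
    using vs t *
    by (subst additive_sweedler[of "tensor U V" W ?T X ?f])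
      (auto simp: add intro!: sweedler_cong[of "tensor U V" W] sweedler_closed[of U V])
qed

end

context
  fixes U :: "('a, 'd) univ_space" and V :: "('a, 'b) univ_space"
    and W :: "('a, 'c) univ_space"
  assumes vs: "vec_space U" "vec_space V" "vec_space W"
begin

lemma balanced_triple:
  "w \<in> carrier W \<Longrightarrow> balanced U V (tensor U (tensor V W)) (\<lambda>u v. pure U (tensor V W) u (pure V W v w))"
  "u \<in> carrier U \<Longrightarrow> balanced V W (tensor U (tensor V W)) (\<lambda>v w. pure U (tensor V W) u (pure V W v w))"
  using vs by (auto intro!: balancedI simp: pure_add_left pure_add_right pure_smult_right
      smult_pure[symmetric])

lemma reassoc_additive: "additive_map (tensor (tensor U V) W) (tensor U (tensor V W)) (reassoc U V W)"
  unfolding reassoc_def using vs balanced_triple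
  by (intro additive_sweedler_map balanced_sweedler_left) auto

lemma reassoc_pure:
  "\<lbrakk>u \<in> carrier U; v \<in> carrier V; w \<in> carrier W\<rbrakk>
    \<Longrightarrow> reassoc U V W (pure (tensor U V) W (pure U V u v) w) = pure U (tensor V W) u (pure V W v w)"
  unfolding reassoc_def using vs balanced_triple
  by (subst sweedler_pure, simp, simp, simp, intro balanced_sweedler_left)
    (auto simp: sweedler_pure)

end

text \<open>
  Passing to the conjugate space (\<open>\<sigma> = cnj\<close>) or forgetting an action (\<open>\<sigma> = id\<close>) changes
  neither the elements nor the sums of a tensor product.
\<close>

definition twin ::
  "(complex \<Rightarrow> complex) \<Rightarrow> (complex, 'v, 'b) module_scheme \<Rightarrow> (complex, 'v, 'c) module_scheme \<Rightarrow> bool" where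
  "twin \<sigma> V V' \<longleftrightarrow> carrier V' = carrier V \<and> \<zero>\<^bsub>V'\<^esub> = \<zero>\<^bsub>V\<^esub> \<and> add V' = add V \<and>
     (\<forall>c v. c \<odot>\<^bsub>V'\<^esub> v = \<sigma> c \<odot>\<^bsub>V\<^esub> v) \<and> (\<forall>c. \<sigma> (\<sigma> c) = c)"

lemma twin_sym: "twin \<sigma> V V' \<Longrightarrow> twin \<sigma> V' V"
  by (simp add: twin_def)

lemma twin_refl: "twin (\<lambda>c. c) V V"
  by (simp add: twin_def)

lemma twin_sel:
  "twin \<sigma> V V' \<Longrightarrow> carrier V' = carrier V"
  "twin \<sigma> V V' \<Longrightarrow> \<zero>\<^bsub>V'\<^esub> = \<zero>\<^bsub>V\<^esub>"
  "twin \<sigma> V V' \<Longrightarrow> add V' = add V"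
  by (auto simp: twin_def)

lemma sweedler_twin: "twin \<sigma> V V' \<Longrightarrow> sweedler V' = sweedler V"
  by (simp add: fun_eq_iff sweedler_def twin_def)

lemma tensor_eq_twin_imp:
  assumes "tensor_eq V' W' xs ys" and "twin \<sigma> V V'" "twin \<sigma> W W'"
  shows "tensor_eq V W xs ys"
  using assms
proof (induct rule: tensor_eq.induct)
  case (commute xs ys)
  then show ?case by (intro tensor_eq.commute) (auto simp: twin_def)
qed (auto simp: twin_def intro: tensor_eq.intros)

context
  fixes V :: "('a, 'b) univ_space" and W :: "('a, 'c) univ_space"
    and V' :: "('a, 'd) univ_space" and W' :: "('a, 'e) univ_space"
    and \<sigma>
  assumes twin: "twin \<sigma> V V'" "twin \<sigma> W W'"
begin

text \<open>The rule \<open>scale\<close> for c on one side is the rule for \<sigma>(c) on the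
  other, and \<sigma> is an involution, so inclusion holds in both directions. Equality of
  predicates, rather than equivalence of quotients, makes the chosen lists coincide.\<close>

lemma tensor_eq_twin: "tensor_eq V' W' = tensor_eq V W"
proof (intro ext iffI)
  show "tensor_eq V W xs ys" if "tensor_eq V' W' xs ys" for xs ys
    by (rule tensor_eq_twin_imp[OF that twin])
  show "tensor_eq V' W' xs ys" if "tensor_eq V W xs ys" for xs ys
    by (rule tensor_eq_twin_imp[OF that twin[THEN twin_sym]])
qed

lemma tensor_of_twin: "tensor_of V' W' = tensor_of V W"
  by (simp add: fun_eq_iff tensor_of_def tensor_eq_twin)

lemma pure_twin: "pure V' W' = pure V W"
  by (simp add: fun_eq_iff pure_def tensor_of_twin)

lemma tensor_twin: "twin \<sigma> (tensor V W) (tensor V' W')"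
  using twin by (simp add: twin_def tensor_def tensor_of_twin)

lemma tensor_map_twin: "tensor_map V' W' = tensor_map V W"
  using tensor_twin by (simp add: fun_eq_iff tensor_map_def sweedler_def pure_twin twin_def)

lemma flip_twin: "flip W' V' = flip W V"
  using tensor_twin by (simp add: fun_eq_iff flip_def sweedler_def pure_twin twin_def)

end

section \<open>Tensor products of algebras and their modules\<close>

sublocale complex_algebra \<subseteq> ring H by (rule ring)

context left_module
begin

lemma act_closed: "\<lbrakk>h \<in> carrier H; v \<in> carrier V\<rbrakk> \<Longrightarrow> h \<triangleright> v \<in> carrier V"
  using act_linear by (auto intro: linear_map_closed)

lemma act_add_right: "\<lbrakk>h \<in> carrier H; v \<in> carrier V; w \<in> carrier V\<rbrakk> \<Longrightarrow> h \<triangleright> (v \<oplus> w) = h \<triangleright> v \<oplus> h \<triangleright> w"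
  using act_linear by (auto intro: linear_map_add)

lemma act_smult_right: "\<lbrakk>h \<in> carrier H; v \<in> carrier V\<rbrakk> \<Longrightarrow> h \<triangleright> (c \<odot> v) = c \<odot> (h \<triangleright> v)"
  using act_linear by (auto intro: linear_map_smult)

lemmas act_simps = act_closed act_add_right act_smult_right act_add act_smult act_mult act_one vec_space

end

text \<open>The sum runs over the algebra element while the tensor \<open>t\<close> is acted on as a
  whole. This is the shape of the action in \<open>tensor_lmod\<close> with a general element in
  place of the coproduct, so that action becomes an instance by unfolding.\<close>

definition outer_act ::
  "('a univ, 'a univ) lmod \<Rightarrow> ('a univ, 'a univ) lmod \<Rightarrow> 'a univ \<Rightarrow> 'a univ \<Rightarrow> 'a univ" where
  "outer_act V W a t = sweedler (tensor V W) a (\<lambda>x y.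
     tensor_map V W (act V x) (act W y) t)"

definition outer ::
  "('a univ, 'a univ) lmod \<Rightarrow> ('a univ, 'a univ) lmod \<Rightarrow> ('a univ, 'a univ) lmod" where
  "outer V W = module.extend (tensor V W) (lmod.fields (outer_act V W))"

lemma outer_sel [simp]:
  "carrier (outer V W) = carrier (tensor V W)"
  "\<zero>\<^bsub>outer V W\<^esub> = \<zero>\<^bsub>tensor V W\<^esub>"
  "add (outer V W) = add (tensor V W)"
  "smult (outer V W) = smult (tensor V W)"
  "act (outer V W) = outer_act V W"
  by (simp_all add: outer_def module.defs lmod.defs)

text \<open>Module records carry further fields, such as the action; agreement of the vector space
  fields is enough to transfer the laws.\<close>

lemma vec_space_cong:
  assumes "vec_space V" "carrier W = carrier V" "\<zero>\<^bsub>W\<^esub> = \<zero>\<^bsub>V\<^esub>" "add W = add V" "smult W = smult V"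
  shows "vec_space W"
proof (rule vec_spaceI)
  interpret module complex_ring V by (rule assms(1))
  show "abelian_group W"
    by (rule abelian_groupI) (use assms a_ac in \<open>auto intro: l_neg a_inv_closed exI[of _ "\<ominus>\<^bsub>V\<^esub> _"]\<close>)
qed (use assms(1) in \<open>simp_all add: assms(2-) vec_smult_add_left vec_smult_add vec_smult_smult\<close>)

locale module_pair =
  A: complex_algebra A + B: complex_algebra B + V: left_module A V + W: left_module B W
  for A :: "('a, 'b) univ_space" and B :: "('a, 'c) univ_space"
    and V :: "('a univ, 'a univ) lmod" and W :: "('a univ, 'a univ) lmod"
begin

abbreviation "T \<equiv> tensor V W"

lemmas vs [simp] = A.vec_space B.vec_space V.vec_space W.vec_space

context
  fixes a b assumes ab: "a \<in> carrier A" "b \<in> carrier B"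
begin

lemmas act_map_pure = tensor_map_pure [OF vs(3,4,3,4) V.act_linear[OF ab(1)] W.act_linear[OF ab(2)]]
lemmas act_map_additive = tensor_map_additive [OF vs(3,4,3,4) V.act_linear[OF ab(1)] W.act_linear[OF ab(2)]]
lemmas act_map_linear = tensor_map_linear [OF vs(3,4,3,4) V.act_linear[OF ab(1)] W.act_linear[OF ab(2)]]
lemmas act_map_simps = act_map_pure additive_map_add[OF act_map_additive]
  additive_map_closed[OF act_map_additive] linear_map_smult[OF act_map_linear]

end

text \<open>Makes \<open>outer_act\<close> independent of the list that represents the algebra
  element.\<close>

lemma balanced_act_map:
  assumes t: "t \<in> carrier T"
  shows "balanced A B T (\<lambda>x y. tensor_map V W (act V x) (act W y) t)"
proof -
  have 1: "tensor_map V W (act V (x \<oplus>\<^bsub>A\<^esub> x')) (act W y) t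
     = tensor_map V W (act V x) (act W y) t \<oplus>\<^bsub>T\<^esub> tensor_map V W ((\<triangleright>\<^bsub>V\<^esub>) x') (act W y) t"
    if "x \<in> carrier A" "x' \<in> carrier A" "y \<in> carrier B" for x x' y
    using vs(3,4) t
    by (induct rule: tensor_induct)
      (use that in \<open>simp_all add: act_map_simps V.act_simps W.act_simps pure_add_left vec_ac\<close>)
  have 2: "tensor_map V W (act V x) (act W (y \<oplus>\<^bsub>B\<^esub> y')) t
     = tensor_map V W (act V x) (act W y) t \<oplus>\<^bsub>T\<^esub> tensor_map V W (act V x) ((\<triangleright>\<^bsub>W\<^esub>) y') t"
    if "x \<in> carrier A" "y \<in> carrier B" "y' \<in> carrier B" for x y y'
    using vs(3,4) t
    by (induct rule: tensor_induct)
      (use that in \<open>simp_all add: act_map_simps V.act_simps W.act_simps pure_add_right vec_ac\<close>)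
  have 3: "tensor_map V W (act V (c \<odot>\<^bsub>A\<^esub> x)) (act W y) t = tensor_map V W (act V x) (act W (c \<odot>\<^bsub>B\<^esub> y)) t"
    if "x \<in> carrier A" "y \<in> carrier B" for c x y
    using vs(3,4) t
    by (induct rule: tensor_induct)
      (use that in \<open>simp_all add: act_map_simps V.act_simps W.act_simps pure_smult_right\<close>)
  show ?thesis
    by (intro balancedI) (simp_all add: 1 2 3 act_map_simps t)
qed

lemma outer_act_pure_left:
  "\<lbrakk>a \<in> carrier A; b \<in> carrier B; t \<in> carrier T\<rbrakk> \<Longrightarrow>
    outer_act V W (pure A B a b) t = tensor_map V W (act V a) (act W b) t"
  unfolding outer_act_def by (simp add: sweedler_pure balanced_act_map)

lemma outer_act_pure:
  "\<lbrakk>a \<in> carrier A; b \<in> carrier B; v \<in> carrier V; w \<in> carrier W\<rbrakk> \<Longrightarrow>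
    outer_act V W (pure A B a b) (pure V W v w) = pure V W (a \<triangleright>\<^bsub>V\<^esub> v) (b \<triangleright>\<^bsub>W\<^esub> w)"
  by (simp add: outer_act_pure_left act_map_simps)

lemma outer_act_closed:
  "\<lbrakk>r \<in> carrier (tensor A B); t \<in> carrier T\<rbrakk> \<Longrightarrow> outer_act V W r t \<in> carrier T"
  unfolding outer_act_def by (intro sweedler_closed[of A B]) (simp_all add: act_map_simps)

lemma outer_act_add_left:
  "\<lbrakk>r \<in> carrier (tensor A B); s \<in> carrier (tensor A B); t \<in> carrier T\<rbrakk> \<Longrightarrow>
    outer_act V W (r \<oplus>\<^bsub>tensor A B\<^esub> s) t = outer_act V W r t \<oplus>\<^bsub>T\<^esub> outer_act V W s t"
  unfolding outer_act_def by (simp add: sweedler_add balanced_act_map)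

lemma outer_act_smult_left:
  assumes "r \<in> carrier (tensor A B)" and t: "t \<in> carrier T"
  shows "outer_act V W (c \<odot>\<^bsub>tensor A B\<^esub> r) t = c \<odot>\<^bsub>T\<^esub> outer_act V W r t"
  using vs(1,2) assms(1)
proof (induct rule: tensor_induct)
  case (pure a b)
  from vs(3,4) t show ?case
    by (induct rule: tensor_induct)
      (use pure in \<open>simp_all add: smult_pure outer_act_pure outer_act_pure_left act_map_simps
          V.act_simps W.act_simps vec_smult_add\<close>)
qed (use t in \<open>simp_all add: vec_smult_add outer_act_add_left outer_act_closed\<close>)

lemma outer_act_linear:
  assumes "r \<in> carrier (tensor A B)"
  shows "linear_map T T (outer_act V W r)"
proof (rule linear_mapI)
  fix s t assume st: "s \<in> carrier T" "t \<in> carrier T"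
  from vs(1,2) assms show "outer_act V W r (s \<oplus>\<^bsub>T\<^esub> t) = outer_act V W r s \<oplus>\<^bsub>T\<^esub> outer_act V W r t"
    by (induct rule: tensor_induct)
      (use st in \<open>simp_all add: outer_act_pure_left act_map_simps outer_act_add_left outer_act_closed
          vec_ac\<close>)
next
  fix c t assume t: "t \<in> carrier T"
  from vs(1,2) assms show "outer_act V W r (c \<odot>\<^bsub>T\<^esub> t) = c \<odot>\<^bsub>T\<^esub> outer_act V W r t"
    by (induct rule: tensor_induct)
      (use t in \<open>simp_all add: outer_act_pure_left act_map_simps outer_act_add_left outer_act_closed
          vec_smult_add\<close>)
qed (simp add: outer_act_closed assms)

lemmas outer_act_simps = outer_act_pure outer_act_closed outer_act_add_left outer_act_smult_left
  linear_map_add[OF outer_act_linear] linear_map_smult[OF outer_act_linear]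

end

section \<open>Regular modules and the tensor product of algebras\<close>

definition regular :: "(complex, 'v, 'b) module_scheme \<Rightarrow> ('v, 'v) lmod" where
  "regular A = \<lparr>carrier = carrier A, monoid.mult = mult A, one = one A, zero = zero A, add = add A,
     smult = smult A, act = mult A\<rparr>"

lemma regular_sel [simp]:
  "carrier (regular A) = carrier A" "\<zero>\<^bsub>regular A\<^esub> = \<zero>\<^bsub>A\<^esub>" "add (regular A) = add A"
  "smult (regular A) = smult A" "act (regular A) = mult A" "mult (regular A) = mult A" "one (regular A)
      = one A"
  by (simp_all add: regular_def)

lemma (in complex_algebra) regular_module: "left_module H (regular H)"
proof (rule left_module.intro)
  show "vec_space (regular H)" using vec_space by (rule vec_space_cong) auto
qed (auto intro!: linear_mapI simp: l_distr r_distr m_assoc smult_mult_left smult_mult_right vec_space)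

lemma tensor_regular: "tensor (regular A) (regular B) = tensor A B"
proof -
  have *: "twin (\<lambda>c. c) A (regular A)" "twin (\<lambda>c. c) B (regular B)" by (simp_all add: twin_def)
  show ?thesis by (simp add: tensor_def tensor_of_twin[OF *] pure_twin[OF *])
qed

lemma pure_regular: "pure (regular A) (regular B) = pure A B"
proof -
  have *: "twin (\<lambda>c. c) A (regular A)" "twin (\<lambda>c. c) B (regular B)" by (simp_all add: twin_def)
  show ?thesis by (simp add: pure_twin[OF *])
qed

context
  fixes A :: "('a, 'b) univ_space" and B :: "('a, 'c) univ_space"
  assumes alg: "complex_algebra A" "complex_algebra B"
begin

interpretation A: complex_algebra A by (rule alg)
interpretation B: complex_algebra B by (rule alg)
interpretation R: module_pair A B "regular A" "regular B"
  by (intro module_pair.intro alg A.regular_module B.regular_module)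

interpretation S: tensor_spaces A B by (rule tensor_spaces.intro[OF A.vec_space B.vec_space])

lemma tensor_mult_eq: "s \<otimes>\<^bsub>tensor A B\<^esub> t = tensor_of A B
    (concat (map (\<lambda>(a, b). map (\<lambda>(c, d). (a \<otimes>\<^bsub>A\<^esub> c, b \<otimes>\<^bsub>B\<^esub> d)) (summands t)) (summands s)))"
  by (simp add: tensor_def case_prod_beta' concat_map_singleton)

lemma tensor_mult_closed:
  assumes "s \<in> carrier (tensor A B)" "t \<in> carrier (tensor A B)"
  shows "s \<otimes>\<^bsub>tensor A B\<^esub> t \<in> carrier (tensor A B)"
  unfolding tensor_mult_eq
  using S.carrier_summands[OF assms(1)] S.carrier_summands[OF assms(2)]
  by (intro S.tensor_of_closed) force

lemma sweedler_mult:
  assumes "s \<in> carrier (tensor A B)" "t \<in> carrier (tensor A B)" and U: "vec_space U"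
      and \<beta>: "balanced A B U \<beta>"
  shows "sweedler U (s \<otimes>\<^bsub>tensor A B\<^esub> t) \<beta>
    = sweedler U s (\<lambda>a b. sweedler U t (\<lambda>c d. \<beta> (a \<otimes>\<^bsub>A\<^esub> c) (b \<otimes>\<^bsub>B\<^esub> d)))"
proof -
  have st: "\<And>a b. (a, b) \<in> set (summands s) \<Longrightarrow> a \<in> carrier A \<and> b \<in> carrier B"
    "\<And>a b. (a, b) \<in> set (summands t) \<Longrightarrow> a \<in> carrier A \<and> b \<in> carrier B"
    using S.carrier_summands[OF assms(1)] S.carrier_summands[OF assms(2)] by auto
  then have "concat (map (\<lambda>(a, b). map (\<lambda>(c, d). (a \<otimes>\<^bsub>A\<^esub> c, b \<otimes>\<^bsub>B\<^esub> d)) (summands t)) (summands s)) \<in> S.formal"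
    by fastforce
  then show ?thesis unfolding tensor_mult_eq
    using U by (subst S.sweedler_tensor_of[OF U \<beta>])
      (auto simp: st sweedler_eq_list_sum list_sum_map case_prod_beta'
        intro!: list_sum_cong HOL.trans[OF list_sum_concat] balancedD[OF \<beta>])
qed

lemma balanced_pure: "balanced A B (tensor A B) (pure A B)"
  by (intro balancedI) (simp_all add: pure_add_left pure_add_right pure_smult_right)

text \<open>Left multiplication is the outer action on the regular modules. Bilinearity,
  associativity and the left unit law of the product are then inherited from the action, without
  calculating with concatenated lists.\<close>

lemma tensor_mult_eq_act:
  "\<lbrakk>s \<in> carrier (tensor A B); t \<in> carrier (tensor A B)\<rbrakk>
    \<Longrightarrow> s \<otimes>\<^bsub>tensor A B\<^esub> t = outer_act (regular A) (regular B) s t"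
  using sweedler_mult[of s t "tensor A B" "pure A B"]
  by (simp add: sweedler_pures balanced_pure tensor_mult_closed outer_act_def tensor_map_def
      tensor_regular pure_regular)

lemma tensor_mult_pure:
  "\<lbrakk>a \<in> carrier A; b \<in> carrier B; c \<in> carrier A; d \<in> carrier B\<rbrakk>
    \<Longrightarrow> pure A B a b \<otimes>\<^bsub>tensor A B\<^esub> pure A B c d = pure A B (a \<otimes>\<^bsub>A\<^esub> c) (b \<otimes>\<^bsub>B\<^esub> d)"
  using R.outer_act_pure[of a b c d] by (simp add: tensor_mult_eq_act pure_regular)

lemma tensor_one: "\<one>\<^bsub>tensor A B\<^esub> = pure A B \<one>\<^bsub>A\<^esub> \<one>\<^bsub>B\<^esub>"
  by (simp add: tensor_def)

lemma tensor_mult_add_left: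
  "\<lbrakk>r \<in> carrier (tensor A B); s \<in> carrier (tensor A B); t \<in> carrier (tensor A B)\<rbrakk>
    \<Longrightarrow> (r \<oplus>\<^bsub>tensor A B\<^esub> s) \<otimes>\<^bsub>tensor A B\<^esub> t = r \<otimes>\<^bsub>tensor A B\<^esub> t \<oplus>\<^bsub>tensor A B\<^esub> s \<otimes>\<^bsub>tensor A B\<^esub> t"
  using R.outer_act_add_left[of r s t] by (simp add: tensor_mult_eq_act tensor_regular)

lemma tensor_mult_add_right:
  "\<lbrakk>r \<in> carrier (tensor A B); s \<in> carrier (tensor A B); t \<in> carrier (tensor A B)\<rbrakk>
    \<Longrightarrow> r \<otimes>\<^bsub>tensor A B\<^esub> (s \<oplus>\<^bsub>tensor A B\<^esub> t) = r \<otimes>\<^bsub>tensor A B\<^esub> s \<oplus>\<^bsub>tensor A B\<^esub> r \<otimes>\<^bsub>tensor A B\<^esub> t"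
  using linear_map_add[OF R.outer_act_linear, of r s t] by (simp add: tensor_mult_eq_act tensor_regular)

lemma tensor_mult_smult_left:
  "\<lbrakk>s \<in> carrier (tensor A B); t \<in> carrier (tensor A B)\<rbrakk>
    \<Longrightarrow> (c \<odot>\<^bsub>tensor A B\<^esub> s) \<otimes>\<^bsub>tensor A B\<^esub> t = c \<odot>\<^bsub>tensor A B\<^esub> (s \<otimes>\<^bsub>tensor A B\<^esub> t)"
  using R.outer_act_smult_left[of s t c] by (simp add: tensor_mult_eq_act tensor_regular)

lemma tensor_mult_smult_right:
  "\<lbrakk>s \<in> carrier (tensor A B); t \<in> carrier (tensor A B)\<rbrakk>
    \<Longrightarrow> s \<otimes>\<^bsub>tensor A B\<^esub> (c \<odot>\<^bsub>tensor A B\<^esub> t) = c \<odot>\<^bsub>tensor A B\<^esub> (s \<otimes>\<^bsub>tensor A B\<^esub> t)"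
  using linear_map_smult[OF R.outer_act_linear, of s t c] by (simp add: tensor_mult_eq_act tensor_regular)

lemmas tensor_mult_simps = tensor_mult_closed tensor_mult_pure tensor_mult_add_left tensor_mult_add_right

end

context module_pair
begin

lemmas tensor_mult_simps' = tensor_mult_simps[OF A.complex_algebra_axioms B.complex_algebra_axioms]

text \<open>Both sides are additive in each of the three tensors, and on pure tensors the claim is
  the module law of each factor.\<close>

lemma outer_act_mult:
  assumes r: "r \<in> carrier (tensor A B)" and s: "s \<in> carrier (tensor A B)" and t: "t \<in> carrier T"
  shows "outer_act V W (r \<otimes>\<^bsub>tensor A B\<^esub> s) t = outer_act V W r (outer_act V W s t)"
  using vs(1,2) r
proof (induct rule: tensor_induct)
  case r: (pure a b)
  from vs(1,2) s show ?case
  proof (induct rule: tensor_induct)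
    case s: (pure c d)
    from vs(3,4) t show ?case
      by (induct rule: tensor_induct)
        (use r s in \<open>simp_all add: tensor_mult_simps' outer_act_simps V.act_simps W.act_simps\<close>)
  qed (use r t in \<open>simp_all add: tensor_mult_simps' outer_act_simps\<close>)
qed (use s t in \<open>simp_all add: tensor_mult_simps' outer_act_simps\<close>)

lemma outer_act_one: "t \<in> carrier T \<Longrightarrow> outer_act V W \<one>\<^bsub>tensor A B\<^esub> t = t"
  using vs(3,4)
  by (rule tensor_induct)
    (simp_all add: tensor_one[OF A.complex_algebra_axioms B.complex_algebra_axioms]
      outer_act_simps V.act_simps W.act_simps)

end

lemma complex_algebra_tensor:
  fixes A :: "('a, 'b) univ_space" and B :: "('a, 'c) univ_space"
  assumes alg: "complex_algebra A" "complex_algebra B"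
  shows "complex_algebra (tensor A B)"
proof -
  interpret A: complex_algebra A by (rule alg)
  interpret B: complex_algebra B by (rule alg)
  interpret R: module_pair A B "regular A" "regular B"
    by (intro module_pair.intro alg A.regular_module B.regular_module)
  have vs: "vec_space (tensor A B)" by simp
  note simps = tensor_mult_simps[OF alg] tensor_mult_smult_left[OF alg] tensor_mult_smult_right[OF alg]
      tensor_one[OF alg]
  show ?thesis
  proof (rule complex_algebra.intro)
    show "ring (tensor A B)"
    proof (rule ringI)
      show "abelian_group (tensor A B)" by (rule vec_abelian_group[OF vs])
      show "monoid (tensor A B)"
      proof (rule monoidI)
        fix r s t assume "r \<in> carrier (tensor A B)" "s \<in> carrier (tensor A B)" "t \<in> carrier (tensor A B)"
        then show "r \<otimes>\<^bsub>tensor A B\<^esub> s \<otimes>\<^bsub>tensor A B\<^esub> t = r \<otimes>\<^bsub>tensor A B\<^esub> (s \<otimes>\<^bsub>tensor A B\<^esub> t)"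
          using R.outer_act_mult[of r s t] by (simp add: tensor_mult_eq_act[OF alg, symmetric] simps
              tensor_regular)
      next
        fix t assume t: "t \<in> carrier (tensor A B)"
        then show "\<one>\<^bsub>tensor A B\<^esub> \<otimes>\<^bsub>tensor A B\<^esub> t = t"
          using R.outer_act_one[of t] by (simp add: tensor_mult_eq_act[OF alg, symmetric] simps
              tensor_regular)
        \<comment> \<open>The regular action only sees multiplication from the left, so the right
          unit law is checked on pure tensors.\<close>
        from A.vec_space B.vec_space t show "t \<otimes>\<^bsub>tensor A B\<^esub> \<one>\<^bsub>tensor A B\<^esub> = t"
          by (induct rule: tensor_induct) (simp_all add: simps)
      qed (simp_all add: simps)
    qed (simp_all add: simps)
  qed (simp_all add: simps)
qed

context module_pair
begin

sublocale tensor: complex_algebra "tensor A B"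
  by (rule complex_algebra_tensor) unfold_locales

lemma outer_module: "left_module (tensor A B) (outer V W)"
proof (rule left_module.intro)
  show "vec_space (outer V W)" by (rule vec_space_cong[of T]) simp_all
  show "linear_map (outer V W) (outer V W) ((\<triangleright>\<^bsub>outer V W\<^esub>) h)" if "h \<in> carrier (tensor A B)" for h
    using outer_act_linear[OF that] by (simp add: linear_map_def additive_map_def)
qed (simp_all add: outer_act_simps outer_act_mult outer_act_one)

end

section \<open>Interchange of sums and functoriality of the tensor product\<close>

lemma list_sum_swap:
  assumes U: "vec_space U" and f: "\<And>x y. \<lbrakk>x \<in> set xs; y \<in> set ys\<rbrakk> \<Longrightarrow> f x y \<in> carrier U"
  shows "list_sum U (\<lambda>x. list_sum U (f x) ys) xs = list_sum U (\<lambda>y. list_sum U (\<lambda>x. f x y) xs) ys"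
  using f
proof (induct xs)
  case Nil
  show ?case using U by (induct ys) auto
next
  case (Cons x xs)
  have "list_sum U (\<lambda>x. list_sum U (f x) ys) xs = list_sum U (\<lambda>y. list_sum U (\<lambda>x. f x y) xs) ys"
    by (rule Cons.hyps) (simp add: Cons.prems)
  with Cons.prems U show ?case
    by (simp add: list_sum_add list_sum_closed)
qed

lemma sweedler_swap:
  assumes vs: "vec_space V" "vec_space W" "vec_space V'" "vec_space W'" "vec_space U"
    and s: "s \<in> carrier (tensor V W)" and t: "t \<in> carrier (tensor V' W')"
    and f: "\<And>a b c d. \<lbrakk>a \<in> carrier V; b \<in> carrier W; c \<in> carrier V'; d \<in> carrier W'\<rbrakk>
        \<Longrightarrow> f a b c d \<in> carrier U"
  shows "sweedler U s (\<lambda>a b. sweedler U t (f a b)) = sweedler U t (\<lambda>c d. sweedler U s (\<lambda>a b. f a b c d))"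
proof -
  interpret S: tensor_spaces V W by (rule tensor_spaces.intro[OF vs(1,2)])
  interpret S': tensor_spaces V' W' by (rule tensor_spaces.intro[OF vs(3,4)])
  have "f (fst x) (snd x) (fst y) (snd y) \<in> carrier U" if "x \<in> set (summands s)" "y \<in> set (summands t)"
      for x y
    using that S.carrier_summands[OF s] S'.carrier_summands[OF t] by (intro f) auto
  from list_sum_swap[OF vs(5) this] show ?thesis
    by (simp add: sweedler_eq_list_sum case_prod_beta')
qed

lemma sweedler_tensor_map:
  assumes vs: "vec_space V" "vec_space W" "vec_space V'" "vec_space W'" "vec_space U"
    and fg: "linear_map V V' f" "linear_map W W' g" and \<beta>: "balanced V' W' U \<beta>"
        and t: "t \<in> carrier (tensor V W)"
  shows "sweedler U (tensor_map V' W' f g t) \<beta> = sweedler U t (\<lambda>v w. \<beta> (f v) (g w))"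
  unfolding tensor_map_def using assms
  by (subst additive_sweedler[of V W "tensor V' W'" U "\<lambda>t. sweedler U t \<beta>"])
    (auto simp: linear_map_closed sweedler_pure intro!: additive_sweedler_map sweedler_cong[of V W])

text \<open>Two different scalar twists are allowed, because the linear map S is followed by the
  antilinear star.\<close>

lemma semilinear_tensor_map_compose:
  assumes vs: "vec_space V" "vec_space W" "vec_space V'" "vec_space W'" "vec_space V''" "vec_space W''"
    and f: "semilinear_map \<sigma> V V' f" "semilinear_map \<sigma> W W' g"
    and f': "semilinear_map \<tau> V' V'' f'" "semilinear_map \<tau> W' W'' g'"
    and t: "t \<in> carrier (tensor V W)"
  shows "tensor_map V'' W'' f' g' (tensor_map V' W' f g t)
      = tensor_map V'' W'' (\<lambda>v. f' (f v)) (\<lambda>w. g' (g w)) t"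
proof -
  have c: "semilinear_map (\<lambda>c. \<tau> (\<sigma> c)) V V'' (\<lambda>v. f' (f v))" "semilinear_map (\<lambda>c. \<tau> (\<sigma> c)) W W''
      (\<lambda>v. g' (g v))"
    using f f' by (auto simp: semilinear_map_def additive_map_def Pi_iff)
  have cl: "f v \<in> carrier V'" "g w \<in> carrier W'" if "v \<in> carrier V" "w \<in> carrier W" for v w
    using f that by (auto simp: semilinear_map_def additive_map_def)
  note maps = vs(1-4) f  vs(3-6) f'  vs(1,2,5,6) c
  show ?thesis
  proof (rule additive_map_tensor_eqI[OF t vs(1,2)])
    show "additive_map (tensor V W) (tensor V'' W'')
        (\<lambda>t. tensor_map V'' W'' f' g' (tensor_map V' W' f g t))"
      by (rule additive_map_compose[OF semilinear_tensor_map_additive[OF maps(1-6)]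
          semilinear_tensor_map_additive[OF maps(7-12)]])
    show "additive_map (tensor V W) (tensor V'' W'') (tensor_map V'' W'' (\<lambda>v. f' (f v)) (\<lambda>w. g' (g w)))"
      by (rule semilinear_tensor_map_additive[OF maps(13-18)])
  qed (simp add: cl semilinear_tensor_map_pure[OF maps(1-6)] semilinear_tensor_map_pure[OF maps(7-12)]
      semilinear_tensor_map_pure[OF maps(13-18)])
qed

lemmas tensor_map_compose = semilinear_tensor_map_compose
  [where \<sigma> = "\<lambda>c. c" and \<tau> = "\<lambda>c. c", folded linear_semilinear]

lemma tensor_map_cong:
  "\<lbrakk>vec_space V; vec_space W; \<And>v. v \<in> carrier V \<Longrightarrow> f v = f' v; \<And>w. w \<in> carrier W \<Longrightarrow> g w = g' w;
    t \<in> carrier (tensor V W)\<rbrakk> \<Longrightarrow> tensor_map V' W' f g t = tensor_map V' W' f' g' t"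
  unfolding tensor_map_def by (rule sweedler_cong[of V W]) auto

lemma tensor_map_id: "\<lbrakk>vec_space V; vec_space W; t \<in> carrier (tensor V W)\<rbrakk>
    \<Longrightarrow> tensor_map V W (\<lambda>v. v) (\<lambda>w. w) t = t"
  unfolding tensor_map_def by (simp add: sweedler_pures)

text \<open>A tensor product of algebra homomorphisms is multiplicative. It serves to contract the
  middle factor of the cocycle identity, where one homomorphism applies the counit to half of H
  \<otimes> H.\<close>

lemma tensor_map_mult:
  assumes alg: "complex_algebra A" "complex_algebra B" "complex_algebra A'" "complex_algebra B'"
    and fg: "linear_map A A' f" "linear_map B B' g"
    and f: "\<And>x y. \<lbrakk>x \<in> carrier A; y \<in> carrier A\<rbrakk> \<Longrightarrow> f (x \<otimes>\<^bsub>A\<^esub> y) = f x \<otimes>\<^bsub>A'\<^esub> f y"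
    and g: "\<And>x y. \<lbrakk>x \<in> carrier B; y \<in> carrier B\<rbrakk> \<Longrightarrow> g (x \<otimes>\<^bsub>B\<^esub> y) = g x \<otimes>\<^bsub>B'\<^esub> g y"
    and s: "s \<in> carrier (tensor A B)" and t: "t \<in> carrier (tensor A B)"
  shows "tensor_map A' B' f g (s \<otimes>\<^bsub>tensor A B\<^esub> t)
      = tensor_map A' B' f g s \<otimes>\<^bsub>tensor A' B'\<^esub> tensor_map A' B' f g t"
proof -
  interpret A: complex_algebra A by (rule alg)
  interpret B: complex_algebra B by (rule alg)
  note vs = alg[THEN complex_algebra.vec_space]
  note simps = tensor_mult_simps[OF alg(1,2)] tensor_mult_simps[OF alg(3,4)] tensor_map_pure[OF vs fg]
    additive_map_add[OF tensor_map_additive[OF vs fg]] additive_map_closed[OF tensor_map_additive[OF vs fg]]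
    linear_map_closed[OF fg(1)] linear_map_closed[OF fg(2)] vs f g
  from vs(1,2) s show ?thesis
  proof (induct rule: tensor_induct)
    case s: (pure a b)
    from vs(1,2) t show ?case
      by (induct rule: tensor_induct) (use s in \<open>simp_all add: simps\<close>)
  qed (use t in \<open>simp_all add: simps\<close>)
qed

section \<open>The antipode\<close>

context complex_algebra
begin

lemma mult_additive_left: "y \<in> carrier H \<Longrightarrow> additive_map H H (\<lambda>x. x \<otimes> y)"
  by (rule additive_mapI) (auto simp: l_distr)

lemma mult_additive_right: "y \<in> carrier H \<Longrightarrow> additive_map H H (\<lambda>x. y \<otimes> x)"
  by (rule additive_mapI) (auto simp: r_distr)

end

context hopf_algebra
begin

sublocale HH: complex_algebra "tensor H H"
  by (rule complex_algebra_tensor) unfold_locales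

abbreviation "HH \<equiv> tensor H H"

abbreviation HH_mult (infixl \<open>\<bullet>\<close> 70) where
  "s \<bullet> t \<equiv> s \<otimes>\<^bsub>HH\<^esub> t"

lemmas vs [simp] = vec_space
lemmas alg = complex_algebra_axioms
lemmas tensor_simps = tensor_mult_simps[OF alg alg] tensor_one[OF alg alg]

lemma coprod_closed [simp]: "h \<in> carrier H \<Longrightarrow> coprod H h \<in> carrier HH"
  by (rule linear_map_closed[OF coprod_linear])

lemma antipode_closed [simp]: "h \<in> carrier H \<Longrightarrow> antipode H h \<in> carrier H"
  by (rule linear_map_closed[OF antipode_linear])

lemmas antipode_additive = linear_map_additive[OF antipode_linear]

lemmas hopf_linear_simps =
  linear_map_add[OF coprod_linear] linear_map_smult[OF coprod_linear]
  linear_map_add[OF antipode_linear] linear_map_smult[OF antipode_linear]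
  counit_add counit_smult

text \<open>The orientation collects scalars in front of tensors and products, where they are merged
  and ordered.\<close>

lemmas bilinear_simps = l_distr r_distr smult_mult_left smult_mult_right vec_smult_add_left vec_smult_add
  HH.l_distr HH.r_distr HH.smult_mult_left HH.smult_mult_right pure_add_left pure_add_right
  pure_smult_right smult_pure[symmetric] vec_smult_smult mult.commute hopf_linear_simps

lemma balanced_counit:
  "balanced H H H (\<lambda>x y. counit H y \<odot> x)" "balanced H H H (\<lambda>x y. counit H x \<odot> y)"
  by (auto intro!: balancedI simp: bilinear_simps)

lemma sweedler_counit_closed:
  "t \<in> carrier HH \<Longrightarrow> sweedler H t (\<lambda>x y. counit H y \<odot> x) \<in> carrier H"
  "t \<in> carrier HH \<Longrightarrow> sweedler H t (\<lambda>x y. counit H x \<odot> y) \<in> carrier H"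
  by (auto intro!: sweedler_closed[of H H])

lemmas sweedler_counit_simps = sweedler_counit_closed
  sweedler_pure[OF vs vs vs balanced_counit(1)] sweedler_pure[OF vs vs vs balanced_counit(2)]
  sweedler_add[OF vs vs vs balanced_counit(1)] sweedler_add[OF vs vs vs balanced_counit(2)]

text \<open>Coassociativity as used in Sweedler calculus: a threefold coproduct may be split further
  on its left or on its right leg under any \<tau> for which the nested sums are well
  defined.\<close>

lemma coassoc_sweedler:
  assumes X: "vec_space X"
    and left: "\<And>w. w \<in> carrier H \<Longrightarrow> balanced H H X (\<lambda>u v. \<tau> u v w)"
    and right: "\<And>u. u \<in> carrier H \<Longrightarrow> balanced H H X (\<tau> u)"
    and h: "h \<in> carrier H"
  shows "sweedler X (coprod H h) (\<lambda>a b. sweedler X (coprod H a) (\<lambda>c d. \<tau> c d b))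
    = sweedler X (coprod H h) (\<lambda>a b. sweedler X (coprod H b) (\<tau> a))"
proof -
  note b = balanced_sweedler_left[OF vs vs vs X left right]
      balanced_sweedler_right[OF vs vs vs X left right]
  let ?l = "tensor_map HH H (coprod H) (\<lambda>x. x) (coprod H h)"
  have "?l \<in> carrier (tensor HH H)"
    by (rule linear_map_closed[OF tensor_map_linear[of H H]]) (use h coprod_linear linear_map_id in auto)
  then have "sweedler X ?l (\<lambda>s w. sweedler X s (\<lambda>u v. \<tau> u v w))
    = sweedler X (reassoc H H H ?l) (\<lambda>u s. sweedler X s (\<tau> u))"
    by (subst sweedler_reassoc) (simp_all add: X left right)
  also have "\<dots> = sweedler X (tensor_map H HH (\<lambda>x. x) (coprod H) (coprod H h)) (\<lambda>u s. sweedler X s (\<tau> u))"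
    using h by (simp add: coassoc)
  finally show ?thesis
    using h X b
    by (simp add: sweedler_tensor_map[of H H HH H X "coprod H" "\<lambda>x. x"]
        sweedler_tensor_map[of H H H HH X "\<lambda>x. x" "coprod H"] coprod_linear linear_map_id)
qed

text \<open>In the convolution algebra Hom(H, A) a unital homomorphism j has the right inverse j S.
  If \<psi> * j = \<epsilon> a, multiplying by j S on the right gives \<psi> = a (j S). With j the
  identity this yields that S reverses products; with j = \<Delta>, that S reverses
  coproducts.\<close>

lemma convolution_antipode:
  assumes A: "complex_algebra A" and j: "linear_map H A j" and \<psi>: "linear_map H A \<psi>"
    and j_mult: "\<And>x y. \<lbrakk>x \<in> carrier H; y \<in> carrier H\<rbrakk> \<Longrightarrow> j (x \<otimes> y) = j x \<otimes>\<^bsub>A\<^esub> j y"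
    and j_one: "j \<one> = \<one>\<^bsub>A\<^esub>" and a: "a \<in> carrier A"
    and conv: "\<And>k. k \<in> carrier H \<Longrightarrow> sweedler A (coprod H k) (\<lambda>x y. \<psi> x \<otimes>\<^bsub>A\<^esub> j y) = counit H k \<odot>\<^bsub>A\<^esub> a"
    and k: "k \<in> carrier H"
  shows "\<psi> k = a \<otimes>\<^bsub>A\<^esub> j (antipode H k)"
proof -
  interpret A: complex_algebra A by (rule A)
  note vsA = A.vec_space
  note cl [simp] = linear_map_closed[OF j] linear_map_closed[OF \<psi>]
  note simps = linear_map_add[OF j] linear_map_smult[OF j] linear_map_add[OF \<psi>] linear_map_smult[OF \<psi>]
    A.l_distr A.r_distr A.smult_mult_left A.smult_mult_right hopf_linear_simps
  let ?\<tau> = "\<lambda>x y z. \<psi> x \<otimes>\<^bsub>A\<^esub> j y \<otimes>\<^bsub>A\<^esub> j (antipode H z)"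
  have "a \<otimes>\<^bsub>A\<^esub> j (antipode H k)
      = a \<otimes>\<^bsub>A\<^esub> j (antipode H (sweedler H (coprod H k) (\<lambda>x y. counit H x \<odot> y)))"
    using k by (simp add: counit_left)
  also have "\<dots> = sweedler A (coprod H k) (\<lambda>x y. a \<otimes>\<^bsub>A\<^esub> j (antipode H (counit H x \<odot> y)))"
    using k a vsA
    by (intro additive_sweedler[of H H H A "\<lambda>z. a \<otimes>\<^bsub>A\<^esub> j (antipode H z)"])
      (auto intro!: additive_mapI simp: simps)
  also have "\<dots> = sweedler A (coprod H k) (\<lambda>x y. sweedler A (coprod H x) (\<lambda>c d. ?\<tau> c d y))"
  proof (rule sweedler_cong[of H H])
    fix x y assume xy: "x \<in> carrier H" "y \<in> carrier H"
    have "a \<otimes>\<^bsub>A\<^esub> j (antipode H (counit H x \<odot> y))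
      = sweedler A (coprod H x) (\<lambda>x y. \<psi> x \<otimes>\<^bsub>A\<^esub> j y) \<otimes>\<^bsub>A\<^esub> j (antipode H y)"
      using xy a by (simp add: conv simps)
    also have "\<dots> = sweedler A (coprod H x) (\<lambda>c d. ?\<tau> c d y)"
      using xy vsA by (intro additive_sweedler[of H H A A] A.mult_additive_left) auto
    finally show "a \<otimes>\<^bsub>A\<^esub> j (antipode H (counit H x \<odot> y)) = sweedler A (coprod H x) (\<lambda>c d. ?\<tau> c d y)" .
  qed (use k in simp_all)
  \<comment> \<open>Rebracketing (\<psi> * j) * (j S) as \<psi> * (j * (j S)).\<close>
  also have "\<dots> = sweedler A (coprod H k) (\<lambda>x y. sweedler A (coprod H y) (?\<tau> x))"
    by (rule coassoc_sweedler[OF vsA _ _ k]) (intro balancedI, simp_all add: simps)+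
  \<comment> \<open>The inner sum is j applied to the right antipode axiom for y, so it contributes
    the scalar \<epsilon>(y).\<close>
  also have "\<dots> = sweedler A (coprod H k) (\<lambda>x y. \<psi> (counit H y \<odot> x))"
  proof (rule sweedler_cong[of H H])
    fix x y assume xy: "x \<in> carrier H" "y \<in> carrier H"
    have "sweedler A (coprod H y) (?\<tau> x) = sweedler A (coprod H y) (\<lambda>c d. \<psi> x \<otimes>\<^bsub>A\<^esub> j (c \<otimes> antipode H d))"
      using xy by (intro sweedler_cong[of H H]) (simp_all add: A.m_assoc j_mult)
    also have "\<dots> = \<psi> x \<otimes>\<^bsub>A\<^esub> j (sweedler H (coprod H y) (\<lambda>c d. c \<otimes> antipode H d))"
      using xy vsA
      by (intro additive_sweedler[symmetric, of H H H A "\<lambda>z. \<psi> x \<otimes>\<^bsub>A\<^esub> j z"])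
        (auto intro!: additive_mapI simp: simps)
    also have "\<dots> = \<psi> (counit H y \<odot> x)"
      using xy by (simp add: antipode_right simps j_one)
    finally show "sweedler A (coprod H y) (?\<tau> x) = \<psi> (counit H y \<odot> x)" .
  qed (use k in simp_all)
  also have "\<dots> = \<psi> (sweedler H (coprod H k) (\<lambda>x y. counit H y \<odot> x))"
    using k vsA by (intro additive_sweedler[symmetric, of H H H A] linear_map_additive[OF \<psi>]) auto
  also have "\<dots> = \<psi> k" using k by (simp add: counit_right)
  finally show ?thesis by simp
qed

lemma antipode_one: "antipode H \<one> = \<one>"
proof -
  have "balanced H H H (\<lambda>x y. antipode H x \<otimes> y)" by (intro balancedI) (simp_all add: bilinear_simps)
  then show ?thesis
    using antipode_left[of \<one>] by (simp add: coprod_one tensor_simps sweedler_pure counit_one)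
qed

text \<open>The antipode axiom for a product hk involves two coproducts at once, so the convolution
  argument is run twice, one variable at a time. The auxiliary identity is S(h1 k) h2 =
  \<epsilon>(h) S(k), where h1 and h2 are the legs of \<Delta>h.\<close>

lemma antipode_mult:
  assumes h: "h \<in> carrier H" and k: "k \<in> carrier H"
  shows "antipode H (h \<otimes> k) = antipode H k \<otimes> antipode H h"
proof -
  have bal: "balanced H H H (\<lambda>x y. antipode H x \<otimes> y)"
    by (intro balancedI) (simp_all add: bilinear_simps)
  have *: "sweedler H (coprod H h) (\<lambda>x y. antipode H (x \<otimes> k) \<otimes> y) = counit H h \<odot> antipode H k"
    if h: "h \<in> carrier H" and k: "k \<in> carrier H" for h k
  proof -
    let ?\<psi> = "\<lambda>k. sweedler H (coprod H h) (\<lambda>x y. antipode H (x \<otimes> k) \<otimes> y)"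
    have cl: "?\<psi> k \<in> carrier H" if "k \<in> carrier H" for k
      using that h by (intro sweedler_closed[of H H]) auto
    have "?\<psi> k = counit H h \<odot> \<one> \<otimes> antipode H k"
    proof (rule convolution_antipode[OF alg linear_map_id, where k = k])
      show "linear_map H H ?\<psi>"
      proof (rule linear_mapI)
        fix x y assume xy: "x \<in> carrier H" "y \<in> carrier H"
        show "?\<psi> (x \<oplus> y) = ?\<psi> x \<oplus> ?\<psi> y"
          using xy h by (subst sweedler_sum[symmetric, of H H]) (auto intro!: sweedler_cong[of H H]
              simp: bilinear_simps)
      next
        fix c x assume x: "x \<in> carrier H"
        show "?\<psi> (c \<odot> x) = c \<odot> ?\<psi> x"
          using x h by (subst additive_sweedler[of H H H H "\<lambda>x. c \<odot> x"])
            (auto intro!: sweedler_cong[of H H] additive_mapI simp: bilinear_simps)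
      qed (rule cl)
    next
      fix l assume l: "l \<in> carrier H"
      have "counit H l \<odot> (counit H h \<odot> \<one>) = sweedler H (coprod H (h \<otimes> l)) (\<lambda>x y. antipode H x \<otimes> y)"
        using h l by (simp add: antipode_left counit_mult vec_smult_smult mult.commute)
      also have "\<dots> = sweedler H (coprod H h) (\<lambda>a b. sweedler H (coprod H l)
          (\<lambda>c d. antipode H (a \<otimes> c) \<otimes> (b \<otimes> d)))"
        using h l bal by (simp add: coprod_mult sweedler_mult[OF alg alg])
      also have "\<dots> = sweedler H (coprod H l) (\<lambda>c d. sweedler H (coprod H h)
          (\<lambda>a b. antipode H (a \<otimes> c) \<otimes> (b \<otimes> d)))"
        using h l by (intro sweedler_swap[of H H H H H]) auto
      also have "\<dots> = sweedler H (coprod H l) (\<lambda>c d. ?\<psi> c \<otimes> d)"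
      proof (rule sweedler_cong[of H H])
        fix c d assume cd: "c \<in> carrier H" "d \<in> carrier H"
        have "sweedler H (coprod H h) (\<lambda>a b. antipode H (a \<otimes> c) \<otimes> (b \<otimes> d))
          = sweedler H (coprod H h) (\<lambda>a b. antipode H (a \<otimes> c) \<otimes> b \<otimes> d)"
          using h cd by (intro sweedler_cong[of H H]) (simp_all add: m_assoc)
        also have "\<dots> = ?\<psi> c \<otimes> d"
          using h cd by (intro additive_sweedler[symmetric, of H H H H] mult_additive_left) auto
        finally show "sweedler H (coprod H h) (\<lambda>a b. antipode H (a \<otimes> c) \<otimes> (b \<otimes> d)) = ?\<psi> c \<otimes> d" .
      qed (use l in simp_all)
      finally show "sweedler H (coprod H l) (\<lambda>c d. ?\<psi> c \<otimes> d) = counit H l \<odot> (counit H h \<odot> \<one>)" by simp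
    qed (use k in simp_all)
    then show ?thesis using k by (simp add: smult_mult_left)
  qed
  \<comment> \<open>Now k is fixed: the auxiliary identity says that h \<mapsto> S(hk) convolves
    with the identity map to \<epsilon>(h) S(k).\<close>
  show ?thesis
  proof (rule convolution_antipode[OF alg linear_map_id, where k = h and \<psi> = "\<lambda>h. antipode H (h \<otimes> k)"])
  qed (use h k in \<open>auto simp: * bilinear_simps intro!: linear_mapI\<close>)
qed

lemma counit_antipode:
  assumes h: "h \<in> carrier H"
  shows "counit H (antipode H h) = counit H h"
proof -
  \<comment> \<open>Sweedler sums take values in a vector space record, so \<epsilon> is replaced by
    its multiple of the unit of H and recovered at the end by applying \<epsilon> once more.\<close>
  let ?u = "\<lambda>h. counit H h \<odot> \<one>"
  have u: "additive_map H H ?u" by (intro additive_mapI) (simp_all add: bilinear_simps)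
  have "?u (antipode H h) = ?u (antipode H (sweedler H (coprod H h) (\<lambda>x y. counit H x \<odot> y)))"
    using h by (simp add: counit_left)
  also have "\<dots> = sweedler H (coprod H h) (\<lambda>x y. ?u (antipode H (counit H x \<odot> y)))"
    using h by (intro additive_sweedler[of H H H H "\<lambda>h. ?u (antipode H h)"]
        additive_map_compose[OF antipode_additive u]) auto
  also have "\<dots> = sweedler H (coprod H h) (\<lambda>x y. ?u (x \<otimes> antipode H y))"
    using h by (intro sweedler_cong[of H H]) (simp_all add: hopf_linear_simps counit_mult)
  also have "\<dots> = ?u (sweedler H (coprod H h) (\<lambda>x y. x \<otimes> antipode H y))"
    using h by (intro additive_sweedler[symmetric, of H H H H ?u] u) auto
  also have "\<dots> = ?u h" using h by (simp add: antipode_right counit_smult counit_one)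
  finally have "counit H (?u (antipode H h)) = counit H (?u h)" by simp
  then show ?thesis by (simp add: counit_smult counit_one)
qed

text \<open>Take j = \<Delta> and a = 1 in the convolution lemma: S h2 \<otimes> S h1, like
  \<Delta>(S h), is a convolution inverse of \<Delta>. In the fourfold product the two inner legs
  cancel first, then the two outer ones.\<close>

lemma antipode_coprod:
  assumes h: "h \<in> carrier H"
  shows "coprod H (antipode H h) = tensor_map H H (antipode H) (antipode H) (flip H H (coprod H h))"
proof -
  let ?F = "\<lambda>t. sweedler HH t (\<lambda>x y. pure H H (antipode H y) (antipode H x))"
  let ?\<psi> = "\<lambda>h. ?F (coprod H h)"
  have bal: "balanced H H HH (\<lambda>x y. pure H H (antipode H y) (antipode H x))"
    by (intro balancedI) (simp_all add: bilinear_simps)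
  have F: "?F t = tensor_map H H (antipode H) (antipode H) (flip H H t)" if "t \<in> carrier HH" for t
  proof (rule additive_map_tensor_eqI[OF that vs vs])
    show "additive_map HH HH (\<lambda>t. tensor_map H H (antipode H) (antipode H) (flip H H t))"
      by (rule additive_map_compose[OF flip_additive tensor_map_additive]) (auto simp: antipode_linear)
  qed (auto intro!: additive_sweedler_map bal
       simp: antipode_linear sweedler_pure[OF _ _ _ bal] flip_pure tensor_map_pure)
  have \<psi>: "linear_map H HH ?\<psi>"
  proof (rule linear_mapI)
    fix c x assume "x \<in> carrier H"
    then show "?\<psi> (c \<odot> x) = c \<odot>\<^bsub>HH\<^esub> ?\<psi> x"
      using linear_map_smult[OF tensor_map_linear[of H H H H "antipode H" "antipode H"]]
        linear_map_smult[OF flip_linear[of H H]] linear_map_closed[OF flip_linear[of H H]]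
      by (simp add: F hopf_linear_simps antipode_linear)
  qed (auto simp: hopf_linear_simps sweedler_add[OF _ _ _ bal] intro!: sweedler_closed[of H H])
  have "?\<psi> h = \<one>\<^bsub>HH\<^esub> \<bullet> coprod H (antipode H h)"
  proof (rule convolution_antipode[OF HH.complex_algebra_axioms coprod_linear \<psi> coprod_mult coprod_one])
    fix h assume h: "h \<in> carrier H"
    let ?\<tau> = "\<lambda>c d b. pure H H (antipode H d) (antipode H c) \<bullet> coprod H b"
    let ?\<tau>' = "\<lambda>a c e f. pure H H (antipode H c \<otimes> e) (antipode H a \<otimes> f)"
    have bal': "balanced H H HH (?\<tau>' a c)" "balanced H H HH (\<lambda>c e. ?\<tau>' a c e f)"
        if "a \<in> carrier H" "c \<in> carrier H" "f \<in> carrier H" for a c f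
      using that by (auto intro!: balancedI simp: bilinear_simps)
    \<comment> \<open>The first tensor leg contains an adjacent pair S(c) e, with c and e
      consecutive legs of the coproduct of b. Coassociativity makes them the two legs of a single
      coproduct, so the antipode axiom reduces this leg to 1 and the counit axiom restores b in the
      other.\<close>
    have inner: "sweedler HH (coprod H b) (?\<tau> a) = pure H H \<one> (antipode H a \<otimes> b)"
      if a: "a \<in> carrier H" and b: "b \<in> carrier H" for a b
    proof -
      have \<tau>': "?\<tau> a c d = sweedler HH (coprod H d) (?\<tau>' a c)" if "c \<in> carrier H" "d \<in> carrier H" for c d
      proof -
        have "?\<tau> a c d = pure H H (antipode H c) (antipode H a) \<bullet> sweedler HH (coprod H d) (pure H H)"
          using that by (simp add: sweedler_pures)
        also have "\<dots> = sweedler HH (coprod H d) (\<lambda>e f. pure H H (antipode H c) (antipode H a) \<bullet> pure H H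
            e f)"
          using that a by (intro additive_sweedler[of H H] HH.mult_additive_right) auto
        also have "\<dots> = sweedler HH (coprod H d) (?\<tau>' a c)"
          using that a by (intro sweedler_cong[of H H]) (auto simp: tensor_simps)
        finally show ?thesis .
      qed
      have "sweedler HH (coprod H b) (?\<tau> a) = sweedler HH (coprod H b)
          (\<lambda>c d. sweedler HH (coprod H d) (?\<tau>' a c))"
        using b by (intro sweedler_cong[of H H]) (auto simp: \<tau>')
      also have "\<dots> = sweedler HH (coprod H b) (\<lambda>x f. sweedler HH (coprod H x) (\<lambda>c e. ?\<tau>' a c e f))"
        by (rule coassoc_sweedler[symmetric]) (use a b bal' in auto)
      also have "\<dots> = sweedler HH (coprod H b) (\<lambda>x f. pure H H \<one> (antipode H a \<otimes> (counit H x \<odot> f)))"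
      proof (rule sweedler_cong[of H H])
        fix x f assume xf: "x \<in> carrier H" "f \<in> carrier H"
        have "sweedler HH (coprod H x) (\<lambda>c e. ?\<tau>' a c e f)
          = pure H H (sweedler H (coprod H x) (\<lambda>c e. antipode H c \<otimes> e)) (antipode H a \<otimes> f)"
          using xf a by (intro additive_sweedler[symmetric, of H H H HH "\<lambda>x. pure H H x
              (antipode H a \<otimes> f)"])
            (auto intro!: additive_mapI simp: pure_add_left)
        with xf a show "sweedler HH (coprod H x) (\<lambda>c e. ?\<tau>' a c e f)
            = pure H H \<one> (antipode H a \<otimes> (counit H x \<odot> f))"
          by (simp add: antipode_left smult_mult_right pure_smult_right)
      qed (use b in auto)
      also have "\<dots> = pure H H \<one> (antipode H a \<otimes> sweedler H (coprod H b) (\<lambda>x f. counit H x \<odot> f))"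
        using a b by (intro additive_sweedler[symmetric, of H H H HH "\<lambda>x. pure H H \<one> (antipode H a \<otimes> x)"])
          (auto intro!: additive_mapI simp: r_distr pure_add_right)
      finally show ?thesis using b by (simp add: counit_left)
    qed
    have "sweedler HH (coprod H h) (\<lambda>x y. ?\<psi> x \<bullet> coprod H y)
      = sweedler HH (coprod H h) (\<lambda>x y. sweedler HH (coprod H x) (\<lambda>c d. ?\<tau> c d y))"
      using h by (intro sweedler_cong[of H H] additive_sweedler[of H H] HH.mult_additive_left) auto
    also have "\<dots> = sweedler HH (coprod H h) (\<lambda>x y. sweedler HH (coprod H y) (?\<tau> x))"
      using h by (intro coassoc_sweedler) (auto intro!: balancedI simp: bilinear_simps)
    also have "\<dots> = sweedler HH (coprod H h) (\<lambda>x y. pure H H \<one> (antipode H x \<otimes> y))"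
      using h by (intro sweedler_cong[of H H]) (auto simp: inner)
    also have "\<dots> = pure H H \<one> (sweedler H (coprod H h) (\<lambda>x y. antipode H x \<otimes> y))"
      using h by (intro additive_sweedler[symmetric, of H H H HH "pure H H \<one>"])
        (auto intro!: additive_mapI simp: pure_add_right)
    finally show "sweedler HH (coprod H h) (\<lambda>x y. ?\<psi> x \<bullet> coprod H y) = counit H h \<odot>\<^bsub>HH\<^esub> \<one>\<^bsub>HH\<^esub>"
      using h by (simp add: antipode_left tensor_simps pure_smult_right smult_pure)
  qed (use h in auto)
  then show ?thesis using h by (simp add: F)
qed

end

section \<open>The antilinear endomorphism \<open>dagger\<close> and the twist\<close>

context quasi_star_hopf_algebra
begin

abbreviation "S \<equiv> antipode H"

definition dagger :: "'a univ \<Rightarrow> 'a univ" where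
  "dagger h = star H (S h)"

lemma star_closed [simp]: "h \<in> carrier H \<Longrightarrow> star H h \<in> carrier H"
  using star_antilinear by (auto simp: antilinear_map_def additive_map_def)

text \<open>Evaluate (1* 1)* in two ways: the unit law and the involution give 1, order reversal
  gives 1*.\<close>

lemma star_one: "star H \<one> = \<one>"
proof -
  have "star H \<one> \<otimes> \<one> = star H (star H \<one> \<otimes> \<one>)"
    using star_mult[of "star H \<one>" \<one>] by (simp add: star_star)
  then show ?thesis by (simp add: star_star)
qed

lemma dagger_closed [simp]: "h \<in> carrier H \<Longrightarrow> dagger h \<in> carrier H"
  by (simp add: dagger_def)

lemma dagger_semilinear: "semilinear_map cnj H H dagger"
  using star_antilinear
  by (auto simp: semilinear_map_def antilinear_map_def additive_map_def dagger_def hopf_linear_simps)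

lemma dagger_add: "\<lbrakk>h \<in> carrier H; k \<in> carrier H\<rbrakk> \<Longrightarrow> dagger (h \<oplus> k) = dagger h \<oplus> dagger k"
  and dagger_smult: "h \<in> carrier H \<Longrightarrow> dagger (c \<odot> h) = cnj c \<odot> dagger h"
  using dagger_semilinear by (auto simp: semilinear_map_def additive_map_def)

lemma dagger_mult: "\<lbrakk>h \<in> carrier H; k \<in> carrier H\<rbrakk> \<Longrightarrow> dagger (h \<otimes> k) = dagger h \<otimes> dagger k"
  by (simp add: dagger_def antipode_mult star_mult)

lemma dagger_one: "dagger \<one> = \<one>"
  by (simp add: dagger_def antipode_one star_one)

lemma counit_dagger: "h \<in> carrier H \<Longrightarrow> counit H (dagger h) = cnj (counit H h)"
  by (simp add: dagger_def counit_star[symmetric] counit_antipode)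

lemma gam_closed [simp]: "\<gamma> \<in> carrier H" "inv \<gamma> \<in> carrier H"
  using gam_unit by (simp_all add: Units_closed)

lemma dagger_gam: "dagger \<gamma> = \<gamma>"
  by (simp add: dagger_def gam_star)

text \<open>The axiom for the inverse antipode, applied to \<open>dagger h\<close>: the star of
  \<open>dagger h\<close> is S h, so the left-hand side of the axiom collapses to h.\<close>

lemma gam_mult:
  assumes h: "h \<in> carrier H"
  shows "dagger (dagger h) \<otimes> \<gamma> = \<gamma> \<otimes> h"
proof -
  have "inv_into (carrier H) S (star H (dagger h)) = inv \<gamma> \<otimes> dagger (dagger h) \<otimes> \<gamma>"
    using antipode_star[of "dagger h"] h by (simp add: dagger_def)
  moreover have "inv_into (carrier H) S (star H (dagger h)) = h"
    using h antipode_bij by (simp add: dagger_def star_star bij_betw_def)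
  ultimately have "h = inv \<gamma> \<otimes> dagger (dagger h) \<otimes> \<gamma>" by simp
  then have "\<gamma> \<otimes> h = \<gamma> \<otimes> (inv \<gamma> \<otimes> (dagger (dagger h) \<otimes> \<gamma>))"
    using h by (metis dagger_closed gam_closed m_assoc)
  also have "\<dots> = \<gamma> \<otimes> inv \<gamma> \<otimes> (dagger (dagger h) \<otimes> \<gamma>)"
    using h by (simp add: m_assoc)
  finally show ?thesis using h gam_unit by simp
qed

lemma twist_closed [simp]: "\<G> \<in> carrier HH" "inv\<^bsub>HH\<^esub> \<G> \<in> carrier HH"
  using twist_unit by (simp_all add: HH.Units_closed)

abbreviation dagger2 :: "'a univ \<Rightarrow> 'a univ" where
  "dagger2 t \<equiv> tensor_map H H dagger dagger (flip H H t)"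

lemma flip_closed [simp]: "t \<in> carrier HH \<Longrightarrow> flip H H t \<in> carrier HH"
  by (rule additive_map_closed[OF flip_additive]) simp_all

lemmas dagger_map_additive = semilinear_tensor_map_additive[OF vs vs vs vs dagger_semilinear
    dagger_semilinear]
lemmas dagger_map_pure = semilinear_tensor_map_pure[OF vs vs vs vs dagger_semilinear dagger_semilinear]

lemma dagger2_closed [simp]: "t \<in> carrier HH \<Longrightarrow> dagger2 t \<in> carrier HH"
  by (simp add: additive_map_closed[OF dagger_map_additive])

lemma dagger2_add:
  "\<lbrakk>s \<in> carrier HH; t \<in> carrier HH\<rbrakk> \<Longrightarrow> dagger2 (s \<oplus>\<^bsub>HH\<^esub> t) = dagger2 s \<oplus>\<^bsub>HH\<^esub> dagger2 t"
  by (simp add: additive_map_add[OF flip_additive] additive_map_add[OF dagger_map_additive])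

lemma dagger2_pure:
  "\<lbrakk>x \<in> carrier H; y \<in> carrier H\<rbrakk> \<Longrightarrow> dagger2 (pure H H x y) = pure H H (dagger y) (dagger x)"
  by (simp add: flip_pure dagger_map_pure)

text \<open>The coproduct rule and the strong condition are phrased with star and S separately; this
  converts both to \<open>dagger\<close>.\<close>

lemma star_antipode_map:
  assumes "t \<in> carrier HH"
  shows "tensor_map H H (star H) (star H) (tensor_map H H S S t) = tensor_map H H dagger dagger t"
proof -
  have "semilinear_map (\<lambda>c. c) H H S" "semilinear_map cnj H H (star H)"
    using antipode_linear star_antilinear by (simp_all add: linear_semilinear antilinear_semilinear)
  from semilinear_tensor_map_compose[OF vs vs vs vs vs vs this(1,1,2,2) assms]
  show ?thesis by (simp add: dagger_def[abs_def])
qed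

lemma coprod_dagger:
  assumes h: "h \<in> carrier H"
  shows "\<G> \<bullet> coprod H (dagger h) = dagger2 (coprod H h) \<bullet> \<G>"
proof -
  let ?d = "dagger2 (coprod H h)"
  have "coprod H (dagger h) = inv\<^bsub>HH\<^esub> \<G> \<bullet> ?d \<bullet> \<G>"
    using h by (simp add: dagger_def[abs_def] coprod_star antipode_coprod
        star_antipode_map[unfolded dagger_def[abs_def]])
  then have "\<G> \<bullet> coprod H (dagger h) = \<G> \<bullet> inv\<^bsub>HH\<^esub> \<G> \<bullet> (?d \<bullet> \<G>)"
    using h by (simp add: HH.m_assoc)
  then show ?thesis using h twist_unit by simp
qed

text \<open>Apply \<open>id \<otimes> \<epsilon> \<otimes> id\<close> to the cocycle condition and cancel \<open>\<G>\<close>.\<close>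

lemma twist_counit_right: "sweedler H \<G> (\<lambda>x y. counit H y \<odot> x) = \<one>"
proof -
  let ?e1 = "\<lambda>t. sweedler H t (\<lambda>x y. counit H y \<odot> x)"
  let ?e2 = "\<lambda>t. sweedler H t (\<lambda>x y. counit H x \<odot> y)"
  note p = sweedler_counit_simps
  have lin: "linear_map HH H ?e1" "linear_map HH H ?e2"
  proof -
    have "?e1 (c \<odot>\<^bsub>HH\<^esub> t) = c \<odot> ?e1 t \<and> ?e2 (c \<odot>\<^bsub>HH\<^esub> t) = c \<odot> ?e2 t" if "t \<in> carrier HH" for c t
      using vs vs that
      by (rule tensor_induct)
        (simp_all add: smult_pure p vec_smult_add vec_smult_smult mult.commute counit_smult)
    then show "linear_map HH H ?e1" "linear_map HH H ?e2" by (auto intro!: linear_mapI simp: p)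
  qed
  note add = linear_map_add[OF lin(1)] linear_map_add[OF lin(2)]
  note cl = linear_map_closed[OF lin(1)] linear_map_closed[OF lin(2)]
  have mult: "?e1 (s \<bullet> t) = ?e1 s \<otimes> ?e1 t" "?e2 (s \<bullet> t) = ?e2 s \<otimes> ?e2 t"
    if s: "s \<in> carrier HH" and t: "t \<in> carrier HH" for s t
  proof -
    note simps = tensor_simps p add cl counit_mult smult_mult_left smult_mult_right vec_smult_smult
        mult.commute l_distr r_distr
    have "?e1 (s \<bullet> t) = ?e1 s \<otimes> ?e1 t \<and> ?e2 (s \<bullet> t) = ?e2 s \<otimes> ?e2 t"
      using vs vs s
    proof (induct rule: tensor_induct)
      case s: (pure a b)
      from vs vs t show ?case by (induct rule: tensor_induct) (use s in \<open>simp_all add: simps\<close>)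
    qed (use t in \<open>simp_all add: simps\<close>)
    then show "?e1 (s \<bullet> t) = ?e1 s \<otimes> ?e1 t" "?e2 (s \<bullet> t) = ?e2 s \<otimes> ?e2 t" by auto
  qed
  have vs2: "vec_space HH" by simp
  \<comment> \<open>Two forms of the contraction of the middle factor: (id \<otimes> \<epsilon>)
    \<otimes> id on the left bracketing and id \<otimes> (\<epsilon> \<otimes> id) on the right one.
    Fact \<open>r\<close> says that they agree through \<open>reassoc\<close>.\<close>
  let ?E1 = "tensor_map H H ?e1 (\<lambda>x. x)" and ?E2 = "tensor_map H H (\<lambda>x. x) ?e2"
  let ?R = "pure H HH \<one> \<G> \<otimes>\<^bsub>tensor H HH\<^esub> tensor_map H HH (\<lambda>x. x) (coprod H) \<G>"
  let ?L = "pure HH H \<G> \<one> \<otimes>\<^bsub>tensor HH H\<^esub> tensor_map HH H (coprod H) (\<lambda>x. x) \<G>"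
  have dL: "tensor_map HH H (coprod H) (\<lambda>x. x) \<G> \<in> carrier (tensor HH H)"
    and dR: "tensor_map H HH (\<lambda>x. x) (coprod H) \<G> \<in> carrier (tensor H HH)"
    by (auto intro!: linear_map_closed[OF tensor_map_linear[of H H]] simp: coprod_linear linear_map_id)
  have L: "?L \<in> carrier (tensor HH H)"
    using dL by (simp add: tensor_mult_closed[OF HH.complex_algebra_axioms alg])
  have r: "?E2 (reassoc H H H t) = ?E1 t" if t: "t \<in> carrier (tensor HH H)" for t
  proof -
    have add: "additive_map (tensor HH H) HH (\<lambda>t. ?E2 (reassoc H H H t))"
      by (rule additive_map_compose[OF reassoc_additive tensor_map_additive]) (auto simp: lin linear_map_id)
    have add': "additive_map (tensor HH H) HH ?E1"
      by (rule tensor_map_additive) (auto simp: lin linear_map_id)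
    have "?E2 (reassoc H H H (pure HH H s w)) = ?E1 (pure HH H s w)" if s: "s \<in> carrier HH"
        and w: "w \<in> carrier H" for s w
      using vs vs s
      by (induct rule: tensor_induct)
        (use w in \<open>simp_all add: reassoc_pure tensor_map_pure[of H HH H H] tensor_map_pure[of HH H H H]
            lin linear_map_id p
          pure_smult_right smult_pure pure_add_left additive_map_add[OF add] additive_map_add[OF add']\<close>)
    then show ?thesis by (rule additive_map_tensor_eqI[OF t vs2 vs add add'])
  qed
  have e2: "?E2 ?R = \<G>"
  proof -
    have "?E2 ?R = ?E2 (pure H HH \<one> \<G>) \<bullet> ?E2 (tensor_map H HH (\<lambda>x. x) (coprod H) \<G>)"
      by (rule tensor_map_mult[OF alg HH.complex_algebra_axioms alg alg]) (auto
          simp: lin linear_map_id dR mult)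
    also have "?E2 (pure H HH \<one> \<G>) = \<one>\<^bsub>HH\<^esub>"
      by (subst tensor_map_pure) (auto simp: lin linear_map_id twist_counit tensor_simps)
    also have "?E2 (tensor_map H HH (\<lambda>x. x) (coprod H) \<G>) = tensor_map H H (\<lambda>x. x) (\<lambda>x. ?e2 (coprod H x)) \<G>"
      by (rule tensor_map_compose[of H H]) (auto simp: lin linear_map_id coprod_linear)
    also have "\<dots> = tensor_map H H (\<lambda>x. x) (\<lambda>x. x) \<G>"
      by (rule tensor_map_cong[of H H]) (auto simp: counit_left)
    finally show ?thesis by (simp add: tensor_map_id)
  qed
  have e1: "?E1 ?L = pure H H (?e1 \<G>) \<one> \<bullet> \<G>"
  proof -
    have "?E1 ?L = ?E1 (pure HH H \<G> \<one>) \<bullet> ?E1 (tensor_map HH H (coprod H) (\<lambda>x. x) \<G>)"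
      by (rule tensor_map_mult[OF HH.complex_algebra_axioms alg alg alg]) (auto
          simp: lin linear_map_id dL mult)
    also have "?E1 (pure HH H \<G> \<one>) = pure H H (?e1 \<G>) \<one>"
      by (subst tensor_map_pure) (auto simp: lin linear_map_id)
    also have "?E1 (tensor_map HH H (coprod H) (\<lambda>x. x) \<G>) = tensor_map H H (\<lambda>x. ?e1 (coprod H x)) (\<lambda>x. x) \<G>"
      by (rule tensor_map_compose[of H H]) (auto simp: lin linear_map_id coprod_linear)
    also have "\<dots> = tensor_map H H (\<lambda>x. x) (\<lambda>x. x) \<G>"
      by (rule tensor_map_cong[of H H]) (auto simp: counit_right)
    finally show ?thesis by (simp add: tensor_map_id)
  qed
  \<comment> \<open>On the right, the given normalisation removes the first factor and the counit
    axiom turns the second into \<G>; on the left the contraction still to be determined survives as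
    a factor.\<close>
  have "pure H H (?e1 \<G>) \<one> \<bullet> \<G> = \<G>"
    using e1 e2 r[OF L] twist_cocycle by simp
  then have "pure H H (?e1 \<G>) \<one> \<bullet> \<G> \<bullet> inv\<^bsub>HH\<^esub> \<G> = \<G> \<bullet> inv\<^bsub>HH\<^esub> \<G>" by simp
  then have "pure H H (?e1 \<G>) \<one> = \<one>\<^bsub>HH\<^esub>"
    using twist_unit by (simp add: HH.m_assoc cl)
  \<comment> \<open>A second contraction strips the unit from the other tensor leg.\<close>
  then have "?e1 (pure H H (?e1 \<G>) \<one>) = ?e1 \<one>\<^bsub>HH\<^esub>" by simp
  then show ?thesis by (simp add: p cl tensor_simps counit_one)
qed

end

section \<open>The monoidal category of modules\<close>

lemma tensor3_induct [consumes 4, case_names pure add]: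
  assumes vs: "vec_space U" "vec_space V" "vec_space W" and t: "t \<in> carrier (tensor (tensor U V) W)"
    and pure: "\<And>u v w. \<lbrakk>u \<in> carrier U; v \<in> carrier V; w \<in> carrier W\<rbrakk>
        \<Longrightarrow> P (pure (tensor U V) W (pure U V u v) w)"
    and add: "\<And>s t. \<lbrakk>s \<in> carrier (tensor (tensor U V) W); t \<in> carrier (tensor (tensor U V) W); P s; P t\<rbrakk>
      \<Longrightarrow> P (s \<oplus>\<^bsub>tensor (tensor U V) W\<^esub> t)"
  shows "P t"
proof -
  have UV: "vec_space (tensor U V)" using vs by simp
  from UV vs(3) t show ?thesis
  proof (induct rule: tensor_induct)
    case (pure s w)
    from vs(1,2) pure(1) show ?case
      by (induct rule: tensor_induct) (use pure(2) vs assms(5,6) in \<open>simp_all add: pure_add_left\<close>)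
  qed (use add in auto)
qed

lemma tensor3_induct_right [consumes 4, case_names pure add]:
  assumes vs: "vec_space U" "vec_space V" "vec_space W" and t: "t \<in> carrier (tensor U (tensor V W))"
    and pure: "\<And>u v w. \<lbrakk>u \<in> carrier U; v \<in> carrier V; w \<in> carrier W\<rbrakk>
        \<Longrightarrow> P (pure U (tensor V W) u (pure V W v w))"
    and add: "\<And>s t. \<lbrakk>s \<in> carrier (tensor U (tensor V W)); t \<in> carrier (tensor U (tensor V W)); P s; P t\<rbrakk>
      \<Longrightarrow> P (s \<oplus>\<^bsub>tensor U (tensor V W)\<^esub> t)"
  shows "P t"
proof -
  have VW: "vec_space (tensor V W)" using vs by simp
  from vs(1) VW t show ?thesis
  proof (induct rule: tensor_induct)
    case (pure u s)
    from vs(2,3) pure(2) show ?case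
      by (induct rule: tensor_induct) (use pure(1) vs assms(5,6) in \<open>simp_all add: pure_add_right\<close>)
  qed (use add in auto)
qed

text \<open>The constructions read only the \<open>module\<close> fields, so adding an action
  changes nothing. Because these are equalities and not isomorphisms, they can serve as rewrite
  rules that remove \<open>outer\<close> and \<open>tensor_lmod\<close> from inside iterated tensor
  products.\<close>

lemma tensor_truncate:
  fixes X :: "('a, 'b) univ_space" and W :: "('a, 'c) univ_space"
  assumes X: "module.truncate X = Y"
  shows "tensor X W = tensor Y W" "tensor W X = tensor W Y" "pure X W = pure Y W" "pure W X = pure W Y"
    "tensor_map X W = tensor_map Y W" "tensor_map W X = tensor_map W Y"
    "flip X W = flip Y W" "flip W X = flip W Y"
proof -
  note [simp] = X[symmetric]
  have t: "twin (\<lambda>c. c) Y X" by (simp add: twin_def module.truncate_def)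
  note twins = tensor_of_twin[OF t twin_refl] tensor_of_twin[OF twin_refl t]
    pure_twin[OF t twin_refl] pure_twin[OF twin_refl t]
  show 1: "tensor X W = tensor Y W" "tensor W X = tensor W Y"
    by (simp_all add: tensor_def twins del: X[symmetric]) (simp_all add: module.truncate_def)
  show 2: "pure X W = pure Y W" "pure W X = pure W Y" by (simp_all only: twins)
  show "tensor_map X W = tensor_map Y W" "tensor_map W X = tensor_map W Y"
    by (simp_all only: fun_eq_iff tensor_map_def 1 2 simp_thms)
  show "flip X W = flip Y W" "flip W X = flip W Y"
    by (simp_all only: fun_eq_iff flip_def 1 2 simp_thms)
qed

lemma truncate_outer: "module.truncate (outer V W) = tensor V W"
  and truncate_tensor_lmod: "module.truncate (tensor_lmod H V W) = tensor V W"
  by (simp_all add: outer_def tensor_lmod_def module.defs tensor_def)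

lemmas tensor_outer [simp] = tensor_truncate[OF truncate_outer]
lemmas tensor_tensor_lmod [simp] = tensor_truncate[OF truncate_tensor_lmod]

lemma tensor_lmod_sel [simp]:
  "carrier (tensor_lmod H V W) = carrier (tensor V W)"
  "\<zero>\<^bsub>tensor_lmod H V W\<^esub> = \<zero>\<^bsub>tensor V W\<^esub>"
  "add (tensor_lmod H V W) = add (tensor V W)"
  "smult (tensor_lmod H V W) = smult (tensor V W)"
  "act (tensor_lmod H V W) h = outer_act V W (coprod H h)"
  by (simp_all add: tensor_lmod_def module.defs lmod.defs outer_act_def[abs_def])

lemma unit_lmod_sel [simp]:
  "carrier (unit_lmod H) = range Scalar"
  "\<zero>\<^bsub>unit_lmod H\<^esub> = Scalar 0"
  "x \<oplus>\<^bsub>unit_lmod H\<^esub> y = Scalar (scalar x + scalar y)"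
  "c \<odot>\<^bsub>unit_lmod H\<^esub> x = Scalar (c * scalar x)"
  "act (unit_lmod H) h x = Scalar (counit H h * scalar x)"
  by (simp_all add: unit_lmod_def)

lemma monoidal_lmod_sel [simp]:
  "Obj (monoidal_lmod H) = {V. left_module H V}"
  "Hom (monoidal_lmod H) = module_hom H"
  "unit_obj (monoidal_lmod H) = unit_lmod H"
  "tensor_obj (monoidal_lmod H) = tensor_lmod H"
  by (simp_all add: monoidal_lmod_def)

section \<open>The category of modules\<close>

lemma module_homD:
  assumes "f \<in> module_hom H V W"
  shows "src f = V" "trg f = W" "fn f \<in> extensional (carrier V)" "linear_map V W (fn f)" "additive_map V
      W (fn f)"
    and "\<And>v. v \<in> carrier V \<Longrightarrow> fn f v \<in> carrier W"
    and "\<And>h v. \<lbrakk>h \<in> carrier H; v \<in> carrier V\<rbrakk> \<Longrightarrow> fn f (h \<triangleright>\<^bsub>V\<^esub> v) = h \<triangleright>\<^bsub>W\<^esub> fn f v"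
  using assms by (auto simp: module_hom_def linear_map_def additive_map_def)

text \<open>Arrows carry extensional functions, so agreement on the carrier is equality of
  arrows.\<close>

lemma module_hom_eqI:
  assumes f: "f \<in> module_hom H V W" and g: "g \<in> module_hom H V W"
    and "\<And>v. v \<in> carrier V \<Longrightarrow> fn f v = fn g v"
  shows "f = g"
  using module_homD(1-3)[OF f] module_homD(1-3)[OF g] extensionalityI[of "fn f" "carrier V" "fn g"] assms(3)
  by (cases f; cases g) auto

context hopf_algebra
begin

abbreviation "C \<equiv> monoidal_lmod H"

abbreviation C_comp (infixr \<open>\<circ>\<^sub>C\<close> 55) where
  "g \<circ>\<^sub>C f \<equiv> g \<cdot>\<^bsub>C\<^esub> f"

text \<open>Scalars act through \<open>H\<close>, so an additive equivariant map is linear.\<close>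

lemma module_homI:
  assumes V: "left_module H V" and W: "left_module H W"
    and add: "additive_map V W f"
    and eqv: "\<And>h v. \<lbrakk>h \<in> carrier H; v \<in> carrier V\<rbrakk> \<Longrightarrow> f (h \<triangleright>\<^bsub>V\<^esub> v) = h \<triangleright>\<^bsub>W\<^esub> f v"
  shows "Arrow V W (\<lambda>v \<in> carrier V. f v) \<in> module_hom H V W"
proof -
  interpret V: left_module H V by (rule V)
  interpret W: left_module H W by (rule W)
  have "f (c \<odot>\<^bsub>V\<^esub> v) = c \<odot>\<^bsub>W\<^esub> f v" if "v \<in> carrier V" for c v
    using eqv[of "c \<odot> \<one>" v] that additive_map_closed[OF add that]
    by (simp add: V.act_simps W.act_simps)
  then show ?thesis
    using add eqv by (auto simp: module_hom_def linear_map_def additive_map_def V.act_simps)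
qed

text \<open>An inverse function suffices: its additivity and equivariance follow by cancelling
  f.\<close>

lemma isoI:
  fixes V W :: "('a univ, 'a univ) lmod"
  assumes V: "left_module H V" and W: "left_module H W" and f: "f \<in> module_hom H V W"
    and g: "\<And>w. w \<in> carrier W \<Longrightarrow> g w \<in> carrier V" "\<And>w. w \<in> carrier W \<Longrightarrow> fn f (g w) = w"
      "\<And>v. v \<in> carrier V \<Longrightarrow> g (fn f v) = v"
  shows "f \<in> Iso C V W"
proof -
  interpret V: left_module H V by (rule V)
  interpret W: left_module H W by (rule W)
  note f' = module_homD[OF f]
  let ?g = "Arrow W V (\<lambda>w \<in> carrier W. g w)"
  have "?g \<in> module_hom H W V"
  proof (rule module_homI[OF W V])
    show "additive_map W V g"
    proof (rule additive_mapI)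
      fix x y assume "x \<in> carrier W" "y \<in> carrier W"
      then show "g (x \<oplus>\<^bsub>W\<^esub> y) = g x \<oplus>\<^bsub>V\<^esub> g y"
        using additive_map_add[OF f'(5), of "g x" "g y"] g(3)[of "g x \<oplus>\<^bsub>V\<^esub> g y"] g V.vec_space by simp
    qed (rule g)
    fix h w assume "h \<in> carrier H" "w \<in> carrier W"
    then show "g (h \<triangleright>\<^bsub>W\<^esub> w) = h \<triangleright>\<^bsub>V\<^esub> g w"
      using f'(7)[of h "g w"] g(3)[of "h \<triangleright>\<^bsub>V\<^esub> g w"] g by (simp add: V.act_simps)
  qed
  moreover have "?g \<circ>\<^sub>C f = ident C V" "f \<circ>\<^sub>C ?g = ident C W"
    using f' g by (auto simp: monoidal_lmod_def fun_eq_iff compose_def)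
  ultimately show ?thesis using f by (auto simp: Iso_def)
qed

lemma ident_hom [simp]: "left_module H V \<Longrightarrow> ident C V \<in> module_hom H V V"
  by (simp add: monoidal_lmod_def module_homI additive_mapI)

lemma fn_ident [simp]: "v \<in> carrier V \<Longrightarrow> fn (ident C V) v = v"
  by (simp add: monoidal_lmod_def)

lemma fn_comp: "\<lbrakk>f \<in> module_hom H U V; u \<in> carrier U\<rbrakk> \<Longrightarrow> fn (g \<circ>\<^sub>C f) u = fn g (fn f u)"
  using module_homD[of f H U V] by (simp add: monoidal_lmod_def compose_def)

lemma comp_hom:
  fixes U V W :: "('a univ, 'a univ) lmod"
  assumes "left_module H U" "left_module H V" "left_module H W"
    and f: "f \<in> module_hom H U V" and g: "g \<in> module_hom H V W"
  shows "g \<circ>\<^sub>C f \<in> module_hom H U W"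
proof -
  note f' = module_homD[OF f] and g' = module_homD[OF g]
  have "Arrow U W (\<lambda>u \<in> carrier U. fn g (fn f u)) \<in> module_hom H U W"
    by (rule module_homI) (use assms f' g' in \<open>auto intro: additive_map_compose\<close>)
  moreover have "g \<circ>\<^sub>C f = Arrow U W (\<lambda>u \<in> carrier U. fn g (fn f u))"
    using f' g' by (simp add: monoidal_lmod_def compose_def)
  ultimately show ?thesis by simp
qed

lemma category_lmod: "category C"
proof
  show "(h \<circ>\<^sub>C g) \<circ>\<^sub>C f = h \<circ>\<^sub>C (g \<circ>\<^sub>C f)"
    if "W \<in> Obj C" "X \<in> Obj C" "Y \<in> Obj C" "Z \<in> Obj C" "f \<in> Hom C W X" "g \<in> Hom C X Y" "h \<in> Hom C Y Z"
    for W X Y Z f g h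
    using that module_homD[of f H W X] module_homD[of g H X Y] module_homD[of h H Y Z]
    by (auto simp: monoidal_lmod_def compose_def fun_eq_iff)
  fix X Y f assume "X \<in> Obj C" "Y \<in> Obj C" "f \<in> Hom C X Y"
  then have *: "left_module H X" "left_module H Y" "f \<in> module_hom H X Y" by auto
  show "f \<circ>\<^sub>C ident C X = f"
    by (rule module_hom_eqI[of _ H X Y]) (use * comp_hom[of X X Y] in \<open>auto simp: fn_comp[of _ X X]\<close>)
  show "ident C Y \<circ>\<^sub>C f = f"
    by (rule module_hom_eqI[of _ H X Y])
      (use * comp_hom[of X Y Y] module_homD[of f H X Y] in \<open>auto simp: fn_comp[of _ X Y]\<close>)
qed (auto simp: comp_hom dest: module_homD)

section \<open>Tensor products of modules and of morphisms\<close>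

context
  fixes V W :: "('a univ, 'a univ) lmod"
  assumes V: "left_module H V" and W: "left_module H W"
begin

interpretation V: left_module H V by (rule V)
interpretation W: left_module H W by (rule W)
interpretation P: module_pair H H V W
  by (intro module_pair.intro alg V W)

lemma tensor_lmod_module: "left_module H (tensor_lmod H V W)"
proof (rule left_module.intro)
  show "vec_space (tensor_lmod H V W)" by (rule vec_space_cong[of "tensor V W"]) simp_all
  show "linear_map (tensor_lmod H V W) (tensor_lmod H V W) ((\<triangleright>\<^bsub>tensor_lmod H V W\<^esub>) h)" if "h \<in> carrier H"
      for h
    using P.outer_act_linear[of "coprod H h"] that by (simp add: linear_map_def additive_map_def)
qed (simp_all add: hopf_linear_simps coprod_mult coprod_one P.outer_act_simps P.outer_act_mult
    P.outer_act_one)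

end

lemma unit_lmod_module: "left_module H (unit_lmod H)"
proof (rule left_module.intro)
  have "abelian_group (unit_lmod H)"
    by (rule abelian_groupI) (auto simp: intro: exI[of _ "- _"])
  then show "vec_space (unit_lmod H)"
    by (rule vec_spaceI) (auto simp: algebra_simps)
qed (auto intro!: linear_mapI simp: algebra_simps counit_add counit_smult counit_mult counit_one)

text \<open>Each leg of \<open>a\<close> acts on one factor and commutes with the morphism there.
  With \<open>a\<close> a coproduct this makes tensor products of morphisms equivariant; with
  \<open>a\<close> the twist it gives naturality of Upsilon.\<close>

lemma tensor_map_equivariant:
  assumes V: "left_module H V" "left_module H W" "left_module H V'" "left_module H W'"
    and f: "linear_map V V' f" "\<And>h v. \<lbrakk>h \<in> carrier H; v \<in> carrier V\<rbrakk> \<Longrightarrow> f (h \<triangleright>\<^bsub>V\<^esub> v) = h \<triangleright>\<^bsub>V'\<^esub> f v"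
    and g: "linear_map W W' g" "\<And>h w. \<lbrakk>h \<in> carrier H; w \<in> carrier W\<rbrakk> \<Longrightarrow> g (h \<triangleright>\<^bsub>W\<^esub> w) = h \<triangleright>\<^bsub>W'\<^esub> g w"
    and a: "a \<in> carrier HH" and t: "t \<in> carrier (tensor V W)"
  shows "tensor_map V' W' f g (outer_act V W a t) = outer_act V' W' a (tensor_map V' W' f g t)"
proof -
  interpret P: module_pair H H V W by (intro module_pair.intro alg V)
  interpret P': module_pair H H V' W' by (intro module_pair.intro alg V)
  note vss = P.vs(3,4) P'.vs(3,4)
  note m = tensor_map_pure[OF vss f(1) g(1)] additive_map_closed[OF tensor_map_additive[OF vss f(1) g(1)]]
    additive_map_add[OF tensor_map_additive[OF vss f(1) g(1)]] linear_map_closed[OF f(1)]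
        linear_map_closed[OF g(1)]
    P.V.act_closed P.W.act_closed
  from vs vs a show ?thesis
  proof (induct rule: tensor_induct)
    case (pure x y)
    from P.vs(3,4) t show ?case
      by (induct rule: tensor_induct) (use pure in \<open>simp_all add: m P.outer_act_simps P'.outer_act_simps
          f g\<close>)
  qed (use t in \<open>simp_all add: m P.outer_act_simps P'.outer_act_simps\<close>)
qed

lemma tensor_arr_eq:
  assumes "f \<in> module_hom H V V'" "g \<in> module_hom H W W'"
  shows "tensor_arr C f g = Arrow (tensor_lmod H V W) (tensor_lmod H V' W')
    (\<lambda>t \<in> carrier (tensor_lmod H V W). tensor_map V' W' (fn f) (fn g) t)"
  using module_homD[OF assms(1)] module_homD[OF assms(2)] by (simp add: monoidal_lmod_def)

lemma tensor_arr_hom: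
  assumes V: "left_module H V" "left_module H W" "left_module H V'" "left_module H W'"
    and f: "f \<in> module_hom H V V'" and g: "g \<in> module_hom H W W'"
  shows "tensor_arr C f g \<in> module_hom H (tensor_lmod H V W) (tensor_lmod H V' W')"
  unfolding tensor_arr_eq[OF f g]
proof (rule module_homI)
  show "additive_map (tensor_lmod H V W) (tensor_lmod H V' W') (tensor_map V' W' (fn f) (fn g))"
    using tensor_map_additive[of V W V' W' "fn f" "fn g"] module_homD[OF f] module_homD[OF g] V
    by (simp add: left_module.vec_space[of H] additive_map_def)
qed (use V module_homD[OF f] module_homD[OF g] in \<open>simp_all add: tensor_lmod_module tensor_map_equivariant\<close>)

lemma fn_tensor_arr:
  assumes V: "left_module H V" "left_module H W" "left_module H V'" "left_module H W'"
    and f: "f \<in> module_hom H V V'" and g: "g \<in> module_hom H W W'"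
    and "v \<in> carrier V" "w \<in> carrier W"
  shows "fn (tensor_arr C f g) (pure V W v w) = pure V' W' (fn f v) (fn g w)"
  unfolding tensor_arr_eq[OF f g]
  using assms module_homD[OF f] module_homD[OF g]
  by (simp add: left_module.vec_space[of H] tensor_map_pure[of V W])

abbreviation "coprod_left \<equiv> tensor_map HH H (coprod H) (\<lambda>x. x)"
abbreviation "coprod_right \<equiv> tensor_map H HH (\<lambda>x. x) (coprod H)"

lemma coprod_left_simps:
  "\<lbrakk>x \<in> carrier H; y \<in> carrier H\<rbrakk> \<Longrightarrow> coprod_left (pure H H x y) = pure HH H (coprod H x) y"
  "a \<in> carrier HH \<Longrightarrow> coprod_left a \<in> carrier (tensor HH H)"
  "\<lbrakk>a \<in> carrier HH; b \<in> carrier HH\<rbrakk> \<Longrightarrow> coprod_left (a \<oplus>\<^bsub>HH\<^esub> b) = coprod_left a \<oplus>\<^bsub>tensor HH H\<^esub> coprod_left b"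
  using tensor_map_pure[of H H HH H "coprod H" "\<lambda>x. x"] tensor_map_additive[of H H HH H "coprod H" "\<lambda>x. x"]
  by (simp_all add: coprod_linear linear_map_id additive_map_def Pi_iff)

lemma coprod_right_simps:
  "\<lbrakk>x \<in> carrier H; y \<in> carrier H\<rbrakk> \<Longrightarrow> coprod_right (pure H H x y) = pure H HH x (coprod H y)"
  "a \<in> carrier HH \<Longrightarrow> coprod_right a \<in> carrier (tensor H HH)"
  "\<lbrakk>a \<in> carrier HH; b \<in> carrier HH\<rbrakk> \<Longrightarrow> coprod_right (a \<oplus>\<^bsub>HH\<^esub> b) = coprod_right a \<oplus>\<^bsub>tensor H HH\<^esub> coprod_right b"
  using tensor_map_pure[of H H H HH "\<lambda>x. x" "coprod H"] tensor_map_additive[of H H H HH "\<lambda>x. x" "coprod H"]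
  by (simp_all add: coprod_linear linear_map_id additive_map_def Pi_iff)

section \<open>The associator\<close>

context
  fixes U V W :: "('a univ, 'a univ) lmod"
  assumes U: "left_module H U" and V: "left_module H V" and W: "left_module H W"
begin

interpretation UV: module_pair H H U V by (intro module_pair.intro alg U V)
interpretation VW: module_pair H H V W by (intro module_pair.intro alg V W)
interpretation UV_W: module_pair HH H "outer U V" W
  by (intro module_pair.intro alg UV.outer_module HH.complex_algebra_axioms W)
interpretation U_VW: module_pair H HH U "outer V W"
  by (intro module_pair.intro alg VW.outer_module HH.complex_algebra_axioms U)
interpretation UVt_W: module_pair H H "tensor_lmod H U V" W
  by (intro module_pair.intro alg W tensor_lmod_module U V)
interpretation U_VWt: module_pair H H U "tensor_lmod H V W"
  by (intro module_pair.intro alg U tensor_lmod_module V W)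

text \<open>Unfolds an action on an iterated tensor module to an action of the triple tensor product
  of H, where coassociativity and the cocycle identity are statements about the acting
  elements.\<close>

lemma act_coprod_left:
  assumes a: "a \<in> carrier HH" and t: "t \<in> carrier (tensor (tensor U V) W)"
  shows "outer_act (tensor_lmod H U V) W a t = outer_act (outer U V) W (coprod_left a) t"
  using vs vs a
proof (induct rule: tensor_induct)
  case (pure x y)
  from UV.vs(3,4) VW.vs(4) t show ?case
    by (induct rule: tensor3_induct)
      (use pure UVt_W.outer_act_simps UV_W.outer_act_simps in \<open>simp_all add: coprod_left_simps\<close>)
qed (use t UVt_W.outer_act_simps UV_W.outer_act_simps in \<open>simp_all add: coprod_left_simps\<close>)

lemma act_coprod_right:
  assumes a: "a \<in> carrier HH" and t: "t \<in> carrier (tensor U (tensor V W))"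
  shows "outer_act U (tensor_lmod H V W) a t = outer_act U (outer V W) (coprod_right a) t"
  using vs vs a
proof (induct rule: tensor_induct)
  case (pure x y)
  from UV.vs(3) VW.vs(3,4) t show ?case
    by (induct rule: tensor3_induct_right)
      (use pure U_VWt.outer_act_simps U_VW.outer_act_simps in \<open>simp_all add: coprod_right_simps\<close>)
qed (use t U_VWt.outer_act_simps U_VW.outer_act_simps in \<open>simp_all add: coprod_right_simps\<close>)

text \<open>Rebracketing intertwines the two bracketings of H \<otimes> H \<otimes> H. With
  coassociativity this is equivariance of the associator, and it later carries the cocycle identity
  over to modules.\<close>

lemma reassoc_act:
  assumes b: "b \<in> carrier (tensor HH H)" and t: "t \<in> carrier (tensor (tensor U V) W)"
  shows "reassoc U V W (outer_act (outer U V) W b t)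
    = outer_act U (outer V W) (reassoc H H H b) (reassoc U V W t)"
proof -
  note vss = UV.vs(3,4) VW.vs(4)
  note r = additive_map_closed[OF reassoc_additive[OF vss]] additive_map_add[OF reassoc_additive[OF vss]]
    reassoc_pure[OF vss] additive_map_closed[OF reassoc_additive[OF vs vs vs]]
    additive_map_add[OF reassoc_additive[OF vs vs vs]] reassoc_pure[OF vs vs vs]
  note simps = r UV_W.outer_act_simps[simplified] U_VW.outer_act_simps[simplified] UV.outer_act_simps
      VW.outer_act_simps
    UV.V.act_closed UV.W.act_closed VW.W.act_closed
  from vs vs vs b show ?thesis
  proof (induct rule: tensor3_induct)
    case (pure x y z)
    from vss t show ?case
      by (induct rule: tensor3_induct) (use pure in \<open>simp_all add: simps\<close>)
  qed (use t in \<open>simp_all add: simps\<close>)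
qed

lemma assoc_eq: "assoc C U V W =
  Arrow (tensor_lmod H (tensor_lmod H U V) W) (tensor_lmod H U (tensor_lmod H V W))
    (\<lambda>t \<in> carrier (tensor_lmod H (tensor_lmod H U V) W). reassoc U V W t)"
  by (simp add: monoidal_lmod_def reassoc_def fun_eq_iff)

lemma assoc_hom: "assoc C U V W \<in> module_hom H (tensor_lmod H (tensor_lmod H U V) W)
    (tensor_lmod H U (tensor_lmod H V W))"
  unfolding assoc_eq
proof (rule module_homI)
  show "additive_map (tensor_lmod H (tensor_lmod H U V) W) (tensor_lmod H U (tensor_lmod H V W))
      (reassoc U V W)"
    using reassoc_additive[OF UV.vs(3,4) VW.vs(4)] by (simp add: additive_map_def)
next
  fix h t assume h: "h \<in> carrier H" and "t \<in> carrier (tensor_lmod H (tensor_lmod H U V) W)"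
  then have t: "t \<in> carrier (tensor (tensor U V) W)" by simp
  with h show "reassoc U V W (h \<triangleright>\<^bsub>tensor_lmod H (tensor_lmod H U V) W\<^esub> t)
    = h \<triangleright>\<^bsub>tensor_lmod H U (tensor_lmod H V W)\<^esub> reassoc U V W t"
    using additive_map_closed[OF reassoc_additive[OF UV.vs(3,4) VW.vs(4)], of t]
    by (simp add: act_coprod_left act_coprod_right reassoc_act coprod_left_simps coassoc)
qed (simp_all add: tensor_lmod_module U V W)

lemma fn_assoc:
  "\<lbrakk>u \<in> carrier U; v \<in> carrier V; w \<in> carrier W\<rbrakk> \<Longrightarrow>
    fn (assoc C U V W) (pure (tensor U V) W (pure U V u v) w) = pure U (tensor V W) u (pure V W v w)"
  by (simp add: assoc_eq reassoc_pure)

lemma assoc_iso: "assoc C U V W \<in> Iso C (tensor_lmod H (tensor_lmod H U V) W)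
    (tensor_lmod H U (tensor_lmod H V W))"
proof (rule isoI[OF _ _ assoc_hom])
  let ?T = "tensor (tensor U V) W" and ?T' = "tensor U (tensor V W)"
  \<comment> \<open>The inverse rebracketing as a nested Sweedler sum; \<open>isoI\<close> asks for
    no equivariance of it.\<close>
  let ?g = "\<lambda>t. sweedler ?T t (\<lambda>u s. sweedler ?T s (\<lambda>v w. pure (tensor U V) W (pure U V u v) w))"
  have vss: "vec_space U" "vec_space V" "vec_space W" "vec_space ?T" by simp_all
  have bal: "w \<in> carrier W \<Longrightarrow> balanced U V ?T (\<lambda>u v. pure (tensor U V) W (pure U V u v) w)"
    "u \<in> carrier U \<Longrightarrow> balanced V W ?T (\<lambda>v w. pure (tensor U V) W (pure U V u v) w)" for u w
    by (auto intro!: balancedI simp: pure_add_left pure_add_right pure_smult_right smult_pure[symmetric])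
  note bal' = balanced_sweedler_right[OF vss bal]
  have add: "additive_map ?T' ?T ?g"
    by (rule additive_sweedler_map) (simp_all add: bal')
  have g: "?g (pure U (tensor V W) u (pure V W v w)) = pure (tensor U V) W (pure U V u v) w"
    if "u \<in> carrier U" "v \<in> carrier V" "w \<in> carrier W" for u v w
    using that by (simp add: sweedler_pure[OF _ _ _ bal'] sweedler_pure[OF _ _ _ bal(2)])
  note f = reassoc_additive[OF vss(1-3)]
  show "?g t \<in> carrier (tensor_lmod H (tensor_lmod H U V) W)" if "t \<in> carrier
      (tensor_lmod H U (tensor_lmod H V W))" for t
    using additive_map_closed[OF add] that by simp
  have "reassoc U V W (?g t) = t" if "t \<in> carrier ?T'" for t
    using vss(1-3) that
    by (induct rule: tensor3_induct_right)
      (simp_all add: g reassoc_pure additive_map_add[OF add] additive_map_add[OF f]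
          additive_map_closed[OF add])
  then show "fn (assoc C U V W) (?g t) = t" if "t \<in> carrier (tensor_lmod H U (tensor_lmod H V W))" for t
    using that additive_map_closed[OF add] by (simp add: assoc_eq)
  have "?g (reassoc U V W t) = t" if "t \<in> carrier ?T" for t
    using vss(1-3) that
    by (induct rule: tensor3_induct)
      (simp_all add: g reassoc_pure additive_map_add[OF add] additive_map_add[OF f]
          additive_map_closed[OF f])
  then show "?g (fn (assoc C U V W) t) = t" if "t \<in> carrier (tensor_lmod H (tensor_lmod H U V) W)" for t
    using that by (simp add: assoc_eq)
qed (simp_all add: tensor_lmod_module U V W)

end

section \<open>The unit isomorphisms\<close>

context
  fixes V :: "('a univ, 'a univ) lmod"
  assumes V: "left_module H V"
begin

interpretation V: left_module H V by (rule V)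
interpretation I: left_module H "unit_lmod H" by (rule unit_lmod_module)
interpretation R: module_pair H H V "unit_lmod H" by (intro module_pair.intro alg V unit_lmod_module)
interpretation L: module_pair H H "unit_lmod H" V by (intro module_pair.intro alg V unit_lmod_module)

lemma lunit_eq: "lunit C V = Arrow V (tensor_lmod H V (unit_lmod H))
    (\<lambda>v \<in> carrier V. pure V (unit_lmod H) v (Scalar 1))"
  and runit_eq: "runit C V = Arrow V (tensor_lmod H (unit_lmod H) V)
      (\<lambda>v \<in> carrier V. pure (unit_lmod H) V (Scalar 1) v)"
  by (simp_all add: monoidal_lmod_def)

text \<open>Moving the scalar into V gives every pure tensor with the unit module the normal form
  with \<open>Scalar 1\<close>, on which the unit isomorphisms are visibly bijective.\<close>

lemma pure_unit_scalar:
  "v \<in> carrier V \<Longrightarrow> pure V (unit_lmod H) v (Scalar c) = pure V (unit_lmod H) (c \<odot>\<^bsub>V\<^esub> v) (Scalar 1)"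
  "v \<in> carrier V \<Longrightarrow> pure (unit_lmod H) V (Scalar c) v = pure (unit_lmod H) V (Scalar 1) (c \<odot>\<^bsub>V\<^esub> v)"
  using pure_smult_right[of V "unit_lmod H" v "Scalar 1" c]
      pure_smult_right[of "unit_lmod H" V "Scalar 1" v c]
  by simp_all

text \<open>The unit module sees the second leg only through \<epsilon>. For a coproduct the
  contraction is the counit axiom; for the twist it is the normalisation behind the unit axioms of a
  bar category.\<close>

lemma outer_act_unit_right:
  assumes a: "a \<in> carrier HH" and v: "v \<in> carrier V"
  shows "outer_act V (unit_lmod H) a (pure V (unit_lmod H) v (Scalar 1))
    = pure V (unit_lmod H) (sweedler H a (\<lambda>x y. counit H y \<odot> x) \<triangleright>\<^bsub>V\<^esub> v) (Scalar 1)"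
  using vs vs a
  by (induct rule: tensor_induct)
    (use v in \<open>simp_all add: R.outer_act_simps pure_unit_scalar[symmetric] V.act_simps
        sweedler_counit_simps pure_add_left\<close>)

lemma outer_act_unit_left:
  assumes a: "a \<in> carrier HH" and v: "v \<in> carrier V"
  shows "outer_act (unit_lmod H) V a (pure (unit_lmod H) V (Scalar 1) v)
    = pure (unit_lmod H) V (Scalar 1) (sweedler H a (\<lambda>x y. counit H x \<odot> y) \<triangleright>\<^bsub>V\<^esub> v)"
  using vs vs a
  by (induct rule: tensor_induct)
    (use v in \<open>simp_all add: L.outer_act_simps pure_unit_scalar[symmetric] V.act_simps
        sweedler_counit_simps pure_add_right\<close>)

lemma lunit_hom: "lunit C V \<in> module_hom H V (tensor_lmod H V (unit_lmod H))"
  unfolding lunit_eq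
  by (rule module_homI)
    (auto intro!: additive_mapI simp: V tensor_lmod_module unit_lmod_module pure_add_left
        outer_act_unit_right counit_right)

lemma runit_hom: "runit C V \<in> module_hom H V (tensor_lmod H (unit_lmod H) V)"
  unfolding runit_eq
  by (rule module_homI)
    (auto intro!: additive_mapI simp: V tensor_lmod_module unit_lmod_module pure_add_right
        outer_act_unit_left counit_left)

lemma fn_lunit: "v \<in> carrier V \<Longrightarrow> fn (lunit C V) v = pure V (unit_lmod H) v (Scalar 1)"
  and fn_runit: "v \<in> carrier V \<Longrightarrow> fn (runit C V) v = pure (unit_lmod H) V (Scalar 1) v"
  by (simp_all add: lunit_eq runit_eq)

lemma lunit_iso: "lunit C V \<in> Iso C V (tensor_lmod H V (unit_lmod H))"
proof (rule isoI[OF V _ lunit_hom])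
  let ?g = "\<lambda>t. sweedler V t (\<lambda>v x. scalar x \<odot>\<^bsub>V\<^esub> v)"
  have bal: "balanced V (unit_lmod H) V (\<lambda>v x. scalar x \<odot>\<^bsub>V\<^esub> v)"
    by (intro balancedI) (auto simp: V.vec_space vec_smult_add vec_smult_add_left vec_smult_smult
        mult.commute)
  have g: "?g t \<in> carrier V" if "t \<in> carrier (tensor V (unit_lmod H))" for t
    using that by (intro sweedler_closed[of V "unit_lmod H"]) auto
  show "?g t \<in> carrier V" if "t \<in> carrier (tensor_lmod H V (unit_lmod H))" for t
    using that g by simp
  have "pure V (unit_lmod H) (?g t) (Scalar 1) = t" if "t \<in> carrier (tensor V (unit_lmod H))" for t
    using R.vs(3,4) that
    by (induct rule: tensor_induct)
      (auto simp: sweedler_pure[OF _ _ _ bal] sweedler_add[OF _ _ _ bal] pure_unit_scalar[symmetric]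
          pure_add_left g)
  then show "fn (lunit C V) (?g t) = t" if "t \<in> carrier (tensor_lmod H V (unit_lmod H))" for t
    using that g by (simp add: fn_lunit)
  show "?g (fn (lunit C V) v) = v" if "v \<in> carrier V" for v
    using that by (simp add: fn_lunit sweedler_pure[OF _ _ _ bal])
qed (simp add: tensor_lmod_module V unit_lmod_module)

lemma runit_iso: "runit C V \<in> Iso C V (tensor_lmod H (unit_lmod H) V)"
proof (rule isoI[OF V _ runit_hom])
  let ?g = "\<lambda>t. sweedler V t (\<lambda>x v. scalar x \<odot>\<^bsub>V\<^esub> v)"
  have bal: "balanced (unit_lmod H) V V (\<lambda>x v. scalar x \<odot>\<^bsub>V\<^esub> v)"
    by (intro balancedI) (auto simp: V.vec_space vec_smult_add vec_smult_add_left vec_smult_smult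
        mult.commute)
  have g: "?g t \<in> carrier V" if "t \<in> carrier (tensor (unit_lmod H) V)" for t
    using that by (intro sweedler_closed[of "unit_lmod H" V]) auto
  show "?g t \<in> carrier V" if "t \<in> carrier (tensor_lmod H (unit_lmod H) V)" for t
    using that g by simp
  have "pure (unit_lmod H) V (Scalar 1) (?g t) = t" if "t \<in> carrier (tensor (unit_lmod H) V)" for t
    using L.vs(3,4) that
    by (induct rule: tensor_induct)
      (auto simp: sweedler_pure[OF _ _ _ bal] sweedler_add[OF _ _ _ bal] pure_unit_scalar[symmetric]
          pure_add_right g)
  then show "fn (runit C V) (?g t) = t" if "t \<in> carrier (tensor_lmod H (unit_lmod H) V)" for t
    using that g by (simp add: fn_runit)
  show "?g (fn (runit C V) v) = v" if "v \<in> carrier V" for v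
    using that by (simp add: fn_runit sweedler_pure[OF _ _ _ bal])
qed (simp add: tensor_lmod_module V unit_lmod_module)

end

end

section \<open>Coherence of the monoidal structure\<close>

lemma module_hom_tensor_eqI:
  assumes "vec_space V" "vec_space W"
    and f: "f \<in> module_hom H X Y" and g: "g \<in> module_hom H X Y"
    and X: "carrier X = carrier (tensor V W)" "add X = add (tensor V W)"
    and eq: "\<And>v w. \<lbrakk>v \<in> carrier V; w \<in> carrier W\<rbrakk> \<Longrightarrow> fn f (pure V W v w) = fn g (pure V W v w)"
  shows "f = g"
proof (rule module_hom_eqI[OF f g])
  fix t assume "t \<in> carrier X"
  then have t: "t \<in> carrier (tensor V W)" by (simp add: X)
  have add: "additive_map (tensor V W) Y (fn f)" "additive_map (tensor V W) Y (fn g)"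
    using module_homD(5)[OF f] module_homD(5)[OF g] by (simp_all add: additive_map_def X)
  show "fn f t = fn g t"
    by (rule additive_map_tensor_eqI[OF t assms(1,2) add eq])
qed

lemma module_hom_tensor3_eqI:
  assumes "vec_space U" "vec_space V" "vec_space W"
    and f: "f \<in> module_hom H X Y" and g: "g \<in> module_hom H X Y"
    and X: "carrier X = carrier (tensor (tensor U V) W)" "add X = add (tensor (tensor U V) W)"
    and eq: "\<And>u v w. \<lbrakk>u \<in> carrier U; v \<in> carrier V; w \<in> carrier W\<rbrakk>
      \<Longrightarrow> fn f (pure (tensor U V) W (pure U V u v) w) = fn g (pure (tensor U V) W (pure U V u v) w)"
  shows "f = g"
proof (rule module_hom_eqI[OF f g])
  fix t assume "t \<in> carrier X"
  then have "t \<in> carrier (tensor (tensor U V) W)" by (simp add: X)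
  with assms(1-3) show "fn f t = fn g t"
    by (induct rule: tensor3_induct)
      (use eq additive_map_add[OF module_homD(5)[OF f]] additive_map_add[OF module_homD(5)[OF g]]
          in \<open>simp_all add: X\<close>)
qed

context hopf_algebra
begin

lemma vec_space_lmod: "left_module H V \<Longrightarrow> vec_space V"
  by (rule left_module.vec_space)

text \<open>Both sides of every coherence equation are morphisms, so they are compared on pure
  tensors, where associators only move brackets and unit maps only insert
  \<open>Scalar 1\<close>.\<close>

lemma monoidal_category_lmod: "monoidal_category C"
proof (rule monoidal_category.intro[OF category_lmod], rule monoidal_category_axioms.intro)
  note [simp] = vec_space_lmod
  fix X Y assume "X \<in> Obj C" "Y \<in> Obj C"
  then have X: "left_module H X" and Y: "left_module H Y" by auto
  show "tensor_arr C (ident C X) (ident C Y) = ident C (X \<boxtimes>\<^bsub>C\<^esub> Y)"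
    using X Y by (intro module_hom_tensor_eqI[of X Y _ H "tensor_lmod H X Y" "tensor_lmod H X Y"])
      (simp_all add: tensor_arr_hom tensor_lmod_module fn_tensor_arr)
  let ?I = "unit_lmod H"
  note I = unit_lmod_module
  note XI = tensor_arr_hom[OF X Y tensor_lmod_module[OF X I] Y lunit_hom[OF X] ident_hom[OF Y]]
    and IY = tensor_arr_hom[OF X Y X tensor_lmod_module[OF I Y] ident_hom[OF X] runit_hom[OF Y]]
  note c = comp_hom[OF _ _ _ XI assoc_hom[OF X I Y]]
  show "assoc C X (unit_obj C) Y \<circ>\<^sub>C tensor_arr C (lunit C X) (ident C Y)
      = tensor_arr C (ident C X) (runit C Y)"
  proof (rule module_hom_tensor_eqI[of X Y])
    show "assoc C X (unit_obj C) Y \<circ>\<^sub>C tensor_arr C (lunit C X) (ident C Y)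
      \<in> module_hom H (tensor_lmod H X Y) (tensor_lmod H X (tensor_lmod H ?I Y))"
      using c X Y I by (simp add: tensor_lmod_module)
    fix x y assume "x \<in> carrier X" "y \<in> carrier Y"
    then show "fn (assoc C X (unit_obj C) Y \<circ>\<^sub>C tensor_arr C (lunit C X) (ident C Y)) (pure X Y x y)
      = fn (tensor_arr C (ident C X) (runit C Y)) (pure X Y x y)"
      using X Y I
      by (simp add: fn_comp[OF XI] fn_tensor_arr[OF _ _ _ _ lunit_hom[OF X] ident_hom[OF Y]]
          fn_tensor_arr[OF _ _ _ _ ident_hom[OF X] runit_hom[OF Y]] tensor_lmod_module fn_lunit fn_runit
              fn_assoc)
  qed (use X Y IY in simp_all)
next
  note [simp] = vec_space_lmod
  fix X X' X'' Y Y' Y'' f f' g g'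
  assume "X \<in> Obj C" "X' \<in> Obj C" "X'' \<in> Obj C" "Y \<in> Obj C" "Y' \<in> Obj C" "Y'' \<in> Obj C"
    and "f \<in> Hom C X X'" "f' \<in> Hom C X' X''" "g \<in> Hom C Y Y'" "g' \<in> Hom C Y' Y''"
  then have m: "left_module H X" "left_module H X'" "left_module H X''"
      "left_module H Y" "left_module H Y'" "left_module H Y''"
    and f: "f \<in> module_hom H X X'" "f' \<in> module_hom H X' X''"
        and g: "g \<in> module_hom H Y Y'" "g' \<in> module_hom H Y' Y''"
    by auto
  note ff = comp_hom[OF m(1-3) f] and gg = comp_hom[OF m(4-6) g]
  note t = tensor_arr_hom[OF m(1,4,2,5) f(1) g(1)]
  note t' = tensor_arr_hom[OF m(2,5,3,6) f(2) g(2)]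
  show "tensor_arr C (f' \<circ>\<^sub>C f) (g' \<circ>\<^sub>C g) = tensor_arr C f' g' \<circ>\<^sub>C tensor_arr C f g"
    by (rule module_hom_tensor_eqI[of X Y, OF _ _ tensor_arr_hom[OF m(1,4,3,6) ff gg]
          comp_hom[OF tensor_lmod_module tensor_lmod_module tensor_lmod_module t t']])
      (use m module_homD(6)[OF f(1)] module_homD(6)[OF g(1)] in
        \<open>simp_all add: fn_comp[OF t] fn_comp[OF f(1)] fn_comp[OF g(1)] fn_tensor_arr[OF m(1,4,3,6) ff gg]
          fn_tensor_arr[OF m(1,4,2,5) f(1) g(1)] fn_tensor_arr[OF m(2,5,3,6) f(2) g(2)]\<close>)
next
  note [simp] = vec_space_lmod
  fix X X' Y Y' Z Z' f g h
  assume "X \<in> Obj C" "X' \<in> Obj C" "Y \<in> Obj C" "Y' \<in> Obj C" "Z \<in> Obj C" "Z' \<in> Obj C"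
    and "f \<in> Hom C X X'" "g \<in> Hom C Y Y'" "h \<in> Hom C Z Z'"
  then have m: "left_module H X" "left_module H X'" "left_module H Y" "left_module H Y'" "left_module H
      Z" "left_module H Z'"
    and f: "f \<in> module_hom H X X'" and g: "g \<in> module_hom H Y Y'" and h: "h \<in> module_hom H Z Z'"
    by auto
  note tl = tensor_lmod_module
  note fg = tensor_arr_hom[OF m(1,3,2,4) f g] and gh = tensor_arr_hom[OF m(3,5,4,6) g h]
  note l = tensor_arr_hom[OF tl[OF m(1,3)] m(5) tl[OF m(2,4)] m(6) fg h]
  note r = tensor_arr_hom[OF m(1) tl[OF m(3,5)] m(2) tl[OF m(4,6)] f gh]
  note a = assoc_hom[OF m(2,4,6)] and a' = assoc_hom[OF m(1,3,5)]
  note homs = comp_hom[OF _ _ _ l a] comp_hom[OF _ _ _ a' r]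
  show "assoc C X' Y' Z' \<circ>\<^sub>C tensor_arr C (tensor_arr C f g) h
      = tensor_arr C f (tensor_arr C g h) \<circ>\<^sub>C assoc C X Y Z"
    by (rule module_hom_tensor3_eqI[of X Y Z, OF _ _ _ homs])
      (use m module_homD(6)[OF f] module_homD(6)[OF g] module_homD(6)[OF h] in
      \<open>simp_all add: tl fn_comp[OF l] fn_comp[OF a'] fn_assoc
        fn_tensor_arr[OF m(1,3,2,4) f g] fn_tensor_arr[OF m(3,5,4,6) g h]
        fn_tensor_arr[OF tl[OF m(1,3)] m(5) tl[OF m(2,4)] m(6) fg h, simplified]
        fn_tensor_arr[OF m(1) tl[OF m(3,5)] m(2) tl[OF m(4,6)] f gh, simplified]\<close>)
next
  note [simp] = vec_space_lmod
  fix X X' f assume "X \<in> Obj C" "X' \<in> Obj C" "f \<in> Hom C X X'"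
  then have m: "left_module H X" "left_module H X'" and f: "f \<in> module_hom H X X'" by auto
  note I = unit_lmod_module
  note tl = tensor_lmod_module
  note fI = tensor_arr_hom[OF m(1) I m(2) I f ident_hom[OF I]] and If
      = tensor_arr_hom[OF I m(1) I m(2) ident_hom[OF I] f]
  show "lunit C X' \<circ>\<^sub>C f = tensor_arr C f (ident C (unit_obj C)) \<circ>\<^sub>C lunit C X"
    by (rule module_hom_eqI[OF comp_hom[OF _ _ _ f lunit_hom[OF m(2)]]])
      (use m I module_homD(6)[OF f] comp_hom[OF _ _ _ lunit_hom[OF m(1)] fI] in
        \<open>simp_all add: tl fn_comp[OF f] fn_comp[OF lunit_hom[OF m(1)]] fn_lunit
            fn_tensor_arr[OF m(1) I m(2) I f ident_hom[OF I]]\<close>)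
  show "runit C X' \<circ>\<^sub>C f = tensor_arr C (ident C (unit_obj C)) f \<circ>\<^sub>C runit C X"
    by (rule module_hom_eqI[OF comp_hom[OF _ _ _ f runit_hom[OF m(2)]]])
      (use m I module_homD(6)[OF f] comp_hom[OF _ _ _ runit_hom[OF m(1)] If] in
        \<open>simp_all add: tl fn_comp[OF f] fn_comp[OF runit_hom[OF m(1)]] fn_runit
            fn_tensor_arr[OF I m(1) I m(2) ident_hom[OF I] f]\<close>)
next
  note [simp] = vec_space_lmod
  fix W X Y Z assume "W \<in> Obj C" "X \<in> Obj C" "Y \<in> Obj C" "Z \<in> Obj C"
  then have m: "left_module H W" "left_module H X" "left_module H Y" "left_module H Z" by auto
  note tl = tensor_lmod_module
  note WX = tl[OF m(1,2)] and XY = tl[OF m(2,3)] and YZ = tl[OF m(3,4)]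
  note a1 = assoc_hom[OF WX m(3,4)] and a2 = assoc_hom[OF m(1,2) YZ]
    and a3 = assoc_hom[OF m(1-3)] and a4 = assoc_hom[OF m(1) XY m(4)] and a5 = assoc_hom[OF m(2-4)]
  note i = tensor_arr_hom[OF _ _ _ _ a3 ident_hom[OF m(4)]] and j
      = tensor_arr_hom[OF _ _ _ _ ident_hom[OF m(1)] a5]
  have i: "tensor_arr C (assoc C W X Y) (ident C Z) \<in> module_hom H
      (tensor_lmod H (tensor_lmod H (tensor_lmod H W X) Y) Z)
          (tensor_lmod H (tensor_lmod H W (tensor_lmod H X Y)) Z)"
    and j: "tensor_arr C (ident C W) (assoc C X Y Z) \<in> module_hom H
      (tensor_lmod H W (tensor_lmod H (tensor_lmod H X Y) Z))
          (tensor_lmod H W (tensor_lmod H X (tensor_lmod H Y Z)))"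
    by (rule i j; simp add: tl m)+
  have b: "assoc C W (tensor_lmod H X Y) Z \<circ>\<^sub>C tensor_arr C (assoc C W X Y) (ident C Z) \<in> module_hom H
    (tensor_lmod H (tensor_lmod H (tensor_lmod H W X) Y) Z)
        (tensor_lmod H W (tensor_lmod H (tensor_lmod H X Y) Z))"
    by (rule comp_hom[OF _ _ _ i a4]) (simp_all add: tl m)
  have fi: "fn (tensor_arr C (assoc C W X Y) (ident C Z)) (pure (tensor (tensor W X) Y) Z s z)
      = pure (tensor W (tensor X Y)) Z (fn (assoc C W X Y) s) z"
    if "s \<in> carrier (tensor (tensor W X) Y)" "z \<in> carrier Z" for s z
    using fn_tensor_arr[OF _ _ _ _ a3 ident_hom[OF m(4)], of s z] that m tl by simp
  have fj: "fn (tensor_arr C (ident C W) (assoc C X Y Z)) (pure W (tensor (tensor X Y) Z) w s)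
      = pure W (tensor X (tensor Y Z)) w (fn (assoc C X Y Z) s)"
    if "s \<in> carrier (tensor (tensor X Y) Z)" "w \<in> carrier W" for s w
    using fn_tensor_arr[OF _ _ _ _ ident_hom[OF m(1)] a5, of w s] that m tl by simp
  let ?l = "assoc C W X (tensor_lmod H Y Z) \<circ>\<^sub>C assoc C (tensor_lmod H W X) Y Z"
  let ?r = "tensor_arr C (ident C W) (assoc C X Y Z) \<circ>\<^sub>C assoc C W (tensor_lmod H X Y) Z \<circ>\<^sub>C tensor_arr C
      (assoc C W X Y) (ident C Z)"
  have L: "?l \<in> module_hom H (tensor_lmod H (tensor_lmod H (tensor_lmod H W X) Y) Z)
      (tensor_lmod H W (tensor_lmod H X (tensor_lmod H Y Z)))"
    by (rule comp_hom[OF _ _ _ a1 a2]) (simp_all add: tl m)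
  have R: "?r \<in> module_hom H (tensor_lmod H (tensor_lmod H (tensor_lmod H W X) Y) Z)
      (tensor_lmod H W (tensor_lmod H X (tensor_lmod H Y Z)))"
    by (rule comp_hom[OF _ _ _ b j]) (simp_all add: tl m)
  have "?l = ?r"
  \<comment> \<open>The fourfold product is treated as a triple one with W \<otimes> X as first
    factor; an inner induction then splits that factor.\<close>
  proof (rule module_hom_tensor3_eqI[of "tensor W X" Y Z, OF _ _ _ L R])
    fix s y z assume s: "s \<in> carrier (tensor W X)" and yz: "y \<in> carrier Y" "z \<in> carrier Z"
    have WX': "vec_space W" "vec_space X" using m by auto
    note al = additive_map_add[OF module_homD(5)[OF L], simplified] and ar
        = additive_map_add[OF module_homD(5)[OF R], simplified]
    from WX' s show "fn ?l (pure (tensor (tensor W X) Y) Z (pure (tensor W X) Y s y) z)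
        = fn ?r (pure (tensor (tensor W X) Y) Z (pure (tensor W X) Y s y) z)"
    proof (induct rule: tensor_induct)
      case (pure w x)
      then show ?case
        using yz m tl fn_assoc[OF WX m(3,4), of "pure W X w x" y z]
            fn_assoc[OF m(1) XY m(4), of w "pure X Y x y" z]
          fn_assoc[OF m(1,2) YZ, of w x "pure Y Z y z"]
        by (simp add: fn_comp[OF a1] fn_comp[OF b] fn_comp[OF i] fi fj fn_assoc)
    qed (use yz m in \<open>simp_all add: pure_add_left al ar\<close>)
  qed (simp_all add: m)
  then show "assoc C W X (Y \<boxtimes>\<^bsub>C\<^esub> Z) \<circ>\<^sub>C assoc C (W \<boxtimes>\<^bsub>C\<^esub> X) Y Z
    = tensor_arr C (ident C W) (assoc C X Y Z) \<circ>\<^sub>C assoc C W (X \<boxtimes>\<^bsub>C\<^esub> Y) Z \<circ>\<^sub>C tensor_arr C (assoc C W X Y)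
        (ident C Z)"
    by simp
qed (auto simp: tensor_lmod_module unit_lmod_module tensor_arr_hom assoc_iso lunit_iso runit_iso)

end

section \<open>The bar category of modules\<close>

lemma bar_lmod_sel [simp]:
  "carrier (bar_lmod H V) = carrier V"
  "\<zero>\<^bsub>bar_lmod H V\<^esub> = \<zero>\<^bsub>V\<^esub>"
  "add (bar_lmod H V) = add V"
  "c \<odot>\<^bsub>bar_lmod H V\<^esub> v = cnj c \<odot>\<^bsub>V\<^esub> v"
  "act (bar_lmod H V) h v = star H (antipode H h) \<triangleright>\<^bsub>V\<^esub> v"
  by (simp_all add: bar_lmod_def)

lemma twin_bar: "twin cnj V (bar_lmod H V)"
  by (simp add: twin_def)

lemmas twin_tensor_bar = tensor_twin[OF twin_bar twin_bar]

text \<open>Used as rewrite rules, these erase bars from elements, sums and induced maps, so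
  calculations with conjugate modules take place in the original tensor products.\<close>

lemma tensor_bar [simp]:
  "pure (bar_lmod H V) (bar_lmod H W) = pure V W"
  "carrier (tensor (bar_lmod H V) (bar_lmod H W)) = carrier (tensor V W)"
  "\<zero>\<^bsub>tensor (bar_lmod H V) (bar_lmod H W)\<^esub> = \<zero>\<^bsub>tensor V W\<^esub>"
  "add (tensor (bar_lmod H V) (bar_lmod H W)) = add (tensor V W)"
  "tensor_map (bar_lmod H V) (bar_lmod H W) = tensor_map V W"
  "flip (bar_lmod H V) (bar_lmod H W) = flip V W"
  "sweedler (tensor (bar_lmod H V) (bar_lmod H W)) = sweedler (tensor V W)"
  by (simp_all add: pure_twin[OF twin_bar twin_bar] twin_sel[OF twin_tensor_bar]
      tensor_map_twin[OF twin_bar twin_bar] flip_twin[OF twin_bar twin_bar]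
          sweedler_twin[OF twin_tensor_bar])

lemma tensor_bar3 [simp]:
  fixes U V W :: "('a univ, 'a univ) lmod"
  shows "carrier (tensor (tensor (bar_lmod H U) (bar_lmod H V)) (bar_lmod H W))
      = carrier (tensor (tensor U V) W)"
  "add (tensor (bar_lmod H U) (tensor (bar_lmod H V) (bar_lmod H W))) = add (tensor U (tensor V W))"
  "add (tensor (tensor (bar_lmod H U) (bar_lmod H V)) (bar_lmod H W)) = add (tensor (tensor U V) W)"
  "carrier (tensor (bar_lmod H U) (tensor (bar_lmod H V) (bar_lmod H W))) = carrier (tensor U (tensor V W))"
  "tensor_map (tensor (bar_lmod H U) (bar_lmod H V)) (bar_lmod H W) = tensor_map (tensor U V) W"
  "tensor_map (bar_lmod H U) (tensor (bar_lmod H V) (bar_lmod H W)) = tensor_map U (tensor V W)"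
  "reassoc (bar_lmod H U) (bar_lmod H V) (bar_lmod H W) = reassoc U V W"
  by (simp_all add: twin_sel[OF tensor_twin[OF twin_tensor_bar twin_bar]]
      twin_sel[OF tensor_twin[OF twin_bar twin_tensor_bar]]
      tensor_map_twin[OF twin_tensor_bar twin_bar] tensor_map_twin[OF twin_bar twin_tensor_bar]
      reassoc_def fun_eq_iff sweedler_twin[OF tensor_twin[OF twin_bar twin_tensor_bar]]
      pure_twin[OF twin_bar twin_tensor_bar])

lemma flip_tensor_map:
  assumes vs: "vec_space V" "vec_space W" "vec_space V'" "vec_space W'"
    and f: "semilinear_map \<sigma> V V' f" and g: "semilinear_map \<sigma> W W' g" and t: "t \<in> carrier (tensor V W)"
  shows "flip V' W' (tensor_map V' W' f g t) = tensor_map W' V' g f (flip V W t)"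
proof -
  have cl: "f v \<in> carrier V'" "g w \<in> carrier W'" if "v \<in> carrier V" "w \<in> carrier W" for v w
    using f g that by (auto simp: semilinear_map_def additive_map_def)
  show ?thesis
    by (rule additive_map_tensor_eqI[OF t vs(1,2)
          additive_map_compose[OF semilinear_tensor_map_additive[OF vs f g] flip_additive[OF vs(3,4)]]
          additive_map_compose[OF flip_additive[OF vs(1,2)]
              semilinear_tensor_map_additive[OF vs(2,1,4,3) g f]]])
      (simp add: semilinear_tensor_map_pure[OF vs f g] semilinear_tensor_map_pure[OF vs(2,1,4,3) g f]
          flip_pure vs cl)
qed

text \<open>Trades a flip of the acting element for a flip of the modules. This matches the reversal
  in \<open>dagger2\<close> with the reversal in Upsilon, and undoes the two flips in the coboundary
  map.\<close>

lemma flip_outer_act: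
  assumes "module_pair A B V W" and a: "a \<in> carrier (tensor A B)" and t: "t \<in> carrier (tensor V W)"
  shows "flip V W (outer_act V W a t) = outer_act W V (flip A B a) (flip V W t)"
proof -
  interpret P: module_pair A B V W by (rule assms(1))
  interpret Q: module_pair B A W V
    by (intro module_pair.intro P.A.complex_algebra_axioms P.B.complex_algebra_axioms
        P.V.left_module_axioms P.W.left_module_axioms)
  note f = additive_map_add[OF flip_additive] additive_map_closed[OF flip_additive] flip_pure
  from P.vs(1,2) a show ?thesis
  proof (induct rule: tensor_induct)
    case (pure x y)
    from P.vs(3,4) t show ?case
      by (induct rule: tensor_induct)
        (use pure in \<open>simp_all add: f P.outer_act_simps Q.outer_act_simps P.V.act_closed P.W.act_closed\<close>)
  qed (use t in \<open>simp_all add: f P.outer_act_simps Q.outer_act_simps\<close>)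
qed

text \<open>The axioms read only the monoidal fields, so they pass to the larger record with the bar
  structure.\<close>

lemma monoidal_category_extend: "monoidal_category (monoidal.extend M F) \<longleftrightarrow> monoidal_category M"
  by (cases M)
    (simp add: monoidal_category_def category_def monoidal_category_axioms_def Iso_def monoidal.defs
        category.defs)

context quasi_star_hopf_algebra
begin

abbreviation "B \<equiv> bar_lmod_category H"

abbreviation "bar \<equiv> bar_lmod H"

lemma bar_lmod_category_sel [simp]:
  "Obj B = {V. left_module H V}"
  "Hom B = module_hom H"
  "ident B = ident C"
  "comp B = comp C"
  "tensor_obj B = tensor_lmod H"
  "tensor_arr B = tensor_arr C"
  "unit_obj B = unit_lmod H"
  "assoc B = assoc C"
  "lunit B = lunit C"
  "runit B = runit C"
  "bar_obj B = bar"
  by (simp_all add: bar_lmod_category_def monoidal_lmod_def monoidal.defs bar_structure.defs)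

lemma bar_arr_eq: "bar_arr B f = Arrow (bar (src f)) (bar (trg f)) (fn f)"
  and bb_eq: "bb B V = Arrow V (bar (bar V)) (\<lambda>v \<in> carrier V. \<gamma> \<triangleright>\<^bsub>V\<^esub> v)"
  and star_arr_eq: "star_arr B = Arrow (unit_lmod H) (bar (unit_lmod H))
      (\<lambda>x \<in> range Scalar. Scalar (cnj (scalar x)))"
  by (simp_all add: bar_lmod_category_def monoidal_lmod_def monoidal.defs bar_structure.defs)

lemma fn_bb_arr: "v \<in> carrier V \<Longrightarrow> fn (bb B V) v = \<gamma> \<triangleright>\<^bsub>V\<^esub> v"
  by (simp add: bb_eq)

lemma Iso_B [simp]: "Iso B = Iso C"
  by (simp add: Iso_def fun_eq_iff)

lemma bar_act: "act (bar V) h v = dagger h \<triangleright>\<^bsub>V\<^esub> v"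
  by (simp add: dagger_def)

declare bar_lmod_sel(5) [simp del] bar_act [simp]

lemma bar_module:
  assumes "left_module H V"
  shows "left_module H (bar V)"
proof -
  interpret V: left_module H V by (rule assms)
  have "vec_space (bar V)"
  proof (rule vec_spaceI)
    interpret module complex_ring V by (rule V.vec_space)
    show "abelian_group (bar V)"
      by (rule abelian_groupI) (use a_ac in \<open>auto intro: l_neg a_inv_closed exI[of _ "\<ominus>\<^bsub>V\<^esub> _"]\<close>)
  qed (use V.vec_space in \<open>auto simp: vec_smult_add_left vec_smult_add vec_smult_smult\<close>)
  then show ?thesis
    by (rule left_module.intro)
      (auto intro!: linear_mapI simp: V.act_simps dagger_add dagger_smult dagger_mult dagger_one)
qed

text \<open>Each leg acts on its conjugate module through \<open>dagger\<close>; the order of the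
  two modules is kept, so no flip appears here.\<close>

lemma outer_act_bar:
  assumes V: "left_module H V" and W: "left_module H W" and a: "a \<in> carrier HH"
      and t: "t \<in> carrier (tensor V W)"
  shows "outer_act (bar V) (bar W) a t = outer_act V W (tensor_map H H dagger dagger a) t"
proof -
  interpret P: module_pair H H V W by (intro module_pair.intro alg V W)
  interpret Q: module_pair H H "bar V" "bar W" by (intro module_pair.intro alg bar_module V W)
  note simps = P.outer_act_simps Q.outer_act_simps[simplified] dagger_map_pure
    additive_map_add[OF dagger_map_additive] additive_map_closed[OF dagger_map_additive]
  from vs vs a show ?thesis
  proof (induct rule: tensor_induct)
    case (pure x y)
    from P.vs(3,4) t show ?case
      by (induct rule: tensor_induct) (use pure in \<open>simp_all add: simps\<close>)
  qed (use t in \<open>simp_all add: simps\<close>)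
qed

lemma bar_arr_hom:
  assumes f: "f \<in> module_hom H V W"
  shows "bar_arr B f \<in> module_hom H (bar V) (bar W)"
proof -
  note f' = module_homD[OF f]
  show ?thesis unfolding bar_arr_eq f'(1,2)
    using f' by (auto simp: module_hom_def linear_map_def additive_map_def)
qed

lemma fn_bar_arr [simp]: "fn (bar_arr B f) = fn f"
  by (simp add: bar_arr_eq)

section \<open>The morphisms bb and star\<close>

lemma bb_hom:
  assumes V: "left_module H V"
  shows "bb B V \<in> module_hom H V (bar (bar V))"
proof -
  interpret V: left_module H V by (rule V)
  show ?thesis unfolding bb_eq
  proof (rule module_homI)
    fix h v assume "h \<in> carrier H" "v \<in> carrier V"
    then show "\<gamma> \<triangleright>\<^bsub>V\<^esub> h \<triangleright>\<^bsub>V\<^esub> v = h \<triangleright>\<^bsub>bar (bar V)\<^esub> \<gamma> \<triangleright>\<^bsub>V\<^esub> v"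
      by (simp add: V.act_mult[symmetric] gam_mult)
  qed (auto intro!: additive_mapI simp: V bar_module V.act_simps)
qed

lemma bb_iso:
  assumes V: "left_module H V"
  shows "bb B V \<in> Iso C V (bar (bar V))"
proof -
  interpret V: left_module H V by (rule V)
  show ?thesis
    by (rule isoI[OF V _ bb_hom[OF V], where g = "\<lambda>v. inv \<gamma> \<triangleright>\<^bsub>V\<^esub> v"])
      (use gam_unit in \<open>auto simp: bb_eq V bar_module V.act_closed V.act_mult[symmetric] V.act_one\<close>)
qed

lemma star_arr_iso:
  "star_arr B \<in> module_hom H (unit_lmod H) (bar (unit_lmod H))"
  "star_arr B \<in> Iso C (unit_lmod H) (bar (unit_lmod H))"
proof -
  let ?g = "\<lambda>x. Scalar (cnj (scalar x))"
  have "Arrow (unit_lmod H) (bar (unit_lmod H)) (\<lambda>v \<in> carrier (unit_lmod H). ?g v)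
    \<in> module_hom H (unit_lmod H) (bar (unit_lmod H))"
    by (rule module_homI) (auto intro!: additive_mapI simp: unit_lmod_module bar_module counit_dagger)
  then show 1: "star_arr B \<in> module_hom H (unit_lmod H) (bar (unit_lmod H))"
    by (simp add: star_arr_eq)
  show "star_arr B \<in> Iso C (unit_lmod H) (bar (unit_lmod H))"
    by (rule isoI[OF unit_lmod_module bar_module[OF unit_lmod_module] 1, of ?g]) (auto simp: star_arr_eq)
qed

lemma fn_star_arr: "fn (star_arr B) (Scalar c) = Scalar (cnj c)"
  by (simp add: star_arr_eq)

definition star_inv :: "('a univ, 'a univ) arrow" where
  "star_inv = inverse_arrow B (unit_lmod H) (bar (unit_lmod H)) (star_arr B)"

text \<open>The inverse is given by definite description, so uniqueness of inverses in a category is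
  needed before its values can be read off from an actual inverse.\<close>

lemma star_inv:
  "star_inv \<in> module_hom H (bar (unit_lmod H)) (unit_lmod H)"
  "fn star_inv (Scalar c) = Scalar (cnj c)"
proof -
  let ?I = "unit_lmod H" and ?s = "star_arr B"
  note I = unit_lmod_module and I' = bar_module[OF unit_lmod_module]
  interpret C: category C by (rule category_lmod)
  obtain g where g: "g \<in> module_hom H (bar ?I) ?I" "g \<circ>\<^sub>C ?s = ident C ?I" "?s \<circ>\<^sub>C g = ident C (bar ?I)"
    using star_arr_iso(2) by (auto simp: Iso_def)
  have "star_inv = g"
    unfolding star_inv_def inverse_arrow_def
  proof (rule the_equality)
    fix g' assume "g' \<in> Hom B (bar ?I) ?I \<and> g' \<cdot>\<^bsub>B\<^esub> ?s = ident B ?I \<and> ?s \<cdot>\<^bsub>B\<^esub> g' = ident B (bar ?I)"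
    then have g': "g' \<in> module_hom H (bar ?I) ?I" "g' \<circ>\<^sub>C ?s = ident C ?I" by auto
    have "g' = g' \<circ>\<^sub>C (?s \<circ>\<^sub>C g)"
      using g g' I I' C.comp_ident_right[of "bar ?I" ?I g'] by simp
    also have "\<dots> = (g' \<circ>\<^sub>C ?s) \<circ>\<^sub>C g"
      using g g' I I' star_arr_iso(1) C.comp_assoc[of "bar ?I" ?I "bar ?I" ?I g ?s g'] by simp
    also have "\<dots> = g"
      using g g' I I' C.comp_ident_left[of "bar ?I" ?I g] by simp
    finally show "g' = g" .
  qed (use g in simp_all)
  with g(1) show "star_inv \<in> module_hom H (bar ?I) ?I" by simp
  \<comment> \<open>\<open>star_arr\<close> sends \<open>Scalar (cnj c)\<close> to
    \<open>Scalar c\<close>, so this evaluates g at \<open>Scalar c\<close>.\<close>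
  have "fn g (fn ?s (Scalar (cnj c))) = Scalar (cnj c)"
    using fn_comp[OF star_arr_iso(1), of "Scalar (cnj c)" g] g(2) by simp
  then show "fn star_inv (Scalar c) = Scalar (cnj c)"
    using \<open>star_inv = g\<close> by (simp add: star_arr_eq)
qed

section \<open>The natural isomorphism Upsilon\<close>

context
  fixes V W :: "('a univ, 'a univ) lmod"
  assumes V: "left_module H V" and W: "left_module H W"
begin

interpretation P: module_pair H H V W by (intro module_pair.intro alg V W)
interpretation Q: module_pair H H W V by (intro module_pair.intro alg V W)

abbreviation "twisted_flip t \<equiv> flip V W (outer_act V W \<G> t)"

lemma twisted_flip_additive: "additive_map (tensor V W) (tensor W V) (\<lambda>t. twisted_flip t)"
  by (rule additive_map_compose[OF linear_map_additive[OF P.outer_act_linear] flip_additive]) simp_all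

text \<open>Conjugating source and target together preserves linearity, so the map underlying
  Upsilon is linear on the unconjugated spaces and may be tensored with an identity map
  there.\<close>

lemma twisted_flip_linear: "linear_map (tensor V W) (tensor W V) (\<lambda>t. twisted_flip t)"
  by (rule linear_mapI)
    (simp_all add: P.outer_act_simps linear_map_add[OF flip_linear] linear_map_smult[OF flip_linear]
      linear_map_closed[OF flip_linear])

lemma twisted_flip_pure:
  assumes "v \<in> carrier V" "w \<in> carrier W"
  shows "twisted_flip (pure V W v w) = sweedler (tensor W V) \<G> (\<lambda>g\<^sub>1 g\<^sub>2. pure W V (g\<^sub>2 \<triangleright>\<^bsub>W\<^esub> w) (g\<^sub>1 \<triangleright>\<^bsub>V\<^esub> v))"
proof -
  have "twisted_flip (pure V W v w) = sweedler (tensor W V) \<G>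
      (\<lambda>g\<^sub>1 g\<^sub>2. flip V W (tensor_map V W (act V g\<^sub>1) (act W g\<^sub>2) (pure V W v w)))"
    unfolding outer_act_def
    by (rule additive_sweedler[of H H]) (use assms in \<open>auto
        simp: flip_additive P.act_map_simps P.V.act_closed P.W.act_closed\<close>)
  also have "\<dots> = sweedler (tensor W V) \<G> (\<lambda>g\<^sub>1 g\<^sub>2. pure W V (g\<^sub>2 \<triangleright>\<^bsub>W\<^esub> w) (g\<^sub>1 \<triangleright>\<^bsub>V\<^esub> v))"
    by (rule sweedler_cong[of H H]) (use assms in \<open>auto
        simp: P.act_map_simps flip_pure P.V.act_closed P.W.act_closed\<close>)
  finally show ?thesis .
qed

lemma Upsilon_eq:
  "Upsilon B V W = Arrow (bar (tensor_lmod H V W)) (tensor_lmod H (bar W) (bar V))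
    (\<lambda>t \<in> carrier (bar (tensor_lmod H V W)). twisted_flip t)"
proof -
  have "sweedler (tensor W V) t (\<lambda>v w. sweedler (tensor W V) \<G> (\<lambda>g\<^sub>1 g\<^sub>2. pure W V (g\<^sub>2 \<triangleright>\<^bsub>W\<^esub> w) (g\<^sub>1 \<triangleright>\<^bsub>V\<^esub> v)))
      = twisted_flip t"
    if t: "t \<in> carrier (tensor V W)" for t
  proof -
    have "twisted_flip t = twisted_flip (sweedler (tensor V W) t (pure V W))"
      using t by (simp add: sweedler_pures)
    also have "\<dots> = sweedler (tensor W V) t (\<lambda>v w. twisted_flip (pure V W v w))"
      using t by (intro additive_sweedler[of V W] twisted_flip_additive) auto
    also have "\<dots> = sweedler (tensor W V) t (\<lambda>v w. sweedler (tensor W V) \<G>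
        (\<lambda>g\<^sub>1 g\<^sub>2. pure W V (g\<^sub>2 \<triangleright>\<^bsub>W\<^esub> w) (g\<^sub>1 \<triangleright>\<^bsub>V\<^esub> v)))"
      using t by (intro sweedler_cong[of V W]) (auto simp: twisted_flip_pure)
    finally show ?thesis by simp
  qed
  then show ?thesis
    by (simp add: bar_lmod_category_def monoidal_lmod_def monoidal.defs bar_structure.defs
        cong: restrict_cong)
qed

lemma fn_Upsilon: "t \<in> carrier (tensor V W) \<Longrightarrow> fn (Upsilon B V W) t = twisted_flip t"
  by (simp add: Upsilon_eq)

lemma Upsilon_hom: "Upsilon B V W \<in> module_hom H (bar (tensor_lmod H V W)) (tensor_lmod H (bar W) (bar V))"
  unfolding Upsilon_eq
proof (rule module_homI)
  show "additive_map (bar (tensor_lmod H V W)) (tensor_lmod H (bar W) (bar V)) (\<lambda>t. twisted_flip t)"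
    using twisted_flip_additive by (simp add: additive_map_def)
next
  fix h t assume h: "h \<in> carrier H" and "t \<in> carrier (bar (tensor_lmod H V W))"
  then have t: "t \<in> carrier (tensor V W)" by simp
  have f: "flip V W s \<in> carrier (tensor W V)" if "s \<in> carrier (tensor V W)" for s
    using that by (simp add: additive_map_closed[OF flip_additive])
  have "twisted_flip (outer_act V W (coprod H (dagger h)) t)
      = flip V W (outer_act V W (dagger2 (coprod H h)) (outer_act V W \<G> t))"
    using h t by (simp add: P.outer_act_mult[symmetric] coprod_dagger)
  \<comment> \<open>With the flip outermost, \<open>flip_outer_act\<close> can move it onto the
    modules, leaving the action of \<Delta>h on the conjugates.\<close>
  also have "dagger2 (coprod H h) = flip H H (tensor_map H H dagger dagger (coprod H h))"
    using h by (simp add: flip_tensor_map[OF vs vs vs vs dagger_semilinear dagger_semilinear])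
  also have "flip V W (outer_act V W \<dots> (outer_act V W \<G> t))
      = outer_act W V (tensor_map H H dagger dagger (coprod H h)) (twisted_flip t)"
    using h t by (subst flip_outer_act[OF P.module_pair_axioms])
      (simp_all add: P.outer_act_closed flip_flip additive_map_closed[OF dagger_map_additive])
  also have "\<dots> = outer_act (bar W) (bar V) (coprod H h) (twisted_flip t)"
    using h t by (simp add: outer_act_bar V W f P.outer_act_closed)
  finally show "twisted_flip (h \<triangleright>\<^bsub>bar (tensor_lmod H V W)\<^esub> t)
      = h \<triangleright>\<^bsub>tensor_lmod H (bar W) (bar V)\<^esub> twisted_flip t"
    by simp
qed (simp_all add: V W bar_module tensor_lmod_module)

lemma Upsilon_iso: "Upsilon B V W \<in> Iso C (bar (tensor_lmod H V W)) (tensor_lmod H (bar W) (bar V))"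
  by (rule isoI[OF _ _ Upsilon_hom, of "\<lambda>t. outer_act V W (inv\<^bsub>HH\<^esub> \<G>) (flip W V t)"])
    (use twist_unit in \<open>simp_all add: V W bar_module tensor_lmod_module fn_Upsilon P.outer_act_closed
        flip_flip
      additive_map_closed[OF flip_additive] P.outer_act_mult[symmetric] P.outer_act_one\<close>)

end

lemma fn_tensor_arr':
  assumes "f \<in> module_hom H V V'" "g \<in> module_hom H W W'" "t \<in> carrier (tensor V W)"
  shows "fn (tensor_arr C f g) t = tensor_map V' W' (fn f) (fn g) t"
  using assms(3) by (simp add: tensor_arr_eq[OF assms(1,2)])

lemma bar_comp:
  assumes "f \<in> module_hom H U V" "g \<in> module_hom H V W"
  shows "bar_arr B (g \<circ>\<^sub>C f) = bar_arr B g \<circ>\<^sub>C bar_arr B f"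
  using module_homD[OF assms(1)] module_homD[OF assms(2)]
  by (simp add: bar_arr_eq monoidal_lmod_def)

lemma Upsilon_natural:
  assumes m: "left_module H X" "left_module H X'" "left_module H Y" "left_module H Y'"
    and f: "f \<in> module_hom H X X'" and g: "g \<in> module_hom H Y Y'"
  shows "Upsilon B X' Y' \<circ>\<^sub>C bar_arr B (tensor_arr C f g)
      = tensor_arr C (bar_arr B g) (bar_arr B f) \<circ>\<^sub>C Upsilon B X Y"
proof -
  interpret P: module_pair H H X Y by (intro module_pair.intro alg m)
  interpret P': module_pair H H X' Y' by (intro module_pair.intro alg m)
  note b = bar_module and tl = tensor_lmod_module
  note fg = bar_arr_hom[OF tensor_arr_hom[OF m(1,3,2,4) f g]]
  note gf = tensor_arr_hom[OF b[OF m(3)] b[OF m(1)] b[OF m(4)] b[OF m(2)] bar_arr_hom[OF g]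
      bar_arr_hom[OF f]]
  note u = Upsilon_hom[OF m(1,3)] and u' = Upsilon_hom[OF m(2,4)]
  note f' = module_homD[OF f] and g' = module_homD[OF g]
  show ?thesis
  proof (rule module_hom_eqI[OF comp_hom[OF _ _ _ fg u'] comp_hom[OF _ _ _ u gf]])
    fix t assume "t \<in> carrier (bar (tensor_lmod H X Y))"
    then have t: "t \<in> carrier (tensor X Y)" by simp
    have t': "tensor_map X' Y' (fn f) (fn g) t \<in> carrier (tensor X' Y')"
      using linear_map_closed[OF tensor_map_linear[OF P.vs(3,4) P'.vs(3,4) f'(4) g'(4)] t] .
    have cl: "flip X Y (outer_act X Y \<G> t) \<in> carrier (tensor Y X)"
      using t by (simp add: P.outer_act_closed additive_map_closed[OF flip_additive])
    have "flip X' Y' (outer_act X' Y' \<G> (tensor_map X' Y' (fn f) (fn g) t))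
      = flip X' Y' (tensor_map X' Y' (fn f) (fn g) (outer_act X Y \<G> t))"
      using t f' g' m by (simp add: tensor_map_equivariant)
    also have "\<dots> = tensor_map Y' X' (fn g) (fn f) (flip X Y (outer_act X Y \<G> t))"
      by (rule flip_tensor_map[where \<sigma> = "\<lambda>c. c" and V = X and W = Y])
        (use t f' g' in \<open>simp_all add: P.outer_act_closed linear_semilinear[symmetric]\<close>)
    finally show "fn (Upsilon B X' Y' \<circ>\<^sub>C bar_arr B (tensor_arr C f g)) t
      = fn (tensor_arr C (bar_arr B g) (bar_arr B f) \<circ>\<^sub>C Upsilon B X Y) t"
      using t t' cl m
      by (simp add: fn_comp[OF fg] fn_comp[OF u] fn_tensor_arr'[OF f g] fn_Upsilon
          fn_tensor_arr'[OF bar_arr_hom[OF g] bar_arr_hom[OF f]])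
  qed (simp_all add: m b tl)
qed

section \<open>The unit axioms\<close>

lemma bar_units:
  assumes X: "left_module H X"
  shows "tensor_arr C star_inv (ident C (bar X)) \<circ>\<^sub>C Upsilon B X (unit_lmod H) \<circ>\<^sub>C bar_arr B (lunit C X)
      = runit C (bar X)" (is "?l = _")
    and "tensor_arr C (ident C (bar X)) star_inv \<circ>\<^sub>C Upsilon B (unit_lmod H) X \<circ>\<^sub>C bar_arr B (runit C X)
      = lunit C (bar X)" (is "?r = _")
proof -
  let ?I = "unit_lmod H"
  note I = unit_lmod_module and tl = tensor_lmod_module and b = bar_module
  note X' = b[OF X] and I' = b[OF I]
  interpret X: left_module H X by (rule X)
  interpret I: left_module H ?I by (rule I)
  note i = ident_hom[OF X'] and vsI = X.vec_space I.vec_space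
  note l = bar_arr_hom[OF lunit_hom[OF X]] and r = bar_arr_hom[OF runit_hom[OF X]]
  note sl = tensor_arr_hom[OF I' X' I X' star_inv(1) i] and sr = tensor_arr_hom[OF X' I' X' I i star_inv(1)]
  have ul: "Upsilon B X ?I \<circ>\<^sub>C bar_arr B (lunit C X) \<in> module_hom H (bar X) (tensor_lmod H (bar ?I) (bar X))"
    by (rule comp_hom[OF _ _ _ l Upsilon_hom[OF X I]]) (simp_all add: X I tl b)
  have ur: "Upsilon B ?I X \<circ>\<^sub>C bar_arr B (runit C X) \<in> module_hom H (bar X) (tensor_lmod H (bar X) (bar ?I))"
    by (rule comp_hom[OF _ _ _ r Upsilon_hom[OF I X]]) (simp_all add: X I tl b)
  have fl: "fn (Upsilon B X ?I \<circ>\<^sub>C bar_arr B (lunit C X)) x = pure (bar ?I) (bar X) (Scalar 1) x"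
    and fr: "fn (Upsilon B ?I X \<circ>\<^sub>C bar_arr B (runit C X)) x = pure (bar X) (bar ?I) x (Scalar 1)"
    if "x \<in> carrier X" for x
    using that X I vsI
    by (simp_all add: fn_comp[OF l] fn_comp[OF r] fn_lunit fn_runit fn_Upsilon outer_act_unit_left
        outer_act_unit_right
        twist_counit twist_counit_right X.act_one flip_pure)
  \<comment> \<open>The evaluation rule for the tensor arrow is stated with both bars present, and
    \<open>star_inv\<close> removes only one of them; hence the rewrite that erases bars in pairs is
    switched off.\<close>
  show "?l = runit C (bar X)"
    by (rule module_hom_eqI[OF comp_hom[OF _ _ _ ul sl] runit_hom[OF X']])
      (use X I in \<open>simp_all add: tl b fl fn_comp[OF ul] fn_runit
          fn_tensor_arr[OF I' X' I X' star_inv(1) i] star_inv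
        del: tensor_bar(1)\<close>)
  show "?r = lunit C (bar X)"
    by (rule module_hom_eqI[OF comp_hom[OF _ _ _ ur sr] lunit_hom[OF X']])
      (use X I in \<open>simp_all add: tl b fr fn_comp[OF ur] fn_lunit
          fn_tensor_arr[OF X' I' X' I i star_inv(1)] star_inv
        del: tensor_bar(1)\<close>)
qed

section \<open>The associativity axiom\<close>

context
  fixes X Y Z :: "('a univ, 'a univ) lmod"
  assumes m: "left_module H X" "left_module H Y" "left_module H Z"
begin

interpretation XY: module_pair H H X Y by (intro module_pair.intro alg m)
interpretation YZ: module_pair H H Y Z by (intro module_pair.intro alg m)
interpretation XY_Z: module_pair HH H "outer X Y" Z
  by (intro module_pair.intro alg XY.outer_module HH.complex_algebra_axioms m)
interpretation X_YZ: module_pair H HH X "outer Y Z"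
  by (intro module_pair.intro alg YZ.outer_module HH.complex_algebra_axioms m)

text \<open>Two routes from a triple tensor to its reversal, by swapping either Z or X past the
  other two factors first. With the twists split off, they are what remains of the two sides of the
  axiom.\<close>

abbreviation (input) "rev_left t \<equiv> tensor_map Z (tensor Y X) (\<lambda>z. z) (flip X Y) (flip (tensor X Y) Z t)"
abbreviation (input) "rev_right t \<equiv> reassoc Z Y X
    (tensor_map (tensor Z Y) X (flip Y Z) (\<lambda>x. x) (flip X (tensor Y Z) t))"

text \<open>The inner twist acts on X and Y only, so it can be applied before the reversal as \<G>
  \<otimes> 1. All twisting is thereby gathered in one element acting on the unreversed
  tensor.\<close>

lemma twisted_rev_left:
  assumes t: "t \<in> carrier (tensor (tensor X Y) Z)"
  shows "tensor_map Z (tensor Y X) (\<lambda>z. z) (\<lambda>r. flip X Y (outer_act X Y \<G> r)) (flip (tensor X Y) Z t)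
    = rev_left (outer_act (outer X Y) Z (pure HH H \<G> \<one>) t)"
proof -
  note vss = vec_space_tensor[OF XY.vs(3,4)] YZ.vs(4)
  note vss' = vss(2,1) YZ.vs(4) vec_space_tensor[OF XY.vs(4,3)]
  note f = flip_pure[OF vss] additive_map_add[OF flip_additive[OF vss]]
      additive_map_closed[OF flip_additive[OF vss]]
  note l1 = vss' linear_map_id[of Z] twisted_flip_linear[OF m(1,2)]
  note l2 = vss' linear_map_id[of Z] flip_linear[OF XY.vs(3,4)]
  note simps = f tensor_map_pure[OF l1] additive_map_add[OF tensor_map_additive[OF l1]]
    tensor_map_pure[OF l2] additive_map_add[OF tensor_map_additive[OF l2]] XY_Z.outer_act_simps[simplified]
  from vss t show ?thesis
    by (induct rule: tensor_induct)
      (simp_all add: simps YZ.W.act_one XY.outer_act_closed)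
qed

lemma twisted_rev_right:
  assumes t: "t \<in> carrier (tensor X (tensor Y Z))"
  shows "tensor_map (tensor Z Y) X (\<lambda>r. flip Y Z (outer_act Y Z \<G> r)) (\<lambda>x. x) (flip X (tensor Y Z) t)
    = tensor_map (tensor Z Y) X (flip Y Z) (\<lambda>x. x)
        (flip X (tensor Y Z) (outer_act X (outer Y Z) (pure H HH \<one> \<G>) t))"
proof -
  note vss = XY.vs(3) vec_space_tensor[OF YZ.vs(3,4)]
  note vss' = vss(2,1) vec_space_tensor[OF YZ.vs(4,3)] XY.vs(3)
  note f = flip_pure[OF vss] additive_map_add[OF flip_additive[OF vss]]
      additive_map_closed[OF flip_additive[OF vss]]
  note l1 = vss' twisted_flip_linear[OF m(2,3)] linear_map_id[of X]
  note l2 = vss' flip_linear[OF YZ.vs(3,4)] linear_map_id[of X]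
  note simps = f tensor_map_pure[OF l1] additive_map_add[OF tensor_map_additive[OF l1]]
    tensor_map_pure[OF l2] additive_map_add[OF tensor_map_additive[OF l2]] X_YZ.outer_act_simps[simplified]
  from vss t show ?thesis
    by (induct rule: tensor_induct)
      (simp_all add: simps XY.V.act_one YZ.outer_act_closed)
qed

lemma rev_left_eq_rev_right:
  assumes t: "t \<in> carrier (tensor (tensor X Y) Z)"
  shows "rev_left t = rev_right (reassoc X Y Z t)"
proof -
  note v = XY.vs(3,4) YZ.vs(4)
  note vXY = vec_space_tensor[OF v(1,2)] and vYZ = vec_space_tensor[OF v(2,3)]
    and vYX = vec_space_tensor[OF v(2,1)] and vZY = vec_space_tensor[OF v(3,2)]
  note l1 = v(3) vXY v(3) vYX linear_map_id[of Z] flip_linear[OF v(1,2)]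
  note l2 = vYZ v(1) vZY v(1) flip_linear[OF v(2,3)] linear_map_id[of X]
  note maps = flip_additive[OF vXY v(3)] flip_additive[OF v(1) vYZ] tensor_map_additive[OF l1]
      tensor_map_additive[OF l2]
    reassoc_additive[OF v] reassoc_additive[OF v(3,2,1)]
  note simps = maps[THEN additive_map_add] maps[THEN additive_map_closed]
    flip_pure[OF vXY v(3)] flip_pure[OF v(1) vYZ] flip_pure[OF v(1,2)] flip_pure[OF v(2,3)]
    tensor_map_pure[OF l1] tensor_map_pure[OF l2] reassoc_pure[OF v] reassoc_pure[OF v(3,2,1)]
  from v t show ?thesis
    by (induct rule: tensor3_induct) (use v in \<open>simp_all add: simps\<close>)
qed

lemma bar_assoc:
  "assoc C (bar Z) (bar Y) (bar X) \<circ>\<^sub>C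
      tensor_arr C (Upsilon B Y Z) (ident C (bar X)) \<circ>\<^sub>C
      Upsilon B X (tensor_lmod H Y Z) \<circ>\<^sub>C bar_arr B (assoc C X Y Z)
    = tensor_arr C (ident C (bar Z)) (Upsilon B X Y) \<circ>\<^sub>C Upsilon B (tensor_lmod H X Y) Z"
    (is "?a \<circ>\<^sub>C ?t \<circ>\<^sub>C ?u \<circ>\<^sub>C ?b = ?t' \<circ>\<^sub>C ?u'")
proof -
  note tl = tensor_lmod_module and bm = bar_module
  note X' = bm[OF m(1)] and Y' = bm[OF m(2)] and Z' = bm[OF m(3)]
  note v = XY.vs(3,4) YZ.vs(4)
  note b = bar_arr_hom[OF assoc_hom[OF m]] and u = Upsilon_hom[OF m(1) tl[OF m(2,3)]]
    and t = tensor_arr_hom[OF bm[OF tl[OF m(2,3)]] X' tl[OF Z' Y'] X' Upsilon_hom[OF m(2,3)]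
        ident_hom[OF X']]
    and a = assoc_hom[OF Z' Y' X'] and u' = Upsilon_hom[OF tl[OF m(1,2)] m(3)]
    and t' = tensor_arr_hom[OF Z' bm[OF tl[OF m(1,2)]] Z' tl[OF Y' X'] ident_hom[OF Z']
        Upsilon_hom[OF m(1,2)]]
  have ub: "?u \<circ>\<^sub>C ?b \<in> module_hom H (bar (tensor_lmod H (tensor_lmod H X Y) Z))
      (tensor_lmod H (bar (tensor_lmod H Y Z)) (bar X))"
    by (rule comp_hom[OF _ _ _ b u]) (simp_all add: tl bm m)
  have tub: "?t \<circ>\<^sub>C ?u \<circ>\<^sub>C ?b \<in> module_hom H (bar (tensor_lmod H (tensor_lmod H X Y) Z))
      (tensor_lmod H (tensor_lmod H (bar Z) (bar Y)) (bar X))"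
    by (rule comp_hom[OF _ _ _ ub t]) (simp_all add: tl bm m)
  show ?thesis
  proof (rule module_hom_eqI[OF comp_hom[OF _ _ _ tub a] comp_hom[OF _ _ _ u' t']])
    fix s assume "s \<in> carrier (bar (tensor_lmod H (tensor_lmod H X Y) Z))"
    then have s: "s \<in> carrier (tensor (tensor X Y) Z)" by simp
    define r where "r = reassoc X Y Z s"
    have r: "r \<in> carrier (tensor X (tensor Y Z))"
      unfolding r_def by (rule additive_map_closed[OF reassoc_additive[OF v] s])
    note cR = coprod_right_simps(2)[OF twist_closed(1)] and cL = coprod_left_simps(2)[OF twist_closed(1)]
    have p: "pure H HH \<one> \<G> \<in> carrier (tensor H HH)" "pure HH H \<G> \<one> \<in> carrier (tensor HH H)" by simp_all
    have G_r: "outer_act X (tensor_lmod H Y Z) \<G> r \<in> carrier (tensor X (tensor Y Z))"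
      using r cR X_YZ.outer_act_closed by (simp add: act_coprod_right[OF m])
    have G_s: "outer_act (tensor_lmod H X Y) Z \<G> s \<in> carrier (tensor (tensor X Y) Z)"
      using s cL XY_Z.outer_act_closed by (simp add: act_coprod_left[OF m])
    have fl: "flip X (tensor Y Z) q \<in> carrier (tensor (tensor Y Z) X)" if "q \<in> carrier
        (tensor X (tensor Y Z))" for q
      using that v by (simp add: additive_map_closed[OF flip_additive])
    have fl': "flip (tensor X Y) Z q \<in> carrier (tensor Z (tensor X Y))" if "q \<in> carrier
        (tensor (tensor X Y) Z)" for q
      using that v by (simp add: additive_map_closed[OF flip_additive])
    let ?q = "flip X (tensor Y Z) (outer_act X (tensor_lmod H Y Z) \<G> r)"
    let ?q' = "flip (tensor X Y) Z (outer_act (tensor_lmod H X Y) Z \<G> s)"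
    have "fn (?u \<circ>\<^sub>C ?b) s = ?q"
    proof -
      have "fn (assoc C X Y Z) s = r" using s by (simp add: assoc_eq[OF m] r_def)
      with s r show ?thesis by (simp add: fn_comp[OF b] fn_Upsilon m tl)
    qed
    then have "fn (?t \<circ>\<^sub>C ?u \<circ>\<^sub>C ?b) s
      = tensor_map (tensor Z Y) X (fn (Upsilon B Y Z)) (fn (ident C (bar X))) ?q"
      using s fl[OF G_r] by (simp add: fn_comp[OF ub]
          fn_tensor_arr'[OF Upsilon_hom[OF m(2,3)] ident_hom[OF X']])
    also have "\<dots> = tensor_map (tensor Z Y) X (\<lambda>r. flip Y Z (outer_act Y Z \<G> r)) (\<lambda>x. x) ?q"
      by (rule tensor_map_cong[of "tensor Y Z" X]) (use v fl[OF G_r] in \<open>simp_all add: fn_Upsilon m\<close>)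
    also have "\<dots> = tensor_map (tensor Z Y) X (flip Y Z) (\<lambda>x. x) (flip X (tensor Y Z)
        (outer_act X (outer Y Z) (pure H HH \<one> \<G>) (outer_act X (outer Y Z) (coprod_right \<G>) r)))"
      using twisted_rev_right[OF G_r] r by (simp add: act_coprod_right[OF m])
    finally have L: "fn (?t \<circ>\<^sub>C ?u \<circ>\<^sub>C ?b) s = \<dots>" .
    have "tensor_map (tensor Z Y) X (flip Y Z) (\<lambda>x. x) (flip X (tensor Y Z) q) \<in> carrier
        (tensor (tensor Z Y) X)"
      if "q \<in> carrier (tensor X (tensor Y Z))" for q
      by (rule additive_map_closed[OF tensor_map_additive fl[OF that]])
          (use v in \<open>simp_all add: flip_linear linear_map_id\<close>)
    with L r p cR have "fn (?a \<circ>\<^sub>C ?t \<circ>\<^sub>C ?u \<circ>\<^sub>C ?b) s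
      = rev_right (outer_act X (outer Y Z) (pure H HH \<one> \<G> \<otimes>\<^bsub>tensor H HH\<^esub> coprod_right \<G>) r)"
      using s X_YZ.outer_act_closed X_YZ.outer_act_mult by (simp add: fn_comp[OF tub] assoc_eq[OF Z' Y' X'])
    \<comment> \<open>The cocycle identity, carried from H to the modules by
      \<open>reassoc_act\<close>.\<close>
    also have "\<dots> = rev_right (reassoc X Y Z (outer_act (outer X Y) Z
        (pure HH H \<G> \<one> \<otimes>\<^bsub>tensor HH H\<^esub> coprod_left \<G>) s))"
      using s p cL by (subst reassoc_act[OF m]) (simp_all add: twist_cocycle r_def XY_Z.tensor.m_closed)
    \<comment> \<open>The two pure reversals agree, and the acting product is split back into the
      inner and the outer twist.\<close>
    also have "\<dots> = rev_left (outer_act (outer X Y) Z (pure HH H \<G> \<one>)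
        (outer_act (outer X Y) Z (coprod_left \<G>) s))"
      using s p cL XY_Z.outer_act_closed XY_Z.outer_act_mult
          by (subst rev_left_eq_rev_right[symmetric]) simp_all
    also have "\<dots> = tensor_map Z (tensor Y X) (\<lambda>z. z) (\<lambda>r. flip X Y (outer_act X Y \<G> r)) ?q'"
      using twisted_rev_left[OF G_s] s by (simp add: act_coprod_left[OF m])
    also have "\<dots> = tensor_map Z (tensor Y X) (fn (ident C (bar Z))) (fn (Upsilon B X Y)) ?q'"
      by (rule tensor_map_cong[of Z "tensor X Y"]) (use v fl'[OF G_s] in \<open>simp_all add: fn_Upsilon m\<close>)
    also have "\<dots> = fn (?t' \<circ>\<^sub>C ?u') s"
      using s fl'[OF G_s]
      by (simp add: fn_comp[OF u'] fn_Upsilon m tl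
          fn_tensor_arr'[OF ident_hom[OF Z'] Upsilon_hom[OF m(1,2)]])
    finally show "fn (?a \<circ>\<^sub>C ?t \<circ>\<^sub>C ?u \<circ>\<^sub>C ?b) s = fn (?t' \<circ>\<^sub>C ?u') s" .
  qed (simp_all add: tl bm m)
qed

end

section \<open>The axioms of a bar category assembled\<close>

lemma bar_category_lmod:
  assumes eps: "counit H \<gamma> = 1"
  shows "bar_category B"
proof (rule bar_category.intro)
  show "monoidal_category B"
    unfolding bar_lmod_category_def monoidal_category_extend by (rule monoidal_category_lmod)
  have inv: "inverse_arrow B (unit_obj B) (bar_obj B (unit_obj B)) (star_arr B) = star_inv"
    by (simp add: star_inv_def)
  show "bar_category_axioms B"
  proof (rule bar_category_axioms.intro, unfold inv)
    fix X Y assume "X \<in> Obj B" "Y \<in> Obj B"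
    then have m: "left_module H X" "left_module H Y" by auto
    note b = bar_module
    show "bar_arr B (ident B X) = ident B (bar_obj B X)"
      using module_homD[OF ident_hom[OF m(1)]] by (simp add: bar_arr_eq monoidal_lmod_def)
    fix X' f assume "X' \<in> Obj B" "f \<in> Hom B X X'"
    then have X': "left_module H X'" and f: "f \<in> module_hom H X X'" by auto
    show "bb B X' \<cdot>\<^bsub>B\<^esub> f = bar_arr B (bar_arr B f) \<cdot>\<^bsub>B\<^esub> bb B X"
      by (simp, rule module_hom_eqI[OF comp_hom[OF m(1) X' _ f bb_hom[OF X']]
            comp_hom[OF m(1) _ _ bb_hom[OF m(1)] bar_arr_hom[OF bar_arr_hom[OF f]]]])
        (use m X' module_homD[OF f] in \<open>simp_all add: b fn_comp[OF f] fn_comp[OF bb_hom[OF m(1)]],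
          simp add: bb_eq\<close>)
  next
    note I = unit_lmod_module
    \<comment> \<open>Conjugating twice returns c, while bb at the unit object multiplies by
      \<epsilon>(\<gamma>); this is where \<open>eps\<close> enters.\<close>
    show "bar_arr B (star_arr B) \<cdot>\<^bsub>B\<^esub> star_arr B = bb B (unit_obj B)"
      by (simp, rule module_hom_eqI[OF comp_hom[OF I _ _ star_arr_iso(1)
          bar_arr_hom[OF star_arr_iso(1)]] bb_hom[OF I]])
        (auto simp: bar_module I fn_comp[OF star_arr_iso(1)] fn_star_arr bb_eq eps)
  next
    fix X assume "X \<in> Obj B"
    \<comment> \<open>On \<open>bar X\<close> the element \<gamma> acts as
      \<open>dagger \<gamma>\<close> on X, and \<gamma> is fixed by \<open>dagger\<close>.\<close>
    then show "bar_arr B (bb B X) = bb B (bar_obj B X)"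
      by (simp add: bar_arr_eq bb_eq dagger_gam cong: restrict_cong)
  qed (auto simp: bar_module bar_arr_hom bar_comp bb_iso star_arr_iso Upsilon_iso Upsilon_natural
      bar_units bar_assoc)
qed

end

section \<open>The coboundary map\<close>

context quasi_star_hopf_algebra
begin

definition coboundary_elt :: "'a univ" where
  "coboundary_elt = pure H H (inv \<gamma>) (inv \<gamma>) \<bullet> dagger2 \<G> \<bullet> \<G> \<bullet> coprod H \<gamma>"

lemma coboundary_elt_closed [simp]: "coboundary_elt \<in> carrier HH"
  by (simp add: coboundary_elt_def)

lemma gam_inv_mult:
  "pure H H (inv \<gamma>) (inv \<gamma>) \<bullet> pure H H \<gamma> \<gamma> = \<one>\<^bsub>HH\<^esub>"
  "pure H H \<gamma> \<gamma> \<bullet> pure H H (inv \<gamma>) (inv \<gamma>) = \<one>\<^bsub>HH\<^esub>"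
  "coprod H \<gamma> \<bullet> coprod H (inv \<gamma>) = \<one>\<^bsub>HH\<^esub>"
  "coprod H (inv \<gamma>) \<bullet> coprod H \<gamma> = \<one>\<^bsub>HH\<^esub>"
  using gam_unit by (simp_all add: tensor_simps coprod_mult[symmetric] coprod_one[unfolded tensor_simps])

text \<open>Multiplication by \<gamma> \<otimes> \<gamma> on the left and by the coproduct of
  \<gamma>\<inverse> on the right is invertible and moves the outer factors across.\<close>

lemma coboundary_elt_eq_one_iff:
  "coboundary_elt = \<one>\<^bsub>HH\<^esub> \<longleftrightarrow> pure H H \<gamma> \<gamma> \<bullet> coprod H (inv \<gamma>) = dagger2 \<G> \<bullet> \<G>"
proof -
  let ?p = "pure H H \<gamma> \<gamma>" and ?p' = "pure H H (inv \<gamma>) (inv \<gamma>)" and ?k = "dagger2 \<G> \<bullet> \<G>"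
  have e: "coboundary_elt = ?p' \<bullet> ?k \<bullet> coprod H \<gamma>"
    by (simp add: coboundary_elt_def HH.m_assoc)
  have "?p \<bullet> coboundary_elt \<bullet> coprod H (inv \<gamma>) = (?p \<bullet> ?p') \<bullet> ?k \<bullet> (coprod H \<gamma> \<bullet> coprod H (inv \<gamma>))"
    by (simp add: e HH.m_assoc)
  moreover have "?p' \<bullet> (?p \<bullet> coprod H (inv \<gamma>)) \<bullet> coprod H \<gamma> = (?p' \<bullet> ?p) \<bullet> (coprod H (inv \<gamma>) \<bullet> coprod H \<gamma>)"
    by (simp add: HH.m_assoc)
  ultimately show ?thesis by (auto simp: e gam_inv_mult)
qed

lemma strong_iff: "strong_quasi_star_hopf_algebra H \<longleftrightarrow> coboundary_elt = \<one>\<^bsub>HH\<^esub>"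
  unfolding coboundary_elt_eq_one_iff strong_quasi_star_hopf_algebra_def
      strong_quasi_star_hopf_algebra_axioms_def
  by (simp add: quasi_star_hopf_algebra_axioms star_antipode_map)

context
  fixes V W :: "('a univ, 'a univ) lmod"
  assumes V: "left_module H V" and W: "left_module H W"
begin

interpretation P: module_pair H H V W by (intro module_pair.intro alg V W)
interpretation Q: module_pair H H W V by (intro module_pair.intro alg V W)

text \<open>The coboundary map is given by definite description. Since bb \<otimes> bb is the action
  of the unit \<gamma> \<otimes> \<gamma>, it is an isomorphism and the defining equation has
  exactly one solution.\<close>

lemma coboundary_hom_act:
  "coboundary B V W \<in> module_hom H (tensor_lmod H V W) (tensor_lmod H V W)"
  "t \<in> carrier (tensor V W) \<Longrightarrow> fn (coboundary B V W) t = outer_act V W coboundary_elt t"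
proof -
  interpret C: category C by (rule category_lmod)
  note tl = tensor_lmod_module and bm = bar_module
  let ?VW = "tensor_lmod H V W" and ?V'W' = "tensor_lmod H (bar (bar V)) (bar (bar W))"
  let ?bb = "tensor_arr C (bb B V) (bb B W)"
  let ?r = "Upsilon B (bar W) (bar V) \<circ>\<^sub>C bar_arr B (Upsilon B V W) \<circ>\<^sub>C bb B ?VW"
  let ?p = "pure H H \<gamma> \<gamma>" and ?p' = "pure H H (inv \<gamma>) (inv \<gamma>)"
  have VW: "left_module H ?VW" and V'W': "left_module H ?V'W'" by (simp_all add: tl bm V W)
  note h1 = bb_hom[OF VW] and h2 = bar_arr_hom[OF Upsilon_hom[OF V W]] and h3
      = Upsilon_hom[OF bm[OF W] bm[OF V]]
  have h12: "bar_arr B (Upsilon B V W) \<circ>\<^sub>C bb B ?VW \<in> module_hom H ?VW (bar (tensor_lmod H (bar W) (bar V)))"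
    by (rule comp_hom[OF _ _ _ h1 h2]) (simp_all add: tl bm V W)
  have r: "?r \<in> module_hom H ?VW ?V'W'"
    by (rule comp_hom[OF _ _ _ h12 h3]) (simp_all add: tl bm V W)
  have bb: "?bb \<in> module_hom H ?VW ?V'W'"
    by (rule tensor_arr_hom[OF V W _ _ bb_hom[OF V] bb_hom[OF W]]) (simp_all add: bm V W)
  have fn_bb: "fn ?bb t = outer_act V W ?p t" if t: "t \<in> carrier (tensor V W)" for t
  proof -
    have "fn ?bb t = tensor_map V W (fn (bb B V)) (fn (bb B W)) t"
      using t by (simp add: fn_tensor_arr'[OF bb_hom[OF V] bb_hom[OF W]])
    also have "\<dots> = tensor_map V W (act V \<gamma>) (act W \<gamma>) t"
      by (rule tensor_map_cong[of V W]) (use t in \<open>simp_all add: fn_bb_arr\<close>)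
    finally show ?thesis using t by (simp add: P.outer_act_pure_left)
  qed
  have cancel: "outer_act V W ?p (outer_act V W ?p' t) = t" "outer_act V W ?p' (outer_act V W ?p t) = t"
    if "t \<in> carrier (tensor V W)" for t
    using that by (simp_all add: P.outer_act_mult[symmetric] gam_inv_mult P.outer_act_one)
  have "?bb \<in> Iso C ?VW ?V'W'"
    by (rule isoI[OF VW V'W' bb, of "outer_act V W ?p'"]) (simp_all add: fn_bb cancel P.outer_act_closed)
  then obtain g where g: "g \<in> module_hom H ?V'W' ?VW" "g \<circ>\<^sub>C ?bb = ident C ?VW" "?bb \<circ>\<^sub>C g = ident C ?V'W'"
    by (auto simp: Iso_def)
  let ?f = "g \<circ>\<^sub>C ?r"
  have f: "?f \<in> module_hom H ?VW ?VW" by (rule comp_hom[OF VW V'W' VW r g(1)])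
  have bb_f: "?bb \<circ>\<^sub>C ?f = ?r"
    using C.comp_assoc[of ?VW ?V'W' ?VW ?V'W' ?r g ?bb] C.comp_ident_left[of ?VW ?V'W' ?r] VW V'W' r g
        bb by simp
  \<comment> \<open>g is the inverse of bb \<otimes> bb, so existence and uniqueness of the solution
    follow by composing with it.\<close>
  have cob: "coboundary B V W = ?f"
    unfolding coboundary_def
  proof (rule the_equality)
    show "?f \<in> Hom B (V \<boxtimes>\<^bsub>B\<^esub> W) (V \<boxtimes>\<^bsub>B\<^esub> W) \<and> (bb B V \<boxdot>\<^bsub>B\<^esub> bb B W) \<cdot>\<^bsub>B\<^esub> ?f =
        Upsilon B (bar_obj B W) (bar_obj B V) \<cdot>\<^bsub>B\<^esub> bar_arr B (Upsilon B V W) \<cdot>\<^bsub>B\<^esub> bb B (V \<boxtimes>\<^bsub>B\<^esub> W)"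
      using f bb_f by simp
    fix f' assume "f' \<in> Hom B (V \<boxtimes>\<^bsub>B\<^esub> W) (V \<boxtimes>\<^bsub>B\<^esub> W) \<and> (bb B V \<boxdot>\<^bsub>B\<^esub> bb B W) \<cdot>\<^bsub>B\<^esub> f' =
        Upsilon B (bar_obj B W) (bar_obj B V) \<cdot>\<^bsub>B\<^esub> bar_arr B (Upsilon B V W) \<cdot>\<^bsub>B\<^esub> bb B (V \<boxtimes>\<^bsub>B\<^esub> W)"
    then have f': "f' \<in> module_hom H ?VW ?VW" "?bb \<circ>\<^sub>C f' = ?r" by simp_all
    show "f' = ?f"
      using C.comp_assoc[of ?VW ?VW ?V'W' ?VW f' ?bb g] C.comp_ident_left[of ?VW ?VW f'] VW V'W' f' g bb
          by simp
  qed
  with f show "coboundary B V W \<in> module_hom H ?VW ?VW" by simp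
  show "fn (coboundary B V W) t = outer_act V W coboundary_elt t" if t: "t \<in> carrier (tensor V W)"
  proof -
    let ?t1 = "outer_act V W (coprod H \<gamma>) t"
    let ?t2 = "outer_act V W \<G> ?t1"
    have cl: "?t1 \<in> carrier (tensor V W)" "?t2 \<in> carrier (tensor V W)" using t
        by (simp_all add: P.outer_act_closed)
    have cl': "flip V W ?t2 \<in> carrier (tensor W V)"
      using cl by (simp add: additive_map_closed[OF flip_additive])
    \<comment> \<open>The second Upsilon lives on the conjugates of W and V, where the twist acts
      through \<open>dagger\<close> on both legs.\<close>
    have "fn ?r t = flip W V (outer_act W V (tensor_map H H dagger dagger \<G>) (flip V W ?t2))"
      using t cl cl' by (simp add: fn_comp[OF h12] fn_comp[OF h1] fn_bb_arr fn_Upsilon V W bm outer_act_bar)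
    also have "\<dots> = outer_act V W (flip H H (tensor_map H H dagger dagger \<G>)) ?t2"
      using cl cl' by (subst flip_outer_act[OF Q.module_pair_axioms])
        (simp_all add: flip_flip additive_map_closed[OF dagger_map_additive])
    also have "flip H H (tensor_map H H dagger dagger \<G>) = dagger2 \<G>"
      by (simp add: flip_tensor_map[OF vs vs vs vs dagger_semilinear dagger_semilinear])
    finally have r_t: "fn ?r t = outer_act V W (dagger2 \<G>) ?t2" .
    have f_t: "fn ?f t \<in> carrier (tensor V W)" using module_homD(6)[OF f, of t] t by simp
    have "fn ?f t = outer_act V W ?p' (outer_act V W ?p (fn ?f t))"
      using f_t by (simp add: cancel)
    also have "outer_act V W ?p (fn ?f t) = fn ?r t"
      using fn_comp[OF f, of t ?bb] t bb_f fn_bb[OF f_t] by simp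
    also have "outer_act V W ?p' (fn ?r t) = outer_act V W coboundary_elt t"
      using t cl by (simp add: r_t coboundary_elt_def P.outer_act_mult P.outer_act_closed)
    finally show ?thesis using cob by simp
  qed
qed

text \<open>The action is additive separately in \<G>, in the copy of \<G> under
  \<open>dagger2\<close>, and in the coproduct of \<gamma>, so the three are expanded one inside the
  other. The flip in \<open>dagger2\<close> interchanges the legs of the inner copy.\<close>

lemma outer_act_coboundary_elt:
  assumes v: "v \<in> carrier V" and w: "w \<in> carrier W"
  shows "outer_act V W coboundary_elt (pure V W v w) =
    sweedler (tensor V W) \<G> (\<lambda>g\<^sub>1 g\<^sub>2. sweedler (tensor V W) \<G> (\<lambda>g\<^sub>1' g\<^sub>2'.
      sweedler (tensor V W) (coprod H \<gamma>) (\<lambda>\<gamma>\<^sub>1 \<gamma>\<^sub>2. pure V W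
        ((inv \<gamma> \<otimes> dagger g\<^sub>2' \<otimes> g\<^sub>1 \<otimes> \<gamma>\<^sub>1) \<triangleright>\<^bsub>V\<^esub> v)
        ((inv \<gamma> \<otimes> dagger g\<^sub>1' \<otimes> g\<^sub>2 \<otimes> \<gamma>\<^sub>2) \<triangleright>\<^bsub>W\<^esub> w))))"
proof -
  let ?T = "tensor V W" and ?p' = "pure H H (inv \<gamma>) (inv \<gamma>)"
  let ?A = "\<lambda>a. outer_act V W a (pure V W v w)"
  let ?s = "\<lambda>x y a b. sweedler ?T (coprod H \<gamma>) (\<lambda>c d. pure V W
    ((inv \<gamma> \<otimes> dagger b \<otimes> x \<otimes> c) \<triangleright>\<^bsub>V\<^esub> v) ((inv \<gamma> \<otimes> dagger a \<otimes> y \<otimes> d) \<triangleright>\<^bsub>W\<^esub> w))"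
  \<comment> \<open>An additive function of a tensor is the Sweedler sum of its values on pure
    tensors.\<close>
  have expand: "\<phi> a = sweedler ?T a (\<lambda>x y. \<phi> (pure H H x y))" if "additive_map HH ?T \<phi>" "a \<in> carrier HH"
      for \<phi> a
    using additive_sweedler[OF vs vs, of HH ?T \<phi> "pure H H" a] that by (simp add: sweedler_pures)
  note add_simps = P.outer_act_simps HH.l_distr HH.r_distr dagger2_add
  have "?A coboundary_elt = sweedler ?T \<G> (\<lambda>x y. ?A (?p' \<bullet> dagger2 \<G> \<bullet> pure H H x y \<bullet> coprod H \<gamma>))"
    unfolding coboundary_elt_def
    by (rule expand) (auto intro!: additive_mapI simp: add_simps v w)
  also have "\<dots> = sweedler ?T \<G> (\<lambda>x y. sweedler ?T \<G> (?s x y))"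
  proof (rule sweedler_cong[OF vs vs])
    fix x y assume xy: "x \<in> carrier H" "y \<in> carrier H"
    have "?A (?p' \<bullet> dagger2 \<G> \<bullet> pure H H x y \<bullet> coprod H \<gamma>)
      = sweedler ?T \<G> (\<lambda>a b. ?A (?p' \<bullet> dagger2 (pure H H a b) \<bullet> pure H H x y \<bullet> coprod H \<gamma>))"
      by (rule expand[where \<phi> = "\<lambda>t. ?A (?p' \<bullet> dagger2 t \<bullet> pure H H x y \<bullet> coprod H \<gamma>)"])
        (use xy in \<open>auto intro!: additive_mapI simp: add_simps v w\<close>)
    also have "\<dots> = sweedler ?T \<G> (?s x y)"
    proof (rule sweedler_cong[OF vs vs])
      fix a b assume ab: "a \<in> carrier H" "b \<in> carrier H"
      have "?A (?p' \<bullet> dagger2 (pure H H a b) \<bullet> pure H H x y \<bullet> coprod H \<gamma>)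
        = sweedler ?T (coprod H \<gamma>) (\<lambda>c d. ?A (?p' \<bullet> dagger2 (pure H H a b) \<bullet> pure H H x y \<bullet> pure H H c d))"
        by (rule expand[where \<phi> = "\<lambda>t. ?A (?p' \<bullet> dagger2 (pure H H a b) \<bullet> pure H H x y \<bullet> t)"])
          (use xy ab in \<open>auto intro!: additive_mapI simp: add_simps v w\<close>)
      also have "\<dots> = ?s x y a b"
        by (rule sweedler_cong[OF vs vs]) (use xy ab v w
            in \<open>simp_all add: dagger2_pure tensor_simps P.outer_act_pure\<close>)
      finally show "?A (?p' \<bullet> dagger2 (pure H H a b) \<bullet> pure H H x y \<bullet> coprod H \<gamma>)
        = ?s x y a b" .
    qed simp
    finally show "?A (?p' \<bullet> dagger2 \<G> \<bullet> pure H H x y \<bullet> coprod H \<gamma>)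
      = sweedler ?T \<G> (?s x y)" .
  qed simp
  finally show ?thesis .
qed

end

section \<open>The counit of the coboundary element and the strong condition\<close>

definition counit2 :: "'a univ \<Rightarrow> complex" where
  "counit2 t = counit H (sweedler H t (\<lambda>x y. counit H x \<odot> y))"

lemma counit2_simps:
  "\<lbrakk>x \<in> carrier H; y \<in> carrier H\<rbrakk> \<Longrightarrow> counit2 (pure H H x y) = counit H x * counit H y"
  "\<lbrakk>s \<in> carrier HH; t \<in> carrier HH\<rbrakk> \<Longrightarrow> counit2 (s \<oplus>\<^bsub>HH\<^esub> t) = counit2 s + counit2 t"
  "h \<in> carrier H \<Longrightarrow> counit2 (coprod H h) = counit H h"
  "counit2 \<G> = 1"
  by (simp_all add: counit2_def sweedler_counit_simps counit_smult counit_add counit_left twist_counit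
      counit_one)

text \<open>The map \<epsilon> \<otimes> \<epsilon> is a character of H \<otimes> H; it is encoded
  as \<epsilon> after \<epsilon> \<otimes> id so that the Sweedler sum has values in H.\<close>

lemma counit2_mult:
  assumes s: "s \<in> carrier HH" and t: "t \<in> carrier HH"
  shows "counit2 (s \<bullet> t) = counit2 s * counit2 t"
  using vs vs s
proof (induct rule: tensor_induct)
  case s: (pure a b)
  from vs vs t show ?case
    by (induct rule: tensor_induct)
      (use s in \<open>simp_all add: tensor_simps counit2_simps counit_mult HH.r_distr algebra_simps\<close>)
qed (use t in \<open>simp_all add: counit2_simps HH.l_distr algebra_simps\<close>)

lemma counit2_dagger2:
  assumes t: "t \<in> carrier HH"
  shows "counit2 (dagger2 t) = cnj (counit2 t)"
  using vs vs t
  by (induct rule: tensor_induct)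
    (simp_all add: dagger2_pure dagger2_add counit2_simps counit_dagger)

text \<open>Under \<epsilon> \<otimes> \<epsilon> both twists become 1, two factors
  \<epsilon>(\<gamma>\<inverse>) come from the left and one \<epsilon>(\<gamma>) from the coproduct,
  which leaves \<epsilon>(\<gamma>\<inverse>).\<close>

lemma coboundary_elt_one_imp_counit_gam:
  assumes "coboundary_elt = \<one>\<^bsub>HH\<^esub>"
  shows "counit H \<gamma> = 1"
proof -
  have i: "counit H (inv \<gamma>) * counit H \<gamma> = 1"
    using gam_unit by (simp add: counit_mult[symmetric] counit_one)
  have "counit2 coboundary_elt = counit H (inv \<gamma>) * counit H (inv \<gamma>) * counit H \<gamma>"
    by (simp add: coboundary_elt_def counit2_mult counit2_dagger2 counit2_simps)
  moreover have "counit2 coboundary_elt = 1"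
    by (simp add: assms tensor_simps counit2_simps counit_one)
  ultimately have "counit H (inv \<gamma>) = 1" using i by (simp add: mult.assoc)
  with i show ?thesis by simp
qed

lemma strong_bar_category_iff: "strong_bar_category B \<longleftrightarrow> strong_quasi_star_hopf_algebra H"
  unfolding strong_iff
proof
  assume "strong_bar_category B"
  then have "coboundary B V W = ident C (tensor_lmod H V W)" if "left_module H V" "left_module H W" for V W
    using strong_bar_category.strong[of B V W] that by simp
  moreover have R: "left_module H (regular H)" by (rule regular_module)
  ultimately have "coboundary B (regular H) (regular H)
      = ident C (tensor_lmod H (regular H) (regular H))" by blast
  \<comment> \<open>The coboundary map is the identity, so it fixes the unit of H \<otimes> H, on
    which the coboundary element acts by left multiplication.\<close>
  then have "outer_act (regular H) (regular H) coboundary_elt \<one>\<^bsub>HH\<^esub> = \<one>\<^bsub>HH\<^esub>"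
    using coboundary_hom_act(2)[OF R R, of "\<one>\<^bsub>HH\<^esub>"] by (simp add: tensor_regular)
  then show "coboundary_elt = \<one>\<^bsub>HH\<^esub>"
    using tensor_mult_eq_act[OF alg alg, of coboundary_elt "\<one>\<^bsub>HH\<^esub>"] by simp
next
  assume e: "coboundary_elt = \<one>\<^bsub>HH\<^esub>"
  \<comment> \<open>Triviality of the coboundary element supplies \<epsilon>(\<gamma>) = 1, and with
    it the bar category itself.\<close>
  show "strong_bar_category B"
  proof (rule strong_bar_category.intro[OF bar_category_lmod[OF coboundary_elt_one_imp_counit_gam[OF e]]],
      rule strong_bar_category_axioms.intro)
    fix V W assume "V \<in> Obj B" "W \<in> Obj B"
    then have V: "left_module H V" and W: "left_module H W" by auto
    interpret P: module_pair H H V W by (intro module_pair.intro alg V W)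
    have "coboundary B V W = ident C (tensor_lmod H V W)"
      by (rule module_hom_eqI[OF coboundary_hom_act(1)[OF V W]])
        (simp_all add: V W tensor_lmod_module coboundary_hom_act(2) e P.outer_act_one)
    then show "coboundary B V W = ident B (V \<boxtimes>\<^bsub>B\<^esub> W)" by simp
  qed
qed

end

theorem theorem3p6:
  fixes H :: "('a univ, 'b) quasi_star_hopf_scheme" (structure)
  assumes "quasi_star_hopf_algebra H"
  shows "(counit H \<gamma> = 1 \<longrightarrow> bar_category (bar_lmod_category H)) \<and>
    (\<forall>V W v w. left_module H V \<and> left_module H W \<and> v \<in> carrier V \<and> w \<in> carrier W \<longrightarrow>
       fn (Upsilon (bar_lmod_category H) V W) (pure V W v w) =
         sweedler (tensor (bar_lmod H W) (bar_lmod H V)) \<G> (\<lambda>g\<^sub>1 g\<^sub>2.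
           pure (bar_lmod H W) (bar_lmod H V) (g\<^sub>2 \<triangleright>\<^bsub>W\<^esub> w) (g\<^sub>1 \<triangleright>\<^bsub>V\<^esub> v))) \<and>
    (\<forall>V W v w. left_module H V \<and> left_module H W \<and> v \<in> carrier V \<and> w \<in> carrier W \<longrightarrow>
       fn (coboundary (bar_lmod_category H) V W) (pure V W v w) =
         sweedler (tensor V W) \<G> (\<lambda>g\<^sub>1 g\<^sub>2.
           sweedler (tensor V W) \<G> (\<lambda>g\<^sub>1' g\<^sub>2'.
             sweedler (tensor V W) (coprod H \<gamma>) (\<lambda>\<gamma>\<^sub>1 \<gamma>\<^sub>2.
               pure V W
                 ((inv \<gamma> \<otimes> star H (antipode H g\<^sub>2') \<otimes> g\<^sub>1 \<otimes> \<gamma>\<^sub>1) \<triangleright>\<^bsub>V\<^esub> v)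
                 ((inv \<gamma> \<otimes> star H (antipode H g\<^sub>1') \<otimes> g\<^sub>2 \<otimes> \<gamma>\<^sub>2) \<triangleright>\<^bsub>W\<^esub> w))))) \<and>
    (strong_bar_category (bar_lmod_category H) \<longleftrightarrow> strong_quasi_star_hopf_algebra H)"
proof -
  interpret quasi_star_hopf_algebra H by (rule assms)
  show ?thesis
    using bar_category_lmod strong_bar_category_iff
    by (auto simp: fn_Upsilon twisted_flip_pure vec_space_lmod coboundary_hom_act(2)
        outer_act_coboundary_elt dagger_def)
qed

end
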